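(* The minimum makespan problem on identical parallel machines $P||C_{\max}$ admits an efficient polynomial time approximation scheme (EPTAS) with running time $2^{O((1/\varepsilon)\log^4(1/\varepsilon))}+O(n\log n)$; that is, for every $\varepsilon>0$ there is an algorithm that, given an instance with $n$ jobs, computes an assignment with makespan at most $(1+\varepsilon)$ times the optimum within this running time.
   Context: $P||C_{\max}$: given $n$ jobs $\mathcal{J}$ with processing times $p_j\in\mathbb{Z}_{>0}$ and $m$ identical machines $\mathcal{M}$, find an assignment $a:\mathcal{J}\to\mathcal{M}$ minimizing the makespan $\max_{i\in\mathcal{M}}\sum_{j:a(j)=i}p_j$. *)

theory Defs
  imports Complex_Main "HOL-Library.FuncSet" "HOL-Library.Landau_Symbols"
begin

text \<open>
  Scheduling on identical machines. The jobs are \<open>0, \<dots>, n - 1\<close>, the machines are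
  \<open>0, \<dots>, m - 1\<close>, and \<open>p j\<close> is the processing time of job \<open>j\<close>.
\<close>

definition is_instance :: "nat \<Rightarrow> nat \<Rightarrow> (nat \<Rightarrow> int) \<Rightarrow> bool" where
  "is_instance n m p \<longleftrightarrow> m \<ge> 1 \<and> (\<forall>j<n. p j > 0)"

definition assignments :: "nat \<Rightarrow> nat \<Rightarrow> (nat \<Rightarrow> nat) set" where
  "assignments n m = {..<n} \<rightarrow>\<^sub>E {..<m}"

definition makespan :: "nat \<Rightarrow> nat \<Rightarrow> (nat \<Rightarrow> int) \<Rightarrow> (nat \<Rightarrow> nat) \<Rightarrow> int" where
  "makespan n m p a = Max ((\<lambda>i. \<Sum>j | j < n \<and> a j = i. p j) ` {..<m})"

definition opt_makespan :: "nat \<Rightarrow> nat \<Rightarrow> (nat \<Rightarrow> int) \<Rightarrow> int" where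
  "opt_makespan n m p = Min (makespan n m p ` assignments n m)"

text \<open>
  The machine model is the random access machine of Cook and Reckhow (Time bounded random
  access machines, 1973) under the uniform cost criterion: registers \<open>X\<^sub>0, X\<^sub>1, \<dots>\<close>
  hold integers, input is read from and output is written to a tape, and each instruction
  takes one time unit. The only arithmetic is addition and subtraction: with multiplication at
  unit cost, the uniform criterion would not be a realistic measure of time.
\<close>

datatype instr =
    Const nat int      \<comment> \<open>\<open>X\<^sub>r := c\<close>\<close>
  | Add nat nat nat    \<comment> \<open>\<open>X\<^sub>r := X\<^sub>s + X\<^sub>t\<close>\<close>
  | Sub nat nat nat    \<comment> \<open>\<open>X\<^sub>r := X\<^sub>s - X\<^sub>t\<close>\<close>
  | Load nat nat       \<comment> \<open>\<open>X\<^sub>r := X[X\<^sub>s]\<close>\<close>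
  | Store nat nat      \<comment> \<open>\<open>X[X\<^sub>r] := X\<^sub>s\<close>\<close>
  | Jump_Pos nat nat   \<comment> \<open>if \<open>X\<^sub>r > 0\<close> then continue at instruction \<open>l\<close>\<close>
  | Read nat           \<comment> \<open>\<open>X\<^sub>r :=\<close> next input symbol\<close>
  | Print nat          \<comment> \<open>append \<open>X\<^sub>r\<close> to the output\<close>

type_synonym program = "instr list"

datatype config = Config (pc: nat) (regs: "nat \<Rightarrow> int") (inp: "int list") (outp: "int list")

text \<open>
  \<^const>\<open>None\<close> is a failing computation: indirect access to a negative address or reading past
  the end of the input.
\<close>

fun exec :: "instr \<Rightarrow> config \<Rightarrow> config option" where
  "exec (Const r c) (Config i X xs ys) = Some (Config (i + 1) (X(r := c)) xs ys)"
| "exec (Add r s t) (Config i X xs ys) = Some (Config (i + 1) (X(r := X s + X t)) xs ys)"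
| "exec (Sub r s t) (Config i X xs ys) = Some (Config (i + 1) (X(r := X s - X t)) xs ys)"
| "exec (Load r s) (Config i X xs ys) =
     (if X s \<ge> 0 then Some (Config (i + 1) (X(r := X (nat (X s)))) xs ys) else None)"
| "exec (Store r s) (Config i X xs ys) =
     (if X r \<ge> 0 then Some (Config (i + 1) (X(nat (X r) := X s)) xs ys) else None)"
| "exec (Jump_Pos r l) (Config i X xs ys) =
     Some (Config (if X r > 0 then l else i + 1) X xs ys)"
| "exec (Read r) (Config i X xs ys) =
     (case xs of [] \<Rightarrow> None | x # xs' \<Rightarrow> Some (Config (i + 1) (X(r := x)) xs' ys))"
| "exec (Print r) (Config i X xs ys) = Some (Config (i + 1) X xs (ys @ [X r]))"

text \<open>
  The machine halts when the program counter leaves the program; a halted machine makes no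
  further steps, so the number of steps of a halting computation is unique.
\<close>

definition halted :: "program \<Rightarrow> config \<Rightarrow> bool" where
  "halted P c \<longleftrightarrow> length P \<le> pc c"

definition step :: "program \<Rightarrow> config \<Rightarrow> config option" where
  "step P c = (if halted P c then None else exec (P ! pc c) c)"

primrec steps :: "program \<Rightarrow> nat \<Rightarrow> config \<Rightarrow> config option" where
  "steps P 0 c = Some c"
| "steps P (Suc t) c = Option.bind (step P c) (steps P t)"

definition computes_in :: "program \<Rightarrow> int list \<Rightarrow> nat \<Rightarrow> int list \<Rightarrow> bool" where
  "computes_in P xs t ys \<longleftrightarrow>
     (\<exists>c. steps P t (Config 0 (\<lambda>_. 0) xs []) = Some c \<and> halted P c \<and> outp c = ys)"

text \<open>
  An approximation scheme is a single program that is also given the accuracy. As a real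
  number \<open>\<epsilon>\<close> is not a possible machine input, the program receives \<open>\<lceil>1/\<epsilon>\<rceil>\<close>. The algorithm for
  a particular \<open>\<epsilon>\<close> is the program with this first input fixed, so that nothing but this
  number is precomputed for it.
\<close>

definition encode_input :: "real \<Rightarrow> nat \<Rightarrow> nat \<Rightarrow> (nat \<Rightarrow> int) \<Rightarrow> int list" where
  "encode_input \<epsilon> n m p = [\<lceil>1 / \<epsilon>\<rceil>, int n, int m] @ map p [0..<n]"

definition encode_output :: "nat \<Rightarrow> (nat \<Rightarrow> nat) \<Rightarrow> int list" where
  "encode_output n a = map (\<lambda>j. int (a j)) [0..<n]"

definition approx_scheme_within :: "program \<Rightarrow> (real \<Rightarrow> nat \<Rightarrow> real) \<Rightarrow> bool" where
  "approx_scheme_within P T \<longleftrightarrow>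
     (\<forall>\<epsilon>>0. \<forall>n m p. is_instance n m p \<longrightarrow>
        (\<exists>t. \<exists>a\<in>assignments n m.
           computes_in P (encode_input \<epsilon> n m p) t (encode_output n a) \<and>
           real t \<le> T \<epsilon> n \<and>
           real_of_int (makespan n m p a) \<le> (1 + \<epsilon>) * real_of_int (opt_makespan n m p)))"

end

theory Submission imports Defs "HOL-Real_Asymp.Real_Asymp"
begin

text \<open>
  The large jobs are rounded to \<open>O((1/\<epsilon>) log (1/\<epsilon>))\<close> sizes; the small ones are added greedily at
  the end. What remains is the configuration program \<open>\<Sum>\<^sub>q x\<^sub>q q = b\<close>, where \<open>q\<close> ranges over the
  job vectors of single machines and a further coordinate counts the machines. If many \<open>x\<^sub>q\<close> are
  odd, then two disjoint sets of such configurations have the same sum by the pigeonhole principle,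
  and shifting one unit from the first set to the second makes their multiplicities even. Hence some
  solution is \<open>x = \<Sum>\<^sub>i 2\<^sup>i z\<^sub>i\<close> with 0/1-vectors \<open>z\<^sub>i\<close> of support polynomial in \<open>1/\<epsilon>\<close>, and adding
  up the \<open>z\<^sub>i\<close> in binary needs only carries with entries polynomial in \<open>1/\<epsilon>\<close>. Reachability in the
  resulting automaton takes time \<open>2\<^bsup>O((1/\<epsilon>) log\<^sup>2 (1/\<epsilon>))\<^esup>\<close> per bit, and there are only
  \<open>O(log n)\<close> bits. Products \<open>n f(1/\<epsilon>)\<close> with \<open>f(1/\<epsilon>) = O((1/\<epsilon>) log (1/\<epsilon>))\<close> are harmless: they
  are \<open>O(n log n)\<close> if \<open>f(1/\<epsilon>) \<le> log n\<close>, and \<open>2\<^bsup>O(f(1/\<epsilon>))\<^esup>\<close> otherwise.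
\<close>

text \<open>The makespan bound \<open>T\<close> needs no search that depends on the processing
  times: every rounded size is a multiple of \<open>dl\<close>, where \<open>K ^ 2 * dl\<close> is
  the scaled lower bound on the optimum, so at most \<open>2 * K ^ 2\<close> values of
  \<open>T\<close> matter. Sizes are rounded down, hence an optimal schedule stays feasible for the
  rounded jobs, and undoing the rounding costs a factor \<open>1 + 1 / K\<close> at the end. The
  size grid has \<open>K\<close> equal steps per doubling instead of a constant ratio, because
  thresholds must be computed exactly by additions. As the machine neither multiplies nor divides,
  \<open>K\<close> and all number bases are powers of two, and vectors are packed into single
  integers, with bases so large that digits never overflow. Carries stay small because adding fewer
  than \<open>N0\<close> configurations and halving leads from machine counts of at most
  \<open>N0\<close> back to machine counts of at most \<open>N0\<close>. The table has
  \<open>R ^ D\<close> cells per bit, with \<open>R\<close> polynomial in \<open>K\<close> and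
  \<open>D\<close> of order \<open>K log K\<close>, which lies well below the exponent asked
  for.\<close>

section \<open>A small imperative language with arrays and a cost semantics\<close>

datatype aexp = Num int | Var nat | Plus aexp aexp | Minus aexp aexp | Arr nat aexp

datatype com =
    Skip
  | Asg nat aexp
  | Put nat aexp aexp
  | Get nat
  | Out aexp
  | Seq com com (infixr "\<then>" 60)
  | Cond aexp com com
  | While aexp com

record store =
  vars :: "nat \<Rightarrow> int"
  arrs :: "nat \<Rightarrow> nat \<Rightarrow> int"
  inps :: "int list"
  outs :: "int list"

fun aval :: "aexp \<Rightarrow> store \<Rightarrow> int" where
  "aval (Num c) s = c"
| "aval (Var x) s = vars s x"
| "aval (Plus e f) s = aval e s + aval f s"
| "aval (Minus e f) s = aval e s - aval f s"
| "aval (Arr a e) s = arrs s a (nat (aval e s))"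

text \<open>Length of the compiled code, and hence a bound on its running time: expression code
  never jumps backwards, and its only jump, in \<open>addr\<close>, skips one instruction. The 12 of
  an array access are 11 address instructions and the load.\<close>

fun esize :: "aexp \<Rightarrow> nat" where
  "esize (Num c) = 1"
| "esize (Var x) = 2"
| "esize (Plus e f) = esize e + esize f + 1"
| "esize (Minus e f) = esize e + esize f + 1"
| "esize (Arr a e) = esize e + 12"

text \<open>The costs bound the time of the compiled code. The 3 charged at a test covers the
  conditional jump and one unconditional jump, which takes two instructions. A negative index means
  cell 0, as in the compiled code.\<close>

inductive exe :: "com \<Rightarrow> store \<Rightarrow> nat \<Rightarrow> store \<Rightarrow> bool" where
  exe_Skip: "exe Skip s 0 s"
| exe_Asg: "exe (Asg x e) s (esize e + 2) (s\<lparr>vars := (vars s)(x := aval e s)\<rparr>)"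
| exe_Put: "exe (Put a e f) s (esize e + esize f + 12)
    (s\<lparr>arrs := (arrs s)(a := (arrs s a)(nat (aval e s) := aval f s))\<rparr>)"
| exe_Get: "inps s = z # zs \<Longrightarrow>
    exe (Get x) s 1 (s\<lparr>vars := (vars s)(x := z), inps := zs\<rparr>)"
| exe_Out: "exe (Out e) s (esize e + 1) (s\<lparr>outs := outs s @ [aval e s]\<rparr>)"
| exe_Seq: "exe c s t s' \<Longrightarrow> exe d s' u s'' \<Longrightarrow> exe (c \<then> d) s (t + u) s''"
| exe_CondT: "aval e s > 0 \<Longrightarrow> exe c s t s' \<Longrightarrow> exe (Cond e c d) s (esize e + 3 + t) s'"
| exe_CondF: "aval e s \<le> 0 \<Longrightarrow> exe d s t s' \<Longrightarrow> exe (Cond e c d) s (esize e + 3 + t) s'"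
| exe_WhileF: "aval e s \<le> 0 \<Longrightarrow> exe (While e c) s (esize e + 3) s"
| exe_WhileT: "aval e s > 0 \<Longrightarrow> exe c s t s' \<Longrightarrow> exe (While e c) s' u s'' \<Longrightarrow>
    exe (While e c) s (esize e + 3 + t + u) s''"

subsection \<open>Compilation to the random access machine\<close>

text \<open>Variables live in the registers below 64, temporaries in the registers from 64 to 127, and
  cell \<open>i\<close> of array \<open>a\<close> in register \<open>128 (i + 1) + a\<close>. The jump turns a negative index into 0,
  so that no array access fails.\<close>

definition addr :: "nat \<Rightarrow> nat \<Rightarrow> nat \<Rightarrow> instr list" where
  "addr r a l = [Jump_Pos r (l + 2), Const r 0, Add r r r, Add r r r, Add r r r, Add r r r,
     Add r r r, Add r r r, Add r r r, Const (r + 1) (128 + int a), Add r r (r + 1)]"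

fun ecomp :: "aexp \<Rightarrow> nat \<Rightarrow> nat \<Rightarrow> instr list" where
  "ecomp (Num c) r l = [Const r c]"
| "ecomp (Var x) r l = [Const r 0, Add r r x]"
| "ecomp (Plus e f) r l = ecomp e r l @ ecomp f (r + 1) (l + esize e) @ [Add r r (r + 1)]"
| "ecomp (Minus e f) r l = ecomp e r l @ ecomp f (r + 1) (l + esize e) @ [Sub r r (r + 1)]"
| "ecomp (Arr a e) r l = ecomp e r l @ addr r a (l + esize e) @ [Load r r]"

text \<open>Number of temporaries occupied from the target register on; an array access takes a
  second one for the offset. The limit 60 in \<open>cwf\<close> keeps a computation that starts in
  register 64 or 65 below 128.\<close>

fun edepth :: "aexp \<Rightarrow> nat" where
  "edepth (Num c) = 1"
| "edepth (Var x) = 1"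
| "edepth (Plus e f) = max (edepth e) (edepth f + 1)"
| "edepth (Minus e f) = max (edepth e) (edepth f + 1)"
| "edepth (Arr a e) = max (edepth e) 2"

fun ewf :: "aexp \<Rightarrow> bool" where
  "ewf (Num c) = True"
| "ewf (Var x) = (x < 64)"
| "ewf (Plus e f) = (ewf e \<and> ewf f)"
| "ewf (Minus e f) = (ewf e \<and> ewf f)"
| "ewf (Arr a e) = (a < 128 \<and> ewf e)"

fun csize :: "com \<Rightarrow> nat" where
  "csize Skip = 0"
| "csize (Asg x e) = esize e + 2"
| "csize (Put a e f) = esize e + 11 + esize f + 1"
| "csize (Get x) = 1"
| "csize (Out e) = esize e + 1"
| "csize (c \<then> d) = csize c + csize d"
| "csize (Cond e c d) = esize e + 1 + csize d + 2 + csize c"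
| "csize (While e c) = esize e + 3 + csize c + 2"

text \<open>The machine only jumps on a positive register, so an unconditional jump first sets
  register 64 to 1. In a conditional the else branch comes first, because falling through means that
  the test failed.\<close>

fun comp :: "com \<Rightarrow> nat \<Rightarrow> program" where
  "comp Skip l = []"
| "comp (Asg x e) l = ecomp e 64 l @ [Const x 0, Add x x 64]"
| "comp (Put a e f) l = ecomp e 64 l @ addr 64 a (l + esize e) @
     ecomp f 65 (l + esize e + 11) @ [Store 64 65]"
| "comp (Get x) l = [Read x]"
| "comp (Out e) l = ecomp e 64 l @ [Print 64]"
| "comp (c \<then> d) l = comp c l @ comp d (l + csize c)"
| "comp (Cond e c d) l =
     (let l' = l + esize e + 1 + csize d + 2 in
      ecomp e 64 l @ [Jump_Pos 64 l'] @ comp d (l + esize e + 1) @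
      [Const 64 1, Jump_Pos 64 (l' + csize c)] @ comp c l')"
| "comp (While e c) l =
     ecomp e 64 l @ [Jump_Pos 64 (l + esize e + 3), Const 64 1,
       Jump_Pos 64 (l + esize e + 3 + csize c + 2)] @
     comp c (l + esize e + 3) @ [Const 64 1, Jump_Pos 64 l]"

fun cwf :: "com \<Rightarrow> bool" where
  "cwf Skip = True"
| "cwf (Asg x e) = (x < 64 \<and> ewf e \<and> edepth e \<le> 60)"
| "cwf (Put a e f) = (a < 128 \<and> ewf e \<and> edepth e \<le> 60 \<and> ewf f \<and> edepth f \<le> 60)"
| "cwf (Get x) = (x < 64)"
| "cwf (Out e) = (ewf e \<and> edepth e \<le> 60)"
| "cwf (c \<then> d) = (cwf c \<and> cwf d)"
| "cwf (Cond e c d) = (ewf e \<and> edepth e \<le> 60 \<and> cwf c \<and> cwf d)"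
| "cwf (While e c) = (ewf e \<and> edepth e \<le> 60 \<and> cwf c)"

lemma length_addr [simp]: "length (addr r a l) = 11"
  by (simp add: addr_def)

lemma length_ecomp [simp]: "length (ecomp e r l) = esize e"
  by (induction e arbitrary: r l) auto

lemma length_comp [simp]: "length (comp c l) = csize c"
  by (induction c arbitrary: l) (auto simp: Let_def)

definition code_at :: "program \<Rightarrow> nat \<Rightarrow> instr list \<Rightarrow> bool" where
  "code_at P l is \<longleftrightarrow> (\<forall>i<length is. l + i < length P \<and> P ! (l + i) = is ! i)"

lemma code_at_Nil [simp]: "code_at P l []"
  by (simp add: code_at_def)

lemma code_at_Cons [simp]:
  "code_at P l (x # xs) \<longleftrightarrow> l < length P \<and> P ! l = x \<and> code_at P (Suc l) xs"
  by (auto simp: code_at_def nth_Cons less_Suc_eq_0_disj split: nat.splits)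

lemma code_at_append [simp]:
  "code_at P l (xs @ ys) \<longleftrightarrow> code_at P l xs \<and> code_at P (l + length xs) ys"
  by (induction xs arbitrary: l) auto

text \<open>An upper bound instead of the exact number of steps lets the uniform charges of
  \<open>exe\<close> cover branches of different length.\<close>

definition reaches :: "program \<Rightarrow> config \<Rightarrow> nat \<Rightarrow> config \<Rightarrow> bool" where
  "reaches P c t c' \<longleftrightarrow> (\<exists>t'\<le>t. steps P t' c = Some c')"

lemma steps_add: "steps P (t + u) c = Option.bind (steps P t c) (steps P u)"
  by (induction t arbitrary: c) (auto simp: bind_assoc split: bind_splits)

lemma reaches_refl [simp]: "reaches P c t c"
  unfolding reaches_def by (rule exI[of _ 0]) simp

lemma reaches_trans:
  "reaches P c t c' \<Longrightarrow> reaches P c' u c'' \<Longrightarrow> t + u \<le> v \<Longrightarrow> reaches P c v c''"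
  unfolding reaches_def
proof safe
  fix t' u' assume *: "t + u \<le> v" "t' \<le> t" "u' \<le> u" "steps P t' c = Some c'" "steps P u' c' = Some c''"
  have "steps P (t' + u') c = Some c''" by (simp add: steps_add *)
  with * show "\<exists>w\<le>v. steps P w c = Some c''" by (intro exI[of _ "t' + u'"]) auto
qed

lemma reaches_step:
  assumes "l < length P" "exec (P ! l) (Config l X xs ys) = Some c'" "reaches P c' t c''"
  shows "reaches P (Config l X xs ys) (Suc t) c''"
proof -
  have "reaches P (Config l X xs ys) 1 c'"
    unfolding reaches_def using assms by (intro exI[of _ 1]) (auto simp: step_def halted_def)
  from reaches_trans[OF this assms(3)] show ?thesis by simp
qed

text \<open>Registers 64 to 127 are left unconstrained, so that expressions and unconditional jumps
  may overwrite them.\<close>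

definition sim :: "store \<Rightarrow> (nat \<Rightarrow> int) \<Rightarrow> bool" where
  "sim s X \<longleftrightarrow> (\<forall>x<64. X x = vars s x) \<and> (\<forall>a<128. \<forall>i. X (128 * (i + 1) + a) = arrs s a i)"

lemma sim_temps:
  assumes "sim s X" "\<And>y. y < 64 \<or> 128 \<le> y \<Longrightarrow> X' y = X y"
  shows "sim s X'"
  using assms by (auto simp: sim_def)

lemma reaches_step_pos:
  assumes "l < length P" "exec (P ! l) (Config l X xs ys) = Some c'" "t > 0"
    "reaches P c' (t - 1) c''"
  shows "reaches P (Config l X xs ys) t c''"
  using reaches_step[OF assms(1,2,4)] assms(3) by simp

lemma reaches_eq: "c = c' \<Longrightarrow> reaches P c t c'"
  by simp

text \<open>Seven doublings multiply the index by 128; replacing a nonpositive index by 0 beforehand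
  is what turns \<open>X r\<close> into \<open>nat (X r)\<close>.\<close>

lemma addr_correct:
  assumes "code_at P l (addr r a l)"
  shows "\<exists>X'. reaches P (Config l X xs ys) 11 (Config (l + 11) X' xs ys) \<and>
     X' r = int (128 * (nat (X r) + 1) + a) \<and> (\<forall>y. y \<noteq> r \<and> y \<noteq> r + 1 \<longrightarrow> X' y = X y)"
proof (rule exI, rule conjI)
  let ?X = "X(Suc r := 128 + int a, r := int (128 * (nat (X r) + 1) + a))"
  note code = assms[unfolded addr_def, simplified]
  show "reaches P (Config l X xs ys) 11 (Config (l + 11) ?X xs ys)"
  proof (cases "X r > 0")
    case True
    then show ?thesis
      using code by - ((rule reaches_step_pos, simp, simp, simp)+, rule reaches_eq, force)
  next
    case False
    then show ?thesis
      using code by - ((rule reaches_step_pos, simp, simp, simp)+, rule reaches_eq, force)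
  qed
qed auto

lemma ecomp_correct:
  assumes "sim s X" "code_at P l (ecomp e r l)" "ewf e" "64 \<le> r" "r + edepth e \<le> 128"
  shows "\<exists>X'. reaches P (Config l X xs ys) (esize e) (Config (l + esize e) X' xs ys) \<and>
     X' r = aval e s \<and> (\<forall>y. y < r \<or> 128 \<le> y \<longrightarrow> X' y = X y)"
  using assms
proof (induction e arbitrary: X r l)
  case (Num c)
  then have "reaches P (Config l X xs ys) (esize (Num c)) (Config (l + esize (Num c)) (X(r := c)) xs ys)"
    by - (simp, (rule reaches_step_pos, simp, simp, simp)+, rule reaches_eq, simp)
  moreover have "(X(r := c)) r = aval (Num c) s" "\<forall>y. y < r \<or> 128 \<le> y \<longrightarrow> (X(r := c)) y = X y"
    using Num.prems by auto
  ultimately show ?case by blast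
next
  case (Var x)
  then have "reaches P (Config l X xs ys) (esize (Var x)) (Config (l + esize (Var x)) (X(r := X x)) xs ys)"
    by - (simp, (rule reaches_step_pos, simp, simp, simp)+, rule reaches_eq, auto)
  moreover have "(X(r := X x)) r = aval (Var x) s" "\<forall>y. y < r \<or> 128 \<le> y \<longrightarrow> (X(r := X x)) y = X y"
    using Var.prems by (auto simp: sim_def)
  ultimately show ?case by blast
next
  case (Plus e f)
  from Plus.prems have d: "r + edepth e \<le> 128" "r + 1 + edepth f \<le> 128" by simp_all
  with Plus.IH(1)[of X l r] Plus.prems obtain X1 where
    1: "reaches P (Config l X xs ys) (esize e) (Config (l + esize e) X1 xs ys)"
    "X1 r = aval e s" "\<forall>y. y < r \<or> 128 \<le> y \<longrightarrow> X1 y = X y" by auto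
  have "sim s X1" by (rule sim_temps[OF Plus.prems(1)]) (use 1(3) Plus.prems in auto)
  with Plus.IH(2)[of X1 "l + esize e" "r + 1"] Plus.prems d obtain X2 where
    2: "reaches P (Config (l + esize e) X1 xs ys) (esize f) (Config (l + esize e + esize f) X2 xs ys)"
    "X2 (r + 1) = aval f s" "\<forall>y. y < r + 1 \<or> 128 \<le> y \<longrightarrow> X2 y = X1 y" by auto
  let ?X = "X2(r := X2 r + X2 (r + 1))"
  have 3: "reaches P (Config (l + esize e + esize f) X2 xs ys) 1 (Config (l + esize (Plus e f)) ?X xs ys)"
    using Plus.prems by - (rule reaches_step_pos, simp add: add.assoc, simp add: add.assoc, simp, rule reaches_eq, simp add: add.assoc)
  have "reaches P (Config l X xs ys) (esize (Plus e f)) (Config (l + esize (Plus e f)) ?X xs ys)"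
    by (rule reaches_trans[OF reaches_trans[OF 1(1) 2(1) order_refl] 3]) simp
  moreover have "?X r = aval (Plus e f) s" "\<forall>y. y < r \<or> 128 \<le> y \<longrightarrow> ?X y = X y"
    using 1 2 Plus.prems by auto
  ultimately show ?case by blast
next
  case (Minus e f)
  from Minus.prems have d: "r + edepth e \<le> 128" "r + 1 + edepth f \<le> 128" by simp_all
  with Minus.IH(1)[of X l r] Minus.prems obtain X1 where
    1: "reaches P (Config l X xs ys) (esize e) (Config (l + esize e) X1 xs ys)"
    "X1 r = aval e s" "\<forall>y. y < r \<or> 128 \<le> y \<longrightarrow> X1 y = X y" by auto
  have "sim s X1" by (rule sim_temps[OF Minus.prems(1)]) (use 1(3) Minus.prems in auto)
  with Minus.IH(2)[of X1 "l + esize e" "r + 1"] Minus.prems d obtain X2 where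
    2: "reaches P (Config (l + esize e) X1 xs ys) (esize f) (Config (l + esize e + esize f) X2 xs ys)"
    "X2 (r + 1) = aval f s" "\<forall>y. y < r + 1 \<or> 128 \<le> y \<longrightarrow> X2 y = X1 y" by auto
  let ?X = "X2(r := X2 r - X2 (r + 1))"
  have 3: "reaches P (Config (l + esize e + esize f) X2 xs ys) 1 (Config (l + esize (Minus e f)) ?X xs ys)"
    using Minus.prems by - (rule reaches_step_pos, simp add: add.assoc, simp add: add.assoc, simp, rule reaches_eq, simp add: add.assoc)
  have "reaches P (Config l X xs ys) (esize (Minus e f)) (Config (l + esize (Minus e f)) ?X xs ys)"
    by (rule reaches_trans[OF reaches_trans[OF 1(1) 2(1) order_refl] 3]) simp
  moreover have "?X r = aval (Minus e f) s" "\<forall>y. y < r \<or> 128 \<le> y \<longrightarrow> ?X y = X y"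
    using 1 2 Minus.prems by auto
  ultimately show ?case by blast
next
  case (Arr a e)
  have "r + edepth e \<le> 128" using Arr.prems by simp
  with Arr.IH[of X l r] Arr.prems obtain X1 where
    1: "reaches P (Config l X xs ys) (esize e) (Config (l + esize e) X1 xs ys)"
    "X1 r = aval e s" "\<forall>y. y < r \<or> 128 \<le> y \<longrightarrow> X1 y = X y" by auto
  from addr_correct[of P "l + esize e" r a X1 xs ys] Arr.prems obtain X2 where
    2: "reaches P (Config (l + esize e) X1 xs ys) 11 (Config (l + esize e + 11) X2 xs ys)"
    "X2 r = int (128 * (nat (X1 r) + 1) + a)" "\<forall>y. y \<noteq> r \<and> y \<noteq> r + 1 \<longrightarrow> X2 y = X1 y" by auto
  have d: "r + 1 < 128" using Arr.prems by simp
  have "X2 (128 * (nat (X1 r) + 1) + a) = X (128 * (nat (X1 r) + 1) + a)"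
    using 1(3) 2(3) d by auto
  also have "\<dots> = aval (Arr a e) s" using Arr.prems 1(2) unfolding sim_def by simp
  finally have 3: "X2 (nat (X2 r)) = aval (Arr a e) s" using 2(2) by (metis nat_int)
  let ?X = "X2(r := X2 (nat (X2 r)))"
  have "X2 r \<ge> 0" unfolding 2(2) by (rule of_nat_0_le_iff)
  then have 4: "reaches P (Config (l + esize e + 11) X2 xs ys) 1 (Config (l + esize (Arr a e)) ?X xs ys)"
    using Arr.prems by - (rule reaches_step_pos, simp add: add.assoc, simp add: add.assoc, simp, rule reaches_eq, simp add: add.assoc)
  have "reaches P (Config l X xs ys) (esize (Arr a e)) (Config (l + esize (Arr a e)) ?X xs ys)"
    by (rule reaches_trans[OF reaches_trans[OF 1(1) 2(1) order_refl] 4]) simp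
  moreover have "?X r = aval (Arr a e) s" "\<forall>y. y < r \<or> 128 \<le> y \<longrightarrow> ?X y = X y"
    using 2 3 d 1 Arr.prems by auto
  ultimately show ?case by blast
qed

lemma reaches_goto:
  assumes "code_at P l [Const r 1, Jump_Pos r l']"
  shows "reaches P (Config l X xs ys) 2 (Config l' (X(r := 1)) xs ys)"
  using assms by - ((rule reaches_step_pos, simp, simp, simp)+, rule reaches_eq, simp)

lemma reaches_no_jump:
  assumes "code_at P l [Jump_Pos r l']" "\<not> X r > 0"
  shows "reaches P (Config l X xs ys) 1 (Config (l + 1) X xs ys)"
  using assms by - ((rule reaches_step_pos, simp, simp, simp)+, rule reaches_eq, simp)

lemma reaches_store:
  assumes "code_at P l [Store r r']" "X r \<ge> 0"
  shows "reaches P (Config l X xs ys) 1 (Config (l + 1) (X(nat (X r) := X r')) xs ys)"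
  using assms by - ((rule reaches_step_pos, simp, simp, simp)+, rule reaches_eq, simp)

lemma reaches_read:
  assumes "code_at P l [Read x]"
  shows "reaches P (Config l X (z # zs) ys) 1 (Config (l + 1) (X(x := z)) zs ys)"
  using assms by - ((rule reaches_step_pos, simp, simp, simp)+, rule reaches_eq, simp)

text \<open>The arrays are interleaved: the residue modulo 128 names the array, so an update of one
  cell disturbs no other.\<close>

lemma array_address_inject:
  fixes a b i j :: nat
  assumes "a < 128" "b < 128"
  shows "128 * (i + 1) + b = 128 * (j + 1) + a \<longleftrightarrow> i = j \<and> b = a"
proof
  assume eq: "128 * (i + 1) + b = 128 * (j + 1) + a"
  have "b = (128 * (i + 1) + b) mod 128" "a = (128 * (j + 1) + a) mod 128"
    using assms by (simp_all only: mod_mult_self4 mod_less)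
  with eq have "b = a" by metis
  with eq show "i = j \<and> b = a" by simp
qed simp

text \<open>The induction follows the derivation of \<open>exe\<close>, so the loop case may use the
  claim for the remaining iterations at the same start address \<open>l\<close>, to which the final
  jump returns.\<close>

lemma comp_correct:
  assumes "exe c s t s'" "sim s X" "code_at P l (comp c l)" "cwf c"
  shows "\<exists>X'. reaches P (Config l X (inps s) (outs s)) t (Config (l + csize c) X' (inps s') (outs s')) \<and>
     sim s' X'"
  using assms
proof (induction arbitrary: X l rule: exe.induct)
  case (exe_Skip s)
  then show ?case by (auto intro: exI[of _ X])
next
  case (exe_Asg x e s)
  from ecomp_correct[of s X P l e 64 "inps s" "outs s"] exe_Asg obtain X1 where
    1: "reaches P (Config l X (inps s) (outs s)) (esize e) (Config (l + esize e) X1 (inps s) (outs s))"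
    "X1 64 = aval e s" "\<forall>y. y < 64 \<or> 128 \<le> y \<longrightarrow> X1 y = X y" by auto
  let ?X = "X1(x := X1 64)"
  have "reaches P (Config (l + esize e) X1 (inps s) (outs s)) 2 (Config (l + csize (Asg x e)) ?X (inps s) (outs s))"
    using exe_Asg.prems by - (simp, (rule reaches_step_pos, simp, simp, simp)+, rule reaches_eq, auto)
  from reaches_trans[OF 1(1) this order_refl]
  have "reaches P (Config l X (inps s) (outs s)) (esize e + 2) (Config (l + csize (Asg x e)) ?X
    (inps (s\<lparr>vars := (vars s)(x := aval e s)\<rparr>)) (outs (s\<lparr>vars := (vars s)(x := aval e s)\<rparr>)))" by simp
  moreover have "sim (s\<lparr>vars := (vars s)(x := aval e s)\<rparr>) ?X"
    using sim_temps[OF exe_Asg.prems(1), of X1] 1(2,3) exe_Asg.prems(3) by (auto simp: sim_def)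
  ultimately show ?case by blast
next
  case (exe_Put a e f s)
  from ecomp_correct[of s X P l e 64 "inps s" "outs s"] exe_Put obtain X1 where
    1: "reaches P (Config l X (inps s) (outs s)) (esize e) (Config (l + esize e) X1 (inps s) (outs s))"
    "X1 64 = aval e s" "\<forall>y. y < 64 \<or> 128 \<le> y \<longrightarrow> X1 y = X y" by auto
  from addr_correct[of P "l + esize e" 64 a X1 "inps s" "outs s"] exe_Put.prems obtain X2 where
    2: "reaches P (Config (l + esize e) X1 (inps s) (outs s)) 11 (Config (l + esize e + 11) X2 (inps s) (outs s))"
    "X2 64 = int (128 * (nat (X1 64) + 1) + a)" "\<forall>y. y \<noteq> 64 \<and> y \<noteq> 65 \<longrightarrow> X2 y = X1 y" by auto
  have s2: "sim s X2" by (rule sim_temps[OF exe_Put.prems(1)]) (use 1(3) 2(3) in auto)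
  with ecomp_correct[of s X2 P "l + esize e + 11" f 65 "inps s" "outs s"] exe_Put.prems obtain X3 where
    3: "reaches P (Config (l + esize e + 11) X2 (inps s) (outs s)) (esize f)
          (Config (l + esize e + 11 + esize f) X3 (inps s) (outs s))"
    "X3 65 = aval f s" "\<forall>y. y < 65 \<or> 128 \<le> y \<longrightarrow> X3 y = X2 y" by auto
  have s3: "sim s X3" by (rule sim_temps[OF s2]) (use 3(3) in auto)
  have a3: "X3 64 = int (128 * (nat (aval e s) + 1) + a)" using 2(2) 3(3) 1(2) by simp
  have nonneg: "X3 64 \<ge> 0" unfolding a3 by (rule of_nat_0_le_iff)
  have adr: "nat (X3 64) = 128 * (nat (aval e s) + 1) + a" unfolding a3 by (rule nat_int)
  have a: "a < 128" using exe_Put.prems(3) by simp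
  let ?X = "X3(nat (X3 64) := X3 65)"
  let ?s = "s\<lparr>arrs := (arrs s)(a := (arrs s a)(nat (aval e s) := aval f s))\<rparr>"
  have "code_at P (l + esize e + 11 + esize f) [Store 64 65]"
    using exe_Put.prems(2) by (simp add: add_ac)
  from reaches_trans[OF reaches_trans[OF reaches_trans[OF 1(1) 2(1) order_refl] 3(1) order_refl]
      reaches_store[of _ _ _ _ X3, OF this nonneg] order_refl]
  have "reaches P (Config l X (inps s) (outs s)) (esize e + esize f + 12)
      (Config (l + csize (Put a e f)) ?X (inps ?s) (outs ?s))"
    by (simp add: add_ac)
  moreover have "sim ?s ?X"
    unfolding sim_def adr
  proof (intro conjI allI impI)
    fix x :: nat assume "x < 64"
    then show "(X3(128 * (nat (aval e s) + 1) + a := X3 65)) x = vars ?s x"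
      using s3 by (simp add: sim_def)
  next
    fix b i :: nat assume b: "b < 128"
    show "(X3(128 * (nat (aval e s) + 1) + a := X3 65)) (128 * (i + 1) + b) = arrs ?s b i"
      unfolding fun_upd_apply array_address_inject[OF a b] using s3 b 3(2)
      by (auto simp: sim_def fun_upd_apply)
  qed
  ultimately show ?case by blast
next
  case (exe_Get s z zs x)
  then have "code_at P l [Read x]" by simp
  from reaches_read[OF this, of X z zs "outs s"]
  have "reaches P (Config l X (inps s) (outs s)) 1 (Config (l + csize (Get x)) (X(x := z))
      (inps (s\<lparr>vars := (vars s)(x := z), inps := zs\<rparr>)) (outs (s\<lparr>vars := (vars s)(x := z), inps := zs\<rparr>)))"
    using exe_Get.hyps by simp
  moreover have "sim (s\<lparr>vars := (vars s)(x := z), inps := zs\<rparr>) (X(x := z))"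
    using exe_Get.prems by (auto simp: sim_def)
  ultimately show ?case by blast
next
  case (exe_Out e s)
  from ecomp_correct[of s X P l e 64 "inps s" "outs s"] exe_Out obtain X1 where
    1: "reaches P (Config l X (inps s) (outs s)) (esize e) (Config (l + esize e) X1 (inps s) (outs s))"
    "X1 64 = aval e s" "\<forall>y. y < 64 \<or> 128 \<le> y \<longrightarrow> X1 y = X y" by auto
  have "reaches P (Config (l + esize e) X1 (inps s) (outs s)) 1
     (Config (l + csize (Out e)) X1 (inps s) (outs s @ [aval e s]))"
    using exe_Out.prems 1(2) by - (rule reaches_step_pos, simp add: add_ac, simp add: add_ac, simp, rule reaches_eq, simp add: add_ac)
  from reaches_trans[OF 1(1) this order_refl] show ?case
    using sim_temps[OF exe_Out.prems(1) 1(3)[rule_format]]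
    by (intro exI[of _ X1]) (auto simp: sim_def)
next
  case (exe_Seq c s t s' d u s'')
  from exe_Seq.IH(1)[of X l] exe_Seq.prems obtain X1 where
    1: "reaches P (Config l X (inps s) (outs s)) t (Config (l + csize c) X1 (inps s') (outs s'))" "sim s' X1"
    by auto
  from exe_Seq.IH(2)[of X1 "l + csize c"] exe_Seq.prems 1(2) obtain X2 where
    2: "reaches P (Config (l + csize c) X1 (inps s') (outs s')) u
      (Config (l + csize c + csize d) X2 (inps s'') (outs s''))" "sim s'' X2"
    by auto
  from reaches_trans[OF 1(1) 2(1) order_refl] 2(2) show ?case
    by (auto simp: add.assoc intro!: exI[of _ X2])
next
  case (exe_CondT e s c t s' d)
  let ?l = "l + esize e + 1 + csize d + 2"
  from ecomp_correct[of s X P l e 64 "inps s" "outs s"] exe_CondT.prems obtain X1 where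
    1: "reaches P (Config l X (inps s) (outs s)) (esize e) (Config (l + esize e) X1 (inps s) (outs s))"
    "X1 64 = aval e s" "\<forall>y. y < 64 \<or> 128 \<le> y \<longrightarrow> X1 y = X y" by (auto simp: Let_def)
  have 2: "reaches P (Config (l + esize e) X1 (inps s) (outs s)) 1 (Config ?l X1 (inps s) (outs s))"
    using exe_CondT.prems exe_CondT.hyps 1(2) by - (rule reaches_step_pos, simp add: Let_def, simp add: Let_def, simp, rule reaches_eq, simp add: Let_def)
  have s1: "sim s X1" by (rule sim_temps[OF exe_CondT.prems(1)]) (use 1(3) in auto)
  have "code_at P ?l (comp c ?l)" using exe_CondT.prems by (simp add: Let_def)
  with exe_CondT.IH[OF s1] exe_CondT.prems obtain X2 where
    3: "reaches P (Config ?l X1 (inps s) (outs s)) t (Config (?l + csize c) X2 (inps s') (outs s'))" "sim s' X2"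
    by (metis cwf.simps(7))
  have "reaches P (Config l X (inps s) (outs s)) (esize e + 3 + t) (Config (?l + csize c) X2 (inps s') (outs s'))"
    by (rule reaches_trans[OF reaches_trans[OF 1(1) 2 order_refl] 3(1)]) simp
  then show ?case using 3(2) by (auto simp: add_ac intro!: exI[of _ X2])
next
  case (exe_CondF e s d t s' c)
  let ?l = "l + esize e + 1"
  from ecomp_correct[of s X P l e 64 "inps s" "outs s"] exe_CondF.prems obtain X1 where
    1: "reaches P (Config l X (inps s) (outs s)) (esize e) (Config (l + esize e) X1 (inps s) (outs s))"
    "X1 64 = aval e s" "\<forall>y. y < 64 \<or> 128 \<le> y \<longrightarrow> X1 y = X y" by (auto simp: Let_def)
  have 2: "reaches P (Config (l + esize e) X1 (inps s) (outs s)) 1 (Config ?l X1 (inps s) (outs s))"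
    using exe_CondF.prems exe_CondF.hyps 1(2) by - (rule reaches_step_pos, simp add: Let_def, simp add: Let_def, simp, rule reaches_eq, simp add: Let_def)
  have s1: "sim s X1" by (rule sim_temps[OF exe_CondF.prems(1)]) (use 1(3) in auto)
  have "code_at P ?l (comp d ?l)" using exe_CondF.prems by (simp add: Let_def)
  with exe_CondF.IH[OF s1] exe_CondF.prems obtain X2 where
    3: "reaches P (Config ?l X1 (inps s) (outs s)) t (Config (?l + csize d) X2 (inps s') (outs s'))" "sim s' X2"
    by (metis cwf.simps(7))
  let ?X = "X2(64 := 1)"
  have 4: "reaches P (Config (?l + csize d) X2 (inps s') (outs s')) 2
      (Config (l + csize (Cond e c d)) ?X (inps s') (outs s'))"
    by (rule reaches_goto) (use exe_CondF.prems(2) in \<open>simp add: Let_def add_ac\<close>)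
  have "reaches P (Config l X (inps s) (outs s)) (esize e + 3 + t) (Config (l + csize (Cond e c d)) ?X (inps s') (outs s'))"
    by (rule reaches_trans[OF reaches_trans[OF reaches_trans[OF 1(1) 2 order_refl] 3(1) order_refl] 4]) simp
  moreover have "sim s' ?X" using 3(2) by (simp add: sim_def)
  ultimately show ?case by blast
next
  case (exe_WhileF e s c)
  from ecomp_correct[of s X P l e 64 "inps s" "outs s"] exe_WhileF.prems obtain X1 where
    1: "reaches P (Config l X (inps s) (outs s)) (esize e) (Config (l + esize e) X1 (inps s) (outs s))"
    "X1 64 = aval e s" "\<forall>y. y < 64 \<or> 128 \<le> y \<longrightarrow> X1 y = X y" by auto
  have s1: "sim s X1" by (rule sim_temps[OF exe_WhileF.prems(1)]) (use 1(3) in auto)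
  let ?X = "X1(64 := 1)"
  have 2: "reaches P (Config (l + esize e) X1 (inps s) (outs s)) 1 (Config (l + esize e + 1) X1 (inps s) (outs s))"
  proof (rule reaches_no_jump)
    show "code_at P (l + esize e) [Jump_Pos 64 (l + esize e + 3)]" using exe_WhileF.prems(2) by simp
    show "\<not> X1 64 > 0" using exe_WhileF.hyps 1(2) by simp
  qed
  have 3: "reaches P (Config (l + esize e + 1) X1 (inps s) (outs s)) 2
      (Config (l + csize (While e c)) ?X (inps s) (outs s))"
    by (rule reaches_goto) (use exe_WhileF.prems(2) in \<open>simp add: numeral_eq_Suc\<close>)
  have "reaches P (Config l X (inps s) (outs s)) (esize e + 3) (Config (l + csize (While e c)) ?X (inps s) (outs s))"
    by (rule reaches_trans[OF reaches_trans[OF 1(1) 2 order_refl] 3]) simp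
  moreover have "sim s ?X" using s1 by (simp add: sim_def)
  ultimately show ?case by blast
next
  case (exe_WhileT e s c t s' u s'')
  let ?l = "l + esize e + 3"
  from ecomp_correct[of s X P l e 64 "inps s" "outs s"] exe_WhileT.prems obtain X1 where
    1: "reaches P (Config l X (inps s) (outs s)) (esize e) (Config (l + esize e) X1 (inps s) (outs s))"
    "X1 64 = aval e s" "\<forall>y. y < 64 \<or> 128 \<le> y \<longrightarrow> X1 y = X y" by auto
  have s1: "sim s X1" by (rule sim_temps[OF exe_WhileT.prems(1)]) (use 1(3) in auto)
  have 2: "reaches P (Config (l + esize e) X1 (inps s) (outs s)) 1 (Config ?l X1 (inps s) (outs s))"
    using exe_WhileT.prems exe_WhileT.hyps 1(2) by - (rule reaches_step_pos, simp add: add_ac, simp add: add_ac, simp, rule reaches_eq, simp add: add_ac)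
  have "code_at P ?l (comp c ?l)" using exe_WhileT.prems by (simp add: numeral_eq_Suc)
  with exe_WhileT.IH(1)[OF s1] exe_WhileT.prems obtain X2 where
    3: "reaches P (Config ?l X1 (inps s) (outs s)) t (Config (?l + csize c) X2 (inps s') (outs s'))" "sim s' X2"
    by (metis cwf.simps(8))
  let ?X = "X2(64 := 1)"
  have 4: "reaches P (Config (?l + csize c) X2 (inps s') (outs s')) 2 (Config l ?X (inps s') (outs s'))"
    by (rule reaches_goto) (use exe_WhileT.prems(2) in \<open>simp add: numeral_eq_Suc\<close>)
  have "sim s' ?X" using 3(2) by (simp add: sim_def)
  from exe_WhileT.IH(2)[OF this exe_WhileT.prems(2,3)] obtain X3 where
    5: "reaches P (Config l ?X (inps s') (outs s')) u (Config (l + csize (While e c)) X3 (inps s'') (outs s''))"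
    "sim s'' X3" by blast
  have "reaches P (Config l X (inps s) (outs s)) (esize e + 3 + t + u)
      (Config (l + csize (While e c)) X3 (inps s'') (outs s''))"
    by (rule reaches_trans[OF reaches_trans[OF reaches_trans[OF reaches_trans[OF
      1(1) 2 order_refl] 3(1) order_refl] 4 order_refl] 5(1)]) simp
  then show ?case using 5(2) by blast
qed

definition initial :: "int list \<Rightarrow> store" where
  "initial xs = \<lparr>vars = \<lambda>_. 0, arrs = \<lambda>_ _. 0, inps = xs, outs = []\<rparr>"

lemma comp_computes:
  assumes "exe c (initial xs) t s" "cwf c"
  shows "\<exists>t'\<le>t. computes_in (comp c 0) xs t' (outs s)"
proof -
  have "sim (initial xs) (\<lambda>_. 0)" by (simp add: sim_def initial_def)
  moreover have "code_at (comp c 0) 0 (comp c 0)" by (simp add: code_at_def)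
  ultimately obtain X' where "reaches (comp c 0) (Config 0 (\<lambda>_. 0) (inps (initial xs)) (outs (initial xs))) t
      (Config (0 + csize c) X' (inps s) (outs s))"
    using comp_correct[OF assms(1) _ _ assms(2)] by blast
  then obtain t' where "t' \<le> t" "steps (comp c 0) t' (Config 0 (\<lambda>_. 0) xs []) = Some (Config (csize c) X' (inps s) (outs s))"
    unfolding reaches_def by (auto simp: initial_def)
  then show ?thesis
    unfolding computes_in_def halted_def by (intro exI[of _ t']) simp
qed

subsection \<open>Total correctness with time bounds\<close>

fun mvars :: "com \<Rightarrow> nat set" where
  "mvars Skip = {}"
| "mvars (Asg x e) = {x}"
| "mvars (Put a e f) = {}"
| "mvars (Get x) = {x}"
| "mvars (Out e) = {}"
| "mvars (c \<then> d) = mvars c \<union> mvars d"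
| "mvars (Cond e c d) = mvars c \<union> mvars d"
| "mvars (While e c) = mvars c"

fun marrs :: "com \<Rightarrow> nat set" where
  "marrs (Put a e f) = {a}"
| "marrs (c \<then> d) = marrs c \<union> marrs d"
| "marrs (Cond e c d) = marrs c \<union> marrs d"
| "marrs (While e c) = marrs c"
| "marrs _ = {}"

fun gets :: "com \<Rightarrow> bool" where
  "gets (Get x) = True"
| "gets (c \<then> d) = (gets c \<or> gets d)"
| "gets (Cond e c d) = (gets c \<or> gets d)"
| "gets (While e c) = gets c"
| "gets _ = False"

text \<open>Concerns the output tape, hence \<open>Out\<close>; the array assignments
  \<open>Put\<close> are tracked by \<open>marrs\<close>.\<close>

fun puts :: "com \<Rightarrow> bool" where
  "puts (Out x) = True"
| "puts (c \<then> d) = (puts c \<or> puts d)"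
| "puts (Cond e c d) = (puts c \<or> puts d)"
| "puts (While e c) = puts c"
| "puts _ = False"

text \<open>Frame property: computed from the syntax and supplied by the proof rules, it spares
  every invariant from listing what a command leaves alone.\<close>

definition same :: "com \<Rightarrow> store \<Rightarrow> store \<Rightarrow> bool" where
  "same c s s' \<longleftrightarrow> (\<forall>x. x \<notin> mvars c \<longrightarrow> vars s' x = vars s x) \<and>
     (\<forall>a. a \<notin> marrs c \<longrightarrow> arrs s' a = arrs s a) \<and>
     (\<not> gets c \<longrightarrow> inps s' = inps s) \<and> (\<not> puts c \<longrightarrow> outs s' = outs s)"

lemma same_refl [simp]: "same c s s"
  by (simp add: same_def)

lemma same_trans: "same c s s' \<Longrightarrow> same c s' s'' \<Longrightarrow> same c s s''"
  by (simp add: same_def)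

lemma exe_same: "exe c s t s' \<Longrightarrow> same c s s'"
  by (induction rule: exe.induct) (simp_all add: same_def)

text \<open>Total correctness from one fixed store instead of a precondition, so that the
  postcondition can refer to initial values directly.\<close>

definition ht :: "com \<Rightarrow> store \<Rightarrow> nat \<Rightarrow> (store \<Rightarrow> bool) \<Rightarrow> bool" where
  "ht c s T Q \<longleftrightarrow> (\<exists>t s'. exe c s t s' \<and> t \<le> T \<and> Q s')"

lemma ht_mono: "ht c s T Q \<Longrightarrow> T \<le> U \<Longrightarrow> (\<And>s'. Q s' \<Longrightarrow> same c s s' \<Longrightarrow> Q' s') \<Longrightarrow> ht c s U Q'"
  unfolding ht_def by (meson exe_same le_trans)

lemma ht_Seq:
  assumes "ht c s T Q" "\<And>s'. Q s' \<Longrightarrow> same c s s' \<Longrightarrow> ht d s' U Q'" "T + U \<le> V"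
  shows "ht (c \<then> d) s V Q'"
  using assms unfolding ht_def by (meson exe_Seq exe_same add_le_mono le_trans)

lemma ht_Get: "inps s = z # zs \<Longrightarrow> Q (s\<lparr>vars := (vars s)(x := z), inps := zs\<rparr>) \<Longrightarrow> ht (Get x) s 1 Q"
  unfolding ht_def by (intro exI conjI, erule exe_Get) auto

lemma ht_Cond:
  assumes "aval e s > 0 \<Longrightarrow> ht c s T Q" "aval e s \<le> 0 \<Longrightarrow> ht d s T Q" "esize e + 3 + T \<le> U"
  shows "ht (Cond e c d) s U Q"
proof (cases "aval e s > 0")
  case True
  then show ?thesis using assms(1,3) unfolding ht_def
    by (meson exe_CondT add_le_mono le_trans order_refl)
next
  case False
  then have "aval e s \<le> 0" by simp
  then show ?thesis using assms(2,3) unfolding ht_def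
    by (meson exe_CondF add_le_mono le_trans order_refl)
qed

fun run :: "com \<Rightarrow> store \<Rightarrow> store" where
  "run Skip s = s"
| "run (Asg x e) s = s\<lparr>vars := (vars s)(x := aval e s)\<rparr>"
| "run (Put a e f) s = s\<lparr>arrs := (arrs s)(a := (arrs s a)(nat (aval e s) := aval f s))\<rparr>"
| "run (Out e) s = s\<lparr>outs := outs s @ [aval e s]\<rparr>"
| "run (c \<then> d) s = run d (run c s)"
| "run (Cond e c d) s = (if aval e s > 0 then run c s else run d s)"
| "run _ s = s"

text \<open>Charging both branches of a conditional makes the cost independent of the store, so that
  simplification computes it.\<close>

fun cost :: "com \<Rightarrow> nat" where
  "cost (Asg x e) = esize e + 2"
| "cost (Put a e f) = esize e + esize f + 12"
| "cost (Out e) = esize e + 1"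
| "cost (c \<then> d) = cost c + cost d"
| "cost (Cond e c d) = esize e + 3 + (cost c + cost d)"
| "cost _ = 0"

fun straight :: "com \<Rightarrow> bool" where
  "straight (While e c) = False"
| "straight (Get x) = False"
| "straight (c \<then> d) = (straight c \<and> straight d)"
| "straight (Cond e c d) = (straight c \<and> straight d)"
| "straight _ = True"

lemma ht_straight_aux: "straight c \<Longrightarrow> \<exists>t\<le>cost c. exe c s t (run c s)"
proof (induction c arbitrary: s)
  case (Seq c d)
  then obtain t u where "t \<le> cost c" "exe c s t (run c s)" "u \<le> cost d" "exe d (run c s) u (run d (run c s))"
    by (meson straight.simps(3))
  then show ?case by (intro exI[of _ "t + u"]) (auto intro: exe.intros)
next
  case (Cond e c d)
  then obtain t u where *: "t \<le> cost c" "exe c s t (run c s)" "u \<le> cost d" "exe d s u (run d s)"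
    by (meson straight.simps(4))
  show ?case
  proof (cases "aval e s > 0")
    case True
    with * show ?thesis by (intro exI[of _ "esize e + 3 + t"]) (auto intro: exe_CondT[simplified])
  next
    case False
    with * show ?thesis by (intro exI[of _ "esize e + 3 + u"]) (auto intro: exe_CondF[simplified])
  qed
qed (auto intro: exe.intros exe_Asg[simplified] exe_Put[simplified] exe_Out[simplified])

lemma ht_straight: "straight c \<Longrightarrow> Q (run c s) \<Longrightarrow> cost c \<le> T \<Longrightarrow> ht c s T Q"
  unfolding ht_def using ht_straight_aux le_trans by blast

text \<open>Besides the invariant, each premise may use the frame relative to the store at loop
  entry; invariants therefore only mention what the body changes.\<close>

lemma ht_While:
  fixes v :: "store \<Rightarrow> nat"
  assumes "I s"
    and "\<And>s'. I s' \<Longrightarrow> same c s s' \<Longrightarrow> aval e s' > 0 \<Longrightarrow> ht c s' T (\<lambda>s''. I s'' \<and> v s'' < v s')"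
    and "\<And>s'. I s' \<Longrightarrow> same c s s' \<Longrightarrow> aval e s' \<le> 0 \<Longrightarrow> Q s'"
    and "v s \<le> N" "N * (T + esize e + 3) + esize e + 3 \<le> U"
  shows "ht (While e c) s U Q"
proof -
  have "I s' \<Longrightarrow> same c s s' \<Longrightarrow> \<exists>t s''. exe (While e c) s' t s'' \<and>
      t \<le> v s' * (T + esize e + 3) + (esize e + 3) \<and> Q s''" for s'
  proof (induction "v s'" arbitrary: s' rule: less_induct)
    case less
    show ?case
    proof (cases "aval e s' > 0")
      case True
      from assms(2)[OF less.prems True] obtain t s1 where
        1: "exe c s' t s1" "t \<le> T" "I s1" "v s1 < v s'" unfolding ht_def by blast
      have "same c s s1" using less.prems(2) exe_same[OF 1(1)] by (rule same_trans)
      from less.hyps[OF 1(4,3) this] obtain u s2 where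
        2: "exe (While e c) s1 u s2" "u \<le> v s1 * (T + esize e + 3) + (esize e + 3)" "Q s2" by blast
      have "Suc (v s1) * (T + esize e + 3) \<le> v s' * (T + esize e + 3)"
        using 1(4) by (intro mult_right_mono) auto
      with 2(2) 1(2) have "esize e + 3 + t + u \<le> v s' * (T + esize e + 3) + (esize e + 3)" by simp
      with exe_WhileT[OF True 1(1) 2(1)] 2(3) show ?thesis by blast
    next
      case False
      then have "aval e s' \<le> 0" by simp
      from exe_WhileF[OF this] assms(3)[OF less.prems this] show ?thesis
        by (intro exI conjI) auto
    qed
  qed
  from this[OF assms(1) same_refl] obtain t s'' where
    *: "exe (While e c) s t s''" "t \<le> v s * (T + esize e + 3) + (esize e + 3)" "Q s''" by blast
  have "v s * (T + esize e + 3) \<le> N * (T + esize e + 3)"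
    using assms(4) by (rule mult_right_mono) simp
  with *(2) assms(5) have "t \<le> U" by linarith
  with * show ?thesis unfolding ht_def by blast
qed

text \<open>For loops with a known number of iterations: \<open>i\<close> is a ghost value, and the
  equivalence of the guard with \<open>i < N\<close> replaces a termination measure.\<close>

lemma ht_For:
  assumes "I 0 s"
    and "\<And>i s'. i < N \<Longrightarrow> I i s' \<Longrightarrow> same c s s' \<Longrightarrow> ht c s' T (I (Suc i))"
    and "\<And>i s'. i \<le> N \<Longrightarrow> I i s' \<Longrightarrow> same c s s' \<Longrightarrow> aval e s' > 0 \<longleftrightarrow> i < N"
    and "\<And>s'. I N s' \<Longrightarrow> same c s s' \<Longrightarrow> Q s'"
    and "N * (T + esize e + 3) + esize e + 3 \<le> U"
  shows "ht (While e c) s U Q"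
proof -
  have "i \<le> N \<Longrightarrow> I i s' \<Longrightarrow> same c s s' \<Longrightarrow> \<exists>t s''. exe (While e c) s' t s'' \<and>
      t \<le> (N - i) * (T + esize e + 3) + (esize e + 3) \<and> Q s''" for i s'
  proof (induction "N - i" arbitrary: i s')
    case 0
    then have "\<not> aval e s' > 0" "i = N" using assms(3)[of i s'] by auto
    then show ?case
      using exe_WhileF[of e s' c] assms(4)[of s'] 0 by (intro exI conjI) auto
  next
    case (Suc k)
    then have i: "i < N" by simp
    with Suc.prems assms(3)[of i s'] have pos: "aval e s' > 0" by auto
    from assms(2)[OF i Suc.prems(2,3)] obtain t s1 where
      1: "exe c s' t s1" "t \<le> T" "I (Suc i) s1" unfolding ht_def by blast
    have "same c s s1" using Suc.prems(3) exe_same[OF 1(1)] by (rule same_trans)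
    from Suc.hyps(1)[of "Suc i", OF _ _ 1(3) this] Suc.hyps(2) i obtain u s2 where
      2: "exe (While e c) s1 u s2" "u \<le> (N - Suc i) * (T + esize e + 3) + (esize e + 3)" "Q s2"
      by (metis Suc_diff_Suc Suc_inject Suc_leI)
    have "N - i = Suc (N - Suc i)" using i by simp
    then have "esize e + 3 + t + u \<le> (N - i) * (T + esize e + 3) + (esize e + 3)"
      using 2(2) 1(2) by simp
    with exe_WhileT[OF pos 1(1) 2(1)] 2(3) show ?case by blast
  qed
  from this[OF _ assms(1) same_refl] obtain t s'' where "exe (While e c) s t s''"
    "t \<le> N * (T + esize e + 3) + (esize e + 3)" "Q s''" by auto
  with assms(5) show ?thesis unfolding ht_def by (intro exI[of _ t] exI[of _ s'']) linarith
qed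

subsection \<open>Digit vectors\<close>

definition dig :: "nat \<Rightarrow> nat \<Rightarrow> nat \<Rightarrow> nat" where
  "dig b x l = x div b ^ l mod b"

definition code :: "nat \<Rightarrow> nat \<Rightarrow> (nat \<Rightarrow> nat) \<Rightarrow> nat" where
  "code b D v = (\<Sum>l<D. v l * b ^ l)"

lemma code_cong: "(\<And>l. l < D \<Longrightarrow> u l = v l) \<Longrightarrow> code b D u = code b D v"
  unfolding code_def by (rule sum.cong) auto

lemma code_0 [simp]: "code b D (\<lambda>_. 0) = 0"
  by (simp add: code_def)

lemma code_Suc: "code b (Suc D) v = code b D v + v D * b ^ D"
  by (simp add: code_def)

lemma code_add: "code b D (\<lambda>l. u l + v l) = code b D u + code b D v"
  by (simp add: code_def sum.distrib algebra_simps)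

lemma code_mult: "code b D (\<lambda>l. c * v l) = c * code b D v"
  by (simp add: code_def sum_distrib_left algebra_simps)

lemma code_less:
  assumes "\<And>l. l < D \<Longrightarrow> v l < b"
  shows "code b D v < b ^ D"
  using assms
proof (induction D)
  case (Suc D)
  then have "code b D v < b ^ D" "Suc (v D) \<le> b" by (auto simp: Suc_le_eq)
  then have "code b D v + v D * b ^ D < b ^ D + v D * b ^ D" by simp
  also have "\<dots> = Suc (v D) * b ^ D" by simp
  also have "\<dots> \<le> b * b ^ D" using \<open>Suc (v D) \<le> b\<close> by (rule mult_right_mono) simp
  finally show ?case by (simp add: code_Suc)
qed (simp add: code_def)

text \<open>The spare factor \<open>b\<close> makes contributions of higher digits vanish under
  \<open>div b ^ l mod b\<close>.\<close>

lemma power_split: "l < D \<Longrightarrow> (b :: nat) ^ D = b ^ l * (b * b ^ (D - l - 1))"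
proof -
  assume "l < D"
  then have "D = l + Suc (D - l - 1)" by simp
  then have "b ^ D = b ^ (l + Suc (D - l - 1))" by simp
  then show ?thesis by (simp only: power_add power_Suc)
qed

lemma dig_code:
  assumes "\<And>l. l < D \<Longrightarrow> v l < b" "l < D"
  shows "dig b (code b D v) l = v l"
  using assms
proof (induction D)
  case (Suc D)
  have b: "b > 0" using Suc.prems(1)[of 0] by simp
  have lt: "code b D v < b ^ D" using Suc.prems(1) by (intro code_less) auto
  show ?case
  proof (cases "l = D")
    case True
    then show ?thesis using lt b Suc.prems(1)[of D] by (simp add: dig_def code_Suc)
  next
    case False
    with Suc.prems have l: "l < D" by simp
    then have "b ^ D = b ^ l * (b * b ^ (D - l - 1))" by (rule power_split)
    then have "code b (Suc D) v = code b D v + b ^ l * (b * (v D * b ^ (D - l - 1)))"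
      by (simp add: code_Suc algebra_simps)
    then have "dig b (code b (Suc D) v) l = dig b (code b D v) l"
      using b by (simp add: dig_def)
    with Suc l show ?thesis by simp
  qed
qed simp

lemma code_dig: "x < b ^ D \<Longrightarrow> code b D (dig b x) = x"
proof (induction D arbitrary: x)
  case (Suc D)
  have b: "b > 0" using Suc.prems by (cases b) auto
  have "dig b (x mod b ^ D) l = dig b x l" if "l < D" for l
  proof -
    have e: "b ^ D = b ^ l * b ^ (D - l)" using that by (simp flip: power_add)
    have "x mod b ^ D div b ^ l = x div b ^ l mod b ^ (D - l)"
      unfolding e by (simp add: mod_mult2_eq b)
    moreover have "b dvd b ^ (D - l)" using that by (intro dvd_power) auto
    ultimately show ?thesis by (simp add: dig_def mod_mod_cancel)
  qed
  then have "code b D (dig b x) = code b D (dig b (x mod b ^ D))"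
    by (intro code_cong) simp
  also have "\<dots> = x mod b ^ D" using b by (intro Suc.IH) simp
  finally have "code b (Suc D) (dig b x) = x mod b ^ D + (x div b ^ D mod b) * b ^ D"
    by (simp add: code_Suc dig_def)
  moreover have "x div b ^ D < b" using Suc.prems b by (simp add: less_mult_imp_div_less)
  ultimately show ?case by (simp add: mod_div_mult_eq)
qed (simp add: code_def)

lemma dig_less: "b > 0 \<Longrightarrow> dig b x l < b"
  by (simp add: dig_def)

lemma dig_0 [simp]: "dig b 0 l = 0"
  by (simp add: dig_def)

lemma dig_high: "x < b ^ l \<Longrightarrow> dig b x l = 0"
  by (simp add: dig_def)

lemma dig_top_less:
  assumes "x < a * b ^ l" "a \<le> b"
  shows "dig b x l < a"
proof -
  have "x div b ^ l < a" using assms(1) by (simp add: less_mult_imp_div_less)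
  with assms(2) show ?thesis by (simp add: dig_def)
qed

text \<open>The hypothesis rules out a carry: no digit of \<open>x\<close> above \<open>l\<close> is
  nonzero, and digit \<open>l\<close> has room for one more unit.\<close>

lemma dig_add_power:
  assumes "x + b ^ l < b ^ Suc l"
  shows "dig b (x + b ^ l) l' = dig b x l' + (if l' = l then 1 else 0)"
proof -
  have b: "b > 0" using assms by (cases b) auto
  consider "l' < l" | "l' = l" | "l' > l" by linarith
  then show ?thesis
  proof cases
    case 1
    then have "b ^ l = b ^ l' * (b * b ^ (l - l' - 1))" by (rule power_split)
    then show ?thesis using 1 b by (simp add: dig_def)
  next
    case 2
    have "(x + b ^ l) div b ^ l < b" using assms by (simp add: less_mult_imp_div_less)
    then show ?thesis using 2 b by (simp add: dig_def)
  next
    case 3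
    then have "b ^ Suc l \<le> b ^ l'" using b by (intro power_increasing) auto
    with assms have "x + b ^ l < b ^ l'" by linarith
    then show ?thesis using 3 by (simp add: dig_def)
  qed
qed

subsection \<open>Sparse binary expansions\<close>

text \<open>If many multiplicities are odd, then by the pigeonhole principle two disjoint sets of odd
  elements have the same sum; lowering the multiplicities on one of them and raising them on the
  other makes all of these multiplicities even.\<close>

lemma few_odd_multiplicities:
  fixes f :: "'a \<Rightarrow> nat \<Rightarrow> nat" and x :: "'a \<Rightarrow> nat"
  assumes fin: "finite C" and bd: "\<And>q l. q \<in> C \<Longrightarrow> l < D \<Longrightarrow> f q l \<le> Q"
    and big: "(N * Q + 1) ^ D < 2 ^ N"
  shows "\<exists>y. (\<forall>l<D. (\<Sum>q\<in>C. y q * f q l) = (\<Sum>q\<in>C. x q * f q l)) \<and> card {q \<in> C. odd (y q)} < N"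
proof -
  define S where "S y \<longleftrightarrow> (\<forall>l<D. (\<Sum>q\<in>C. y q * f q l) = (\<Sum>q\<in>C. x q * f q l))" for y
  have "S x" by (simp add: S_def)
  \<comment> \<open>With a solution that has the fewest odd multiplicities, a single exchange step
    already yields a contradiction.\<close>
  from ex_has_least_nat[of S x "\<lambda>y. card {q \<in> C. odd (y q)}", OF this] obtain y where
    y: "S y" and least: "\<And>z. S z \<Longrightarrow> card {q \<in> C. odd (y q)} \<le> card {q \<in> C. odd (z q)}" by blast
  have "card {q \<in> C. odd (y q)} < N"
  proof (rule ccontr)
    assume "\<not> card {q \<in> C. odd (y q)} < N"
    then obtain Z where Z: "Z \<subseteq> {q \<in> C. odd (y q)}" "card Z = N"
      using obtain_subset_with_card_n[of N "{q \<in> C. odd (y q)}"] by (auto simp: not_less)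
    have finZ: "finite Z" by (rule finite_subset[OF Z(1)]) (simp add: fin)
    \<comment> \<open>Sum vectors of the subsets of \<open>Z\<close>: at most
      \<open>(N * Q + 1) ^ D\<close> values for \<open>2 ^ N\<close> subsets.\<close>
    define s where "s A = restrict (\<lambda>l. \<Sum>q\<in>A. f q l) {..<D}" for A
    have "s ` Pow Z \<subseteq> {..<D} \<rightarrow>\<^sub>E {..N * Q}"
    proof
      fix w assume "w \<in> s ` Pow Z"
      then obtain A where A: "A \<subseteq> Z" "w = s A" by auto
      have "(\<Sum>q\<in>A. f q l) \<le> N * Q" if "l < D" for l
      proof -
        have "(\<Sum>q\<in>A. f q l) \<le> card A * Q"
          using A Z that by (intro order_trans[OF sum_bounded_above[of A _ Q]]) (auto intro!: bd)
        also have "\<dots> \<le> N * Q" using card_mono[OF finZ A(1)] Z(2) by simp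
        finally show ?thesis .
      qed
      then show "w \<in> {..<D} \<rightarrow>\<^sub>E {..N * Q}" using A(2) by (auto simp: s_def)
    qed
    then have "card (s ` Pow Z) \<le> card ({..<D} \<rightarrow>\<^sub>E {..N * Q})"
      by (intro card_mono finite_PiE) auto
    also have "\<dots> = (N * Q + 1) ^ D" by (simp add: card_PiE)
    also have "\<dots> < 2 ^ N" by fact
    also have "\<dots> = card (Pow Z)" using finZ Z(2) by (simp add: card_Pow)
    finally have "\<not> inj_on s (Pow Z)" by (rule pigeonhole)
    then obtain A B where AB: "A \<subseteq> Z" "B \<subseteq> Z" "A \<noteq> B" "s A = s B" by (auto simp: inj_on_def)
    have finAB: "finite A" "finite B" using AB(1,2) finZ by (simp_all add: finite_subset)
    have eqs: "(\<Sum>q\<in>A - B. f q l) = (\<Sum>q\<in>B - A. f q l)" if "l < D" for l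
    proof -
      have "(\<Sum>q\<in>A. f q l) = (\<Sum>q\<in>B. f q l)" using fun_cong[OF AB(4), of l] that by (simp add: s_def)
      moreover have "(\<Sum>q\<in>A. f q l) = (\<Sum>q\<in>A - B. f q l) + (\<Sum>q\<in>A \<inter> B. f q l)"
        using sum.Int_Diff[OF finAB(1), of "\<lambda>q. f q l" B] by simp
      moreover have "(\<Sum>q\<in>B. f q l) = (\<Sum>q\<in>B - A. f q l) + (\<Sum>q\<in>A \<inter> B. f q l)"
        using sum.Int_Diff[OF finAB(2), of "\<lambda>q. f q l" A] by (simp add: Int_commute)
      ultimately show ?thesis by simp
    qed
    \<comment> \<open>Common elements of \<open>A\<close> and \<open>B\<close> cancel, so only the
      differences are shifted. Lowering is possible because an odd multiplicity is at least
      1.\<close>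
    define z where "z q = (if q \<in> A - B then y q - 1 else if q \<in> B - A then y q + 1 else y q)" for q
    have AC: "A \<subseteq> C" "B \<subseteq> C" using AB Z by auto
    have pos: "y q \<ge> 1" if "q \<in> A" for q using AB Z that by (auto simp: odd_pos Suc_leI)
    have "S z"
      unfolding S_def
    proof (intro allI impI)
      fix l assume l: "l < D"
      have p: "z q * f q l + (if q \<in> A - B then f q l else 0) = y q * f q l + (if q \<in> B - A then f q l else 0)"
        if "q \<in> C" for q
        using pos[of q] by (cases "y q") (auto simp: z_def)
      have "(\<Sum>q\<in>C. z q * f q l) + (\<Sum>q\<in>C. if q \<in> A - B then f q l else 0)
        = (\<Sum>q\<in>C. y q * f q l) + (\<Sum>q\<in>C. if q \<in> B - A then f q l else 0)"
        unfolding sum.distrib[symmetric] using p by (rule sum.cong[OF refl])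
      moreover have "(\<Sum>q\<in>C. if q \<in> A - B then f q l else 0) = (\<Sum>q\<in>A - B. f q l)"
        using sum.inter_restrict[OF fin, of "\<lambda>q. f q l" "A - B"] AC by (simp add: Int_absorb1 subset_iff)
      moreover have "(\<Sum>q\<in>C. if q \<in> B - A then f q l else 0) = (\<Sum>q\<in>B - A. f q l)"
        using sum.inter_restrict[OF fin, of "\<lambda>q. f q l" "B - A"] AC by (simp add: Int_absorb1 subset_iff)
      ultimately have "(\<Sum>q\<in>C. z q * f q l) = (\<Sum>q\<in>C. y q * f q l)" using eqs[OF l] by simp
      then show "(\<Sum>q\<in>C. z q * f q l) = (\<Sum>q\<in>C. x q * f q l)" using y l by (simp add: S_def)
    qed
    have odd: "odd (y q)" "q \<in> C" if "q \<in> A \<or> q \<in> B" for q using that AB(1,2) Z(1) by auto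
    have even: "even (z q)" if "q \<in> A - B \<or> q \<in> B - A" for q
      using that odd[of q] by (auto simp: z_def)
    have other: "z q = y q" if "\<not> (q \<in> A - B \<or> q \<in> B - A)" for q using that by (auto simp: z_def)
    obtain q0 where q0: "q0 \<in> A - B \<or> q0 \<in> B - A" using AB(3) by auto
    have "{q \<in> C. odd (z q)} \<subset> {q \<in> C. odd (y q)}"
    proof (rule psubsetI)
      show "{q \<in> C. odd (z q)} \<subseteq> {q \<in> C. odd (y q)}" using even other by force
      have "q0 \<in> {q \<in> C. odd (y q)}" "q0 \<notin> {q \<in> C. odd (z q)}" using q0 odd[of q0] even[OF q0] by auto
      then show "{q \<in> C. odd (z q)} \<noteq> {q \<in> C. odd (y q)}" by metis
    qed
    then have "card {q \<in> C. odd (z q)} < card {q \<in> C. odd (y q)}"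
      using fin by (intro psubset_card_mono) auto
    with least[OF \<open>S z\<close>] show False by simp
  qed
  with y show ?thesis by (auto simp: S_def)
qed

subsection \<open>List scheduling\<close>

text \<open>Each job goes to a machine whose load is at most the average over the earlier jobs, and
  adds at most \<open>w\<close> there. Loads are multiplied by \<open>m\<close> to stay within the
  integers.\<close>

lemma list_schedule:
  fixes p :: "nat \<Rightarrow> int"
  assumes m: "m \<ge> 1" and w: "w \<ge> 0" and nonneg: "\<And>j. j < n \<Longrightarrow> 0 \<le> p j \<and> p j \<le> w"
  shows "\<exists>a. (\<forall>j<n. a j < m) \<and> (\<forall>i<m. int m * (\<Sum>j | j < n \<and> a j = i. p j) \<le> (\<Sum>j<n. p j) + int m * w)"
  using nonneg
proof (induction n)
  case 0
  show ?case using m w by (intro exI[of _ "\<lambda>_. 0"]) simp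
next
  case (Suc n)
  then obtain a where a: "\<And>j. j < n \<Longrightarrow> a j < m"
    "\<And>i. i < m \<Longrightarrow> int m * (\<Sum>j | j < n \<and> a j = i. p j) \<le> (\<Sum>j<n. p j) + int m * w" by auto
  let ?l = "\<lambda>i. \<Sum>j | j < n \<and> a j = i. p j"
  have "\<exists>i<m. int m * ?l i \<le> (\<Sum>j<n. p j)"
  proof (rule ccontr)
    assume "\<not> (\<exists>i<m. int m * ?l i \<le> (\<Sum>j<n. p j))"
    then have "(\<Sum>i<m. \<Sum>j<n. p j) < (\<Sum>i<m. int m * ?l i)"
      using m by (intro sum_strict_mono) (auto simp: not_le lessThan_empty_iff)
    moreover have "(\<Sum>i<m. ?l i) = (\<Sum>j<n. p j)"
      using a(1) by (subst sum.group[of "{..<n}" "{..<m}" a p, symmetric]) (auto intro!: sum.cong)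
    ultimately show False by (simp add: sum_distrib_left[symmetric])
  qed
  then obtain i0 where i0: "i0 < m" "int m * ?l i0 \<le> (\<Sum>j<n. p j)" by blast
  let ?a = "a(n := i0)"
  have eq: "(\<Sum>j | j < Suc n \<and> ?a j = i. p j) = ?l i + (if i = i0 then p n else 0)" for i
  proof (cases "i = i0")
    case True
    then have "{j. j < Suc n \<and> ?a j = i} = insert n {j. j < n \<and> a j = i}" by auto
    then show ?thesis using True by simp
  next
    case False
    then have "{j. j < Suc n \<and> ?a j = i} = {j. j < n \<and> a j = i}" by auto
    then show ?thesis using False by simp
  qed
  have pn: "0 \<le> p n" "p n \<le> w" using Suc.prems by auto
  have "int m * (\<Sum>j | j < Suc n \<and> ?a j = i. p j) \<le> (\<Sum>j<Suc n. p j) + int m * w" if "i < m" for i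
  proof (cases "i = i0")
    case True
    have "int m * p n \<le> int m * w" using pn by (intro mult_left_mono) auto
    then have "int m * (?l i0 + p n) \<le> (\<Sum>j<n. p j) + int m * w" using i0(2) by (simp only: distrib_left)
    then show ?thesis using True pn(1) unfolding eq by simp
  next
    case False
    then show ?thesis using a(2)[OF that] pn(1) unfolding eq by simp
  qed
  moreover have "?a j < m" if "j < Suc n" for j using a(1)[of j] i0(1) that by (auto simp: less_Suc_eq)
  ultimately show ?case by (intro exI[of _ ?a]) blast
qed

subsection \<open>Scaled and rounded instances\<close>

text \<open>With \<open>m < n\<close> all counts, including that of the machines, have at most
  \<open>L\<close> bits; if \<open>n <= m\<close>, every job simply gets its own machine.
  \<open>k\<close> stands for the ceiling of \<open>1 / eps\<close>.\<close>

locale sched =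
  fixes n m k :: nat and p :: "nat \<Rightarrow> int"
  assumes m_pos: "1 \<le> m" and m_less: "m < n" and p_pos: "\<And>j. j < n \<Longrightarrow> p j > 0" and k_pos: "1 \<le> k"
begin

text \<open>Rounding the accuracy up to a power of two at most doubles it and turns multiplication
  by \<open>K\<close> into \<open>kap\<close> doublings.\<close>

definition kap :: nat where "kap = (LEAST e. k \<le> 2 ^ e)"
definition K :: nat where "K = 2 ^ kap"
definition L :: nat where "L = (LEAST e. n < 2 ^ e)"

text \<open>All processing times are multiplied by \<open>m K\<^sup>2\<close>. Then the lower bound
  \<open>max (p\<^sub>m\<^sub>a\<^sub>x, average load)\<close> becomes \<open>K\<^sup>2 dl\<close> and no division is needed.\<close>

definition JP :: "nat \<Rightarrow> int" where "JP j = int m * p j * int (K ^ 2)"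
definition P :: int where "P = (\<Sum>j<n. p j)"
definition mx :: int where "mx = Max ((\<lambda>j. int m * p j) ` {..<n})"
definition dl :: int where "dl = max mx P"
definition av :: int where "av = P * int (K ^ 2)"

text \<open>There are \<open>kap + 1\<close> octaves of \<open>K\<close> thresholds each; the last
  one starts at \<open>K ^ 2 * dl\<close>, which no job exceeds. The additional coordinate
  \<open>d\<close> counts machines.\<close>

definition d :: nat where "d = (kap + 1) * K"
definition D :: nat where "D = d + 1"

text \<open>Octave \<open>a\<close> starts at \<open>2 ^ a * K * dl\<close> and has \<open>K\<close>
  equal steps: neighbours differ by a factor of at most \<open>1 + 1 / K\<close>, and all values are
  multiples of \<open>dl\<close> obtained by additions. The value 0 from \<open>d\<close> on makes
  the machine coordinate weightless.\<close>

definition th :: "nat \<Rightarrow> int" where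
  "th l = (if l < d then 2 ^ (l div K) * (int K + int (l mod K)) * dl else 0)"

text \<open>Type 0 means a small job, type \<open>t > 0\<close> a job rounded down to
  \<open>th (t - 1)\<close>; the shift by one frees index 0 for the small jobs.\<close>

definition ty :: "nat \<Rightarrow> nat" where
  "ty j = (GREATEST t. t \<le> d \<and> (t = 0 \<or> th (t - 1) \<le> JP j))"

definition b :: "nat \<Rightarrow> nat" where
  "b l = (if l < d then card {j. j < n \<and> ty j = Suc l} else m)"

text \<open>\<open>N0\<close> bounds the number of odd multiplicities, and a carry contains at most
  \<open>R0 = 2 * N0\<close> configurations. Each contributes at most \<open>2 * K\<close> jobs per
  type, so in base \<open>R > 2 * K * (R0 + 1)\<close> no digit overflows; \<open>B\<close>, half of
  \<open>R\<close>, is the base for halved carries. \<open>N\<close> is the unit of the machine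
  digit in base \<open>B\<close>, \<open>ZF\<close> the number of packed states, and a state below
  \<open>ZB\<close> has a machine digit below \<open>R0\<close>.\<close>

definition N0 :: nat where "N0 = 16 * K ^ 3"
definition R :: nat where "R = 128 * K ^ 4"
definition B :: nat where "B = 64 * K ^ 4"
definition R0 :: nat where "R0 = 32 * K ^ 3"
definition N :: nat where "N = B ^ d"
definition ZB :: nat where "ZB = R0 * R ^ d"
definition ZF :: nat where "ZF = R ^ D"

text \<open>Rereads the base \<open>B\<close> digits of \<open>h\<close> in base \<open>R\<close>,
  where doubling them and adding a bit cannot overflow.\<close>

definition EL :: "nat \<Rightarrow> nat" where "EL h = code R D (dig B h)"
definition ld :: "nat \<Rightarrow> int" where "ld h = (\<Sum>l<D. int (dig B h l) * th l)"
definition BE :: "nat \<Rightarrow> nat" where "BE i = code R D (\<lambda>l. b l div 2 ^ i mod 2)"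

text \<open>A configuration describes the large jobs on one machine; its digit \<open>d\<close> counts the machine.\<close>

definition confs :: "int \<Rightarrow> nat set" where "confs T = {q. N \<le> q \<and> q < 2 * N \<and> ld q \<le> T}"

text \<open>\<open>rc T i c\<close>: the low \<open>i\<close> bits of \<open>b\<close> can be written as \<open>\<Sum>j<i. 2\<^sup>j s\<^sub>j\<close> with carry \<open>c\<close>, where
  the \<open>s\<^sub>j\<close> are sums of configurations; some configurations of level \<open>i\<close> may already be included.\<close>

inductive rc :: "int \<Rightarrow> nat \<Rightarrow> nat \<Rightarrow> bool" for T where
  rc_init: "rc T 0 0"
| rc_add: "rc T i c \<Longrightarrow> i < L \<Longrightarrow> c < ZB \<Longrightarrow> q \<in> confs T \<Longrightarrow> rc T i (c + EL q)"
| rc_shift: "rc T i (2 * EL h + BE i) \<Longrightarrow> i < L \<Longrightarrow> h < B ^ D \<Longrightarrow> rc T (Suc i) (EL h)"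

section \<open>Inequalities between the parameters, and the rounded sizes\<close>

lemma k_le_K: "k \<le> K"
  unfolding K_def kap_def by (rule LeastI[of _ k]) (simp add: less_imp_le)

lemma K_le: "K \<le> 2 * k"
proof (cases kap)
  case 0
  then show ?thesis using k_pos by (simp add: K_def)
next
  case (Suc e)
  then have "\<not> k \<le> 2 ^ e" unfolding kap_def using not_less_Least by (metis lessI)
  then show ?thesis by (simp add: K_def Suc)
qed

lemma K_pos: "K \<ge> 1"
  by (simp add: K_def)

lemma n_less: "n < 2 ^ L"
  unfolding L_def by (rule LeastI[of _ n]) simp

lemma pow_L_le: "2 ^ L \<le> 2 * n"
proof (cases L)
  case 0
  then show ?thesis using m_less by simp
next
  case (Suc e)
  then have "\<not> n < 2 ^ e" unfolding L_def using not_less_Least by (metis lessI)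
  then show ?thesis by (simp add: Suc)
qed

lemma params:
  "B > 0" "R = 2 * B" "R0 = 2 * N0" "R0 < R" "2 * K * (R0 + 1) < R" "K * (2 * N0 + 1) < B" "N0 < B" "2 * K < B"
  "N0 \<ge> 1"
proof -
  have K4: "K ^ 3 \<le> K ^ 4" "K \<le> K ^ 4" "1 \<le> K ^ 3" "K ^ 4 \<ge> 1"
    using K_pos power_increasing[of 3 4 K] power_increasing[of 1 4 K] by auto
  have e: "K * K ^ 3 = K ^ 4" by (simp add: numeral_eq_Suc)
  show "B > 0" "R = 2 * B" "R0 = 2 * N0" "N0 \<ge> 1" using K_pos by (auto simp: B_def R_def R0_def N0_def)
  show "R0 < R" "N0 < B" "2 * K < B" using K4 unfolding R0_def R_def N0_def B_def by linarith+
  have "2 * K * (R0 + 1) = 64 * K ^ 4 + 2 * K" unfolding R0_def e[symmetric] by (simp add: algebra_simps)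
  then show "2 * K * (R0 + 1) < R" using K4 unfolding R_def by linarith
  have "K * (2 * N0 + 1) = 32 * K ^ 4 + K" unfolding N0_def e[symmetric] by (simp add: algebra_simps)
  then show "K * (2 * N0 + 1) < B" using K4 unfolding B_def by linarith
qed

lemma R_pos: "R > 0"
  using params(4) by linarith

lemma d_pos: "d \<ge> 1"
  using K_pos by (simp add: d_def)

lemma N_ge: "N \<ge> 2"
proof -
  have "2 \<le> B" using params(8) K_pos by linarith
  also have "B \<le> B ^ d" using d_pos params(1) by (intro self_le_power) auto
  finally show ?thesis by (simp add: N_def)
qed

lemma power_D: "B ^ D = B * N"
  by (simp add: D_def N_def)

lemma two_N_le: "2 * N \<le> B ^ D"
  unfolding power_D using params(8) K_pos by (intro mult_right_mono) auto

text \<open>The base is at most \<open>64 * K ^ 4 = 2 ^ (6 + 4 * kap)\<close>, hence at most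
  \<open>2 ^ (6 * K)\<close> since \<open>kap < K\<close>. With \<open>D <= 2 * K ^ 2\<close> the
  exponent is at most \<open>12 * K ^ 3\<close>; this explains the choice
  \<open>N0 = 16 * K ^ 3\<close>.\<close>

lemma pigeonhole_bound: "(N0 * (2 * K) + 1) ^ D < 2 ^ N0"
proof -
  have "kap + 1 \<le> K" unfolding K_def by (metis Suc_eq_plus1 Suc_leI less_exp)
  then have d: "d \<le> K * K" unfolding d_def by (rule mult_right_mono) simp
  have "1 \<le> K * K" using K_pos mult_le_mono[of 1 K 1 K] by simp
  with d have D: "D \<le> 2 * (K * K)" unfolding D_def by linarith
  have e: "K * K ^ 3 = K ^ 4" by (simp add: numeral_eq_Suc)
  have "N0 * (2 * K) + 1 = 32 * K ^ 4 + 1" unfolding N0_def e[symmetric] by (simp add: algebra_simps)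
  also have "\<dots> \<le> 64 * K ^ 4" using K_pos one_le_power[of K 4] by linarith
  also have "\<dots> = 2 ^ (6 + kap * 4)" by (simp add: K_def power_add flip: power_mult)
  also have "\<dots> \<le> 2 ^ (6 * K)" using \<open>kap + 1 \<le> K\<close> K_pos by (intro power_increasing) auto
  finally have "(N0 * (2 * K) + 1) ^ D \<le> (2 ^ (6 * K)) ^ D" by (rule power_mono) simp
  also have "\<dots> = 2 ^ (6 * K * D)" by (simp add: power_mult)
  also have "6 * K * D \<le> 6 * K * (2 * (K * K))" using D by (rule mult_left_mono) simp
  then have "6 * K * D \<le> 12 * K ^ 3" by (simp add: power3_eq_cube mult_ac)
  then have "(2 :: nat) ^ (6 * K * D) \<le> 2 ^ (12 * K ^ 3)" by (intro power_increasing) auto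
  also have "(2 :: nat) ^ (12 * K ^ 3) < 2 ^ N0" unfolding N0_def using K_pos by (intro power_strict_increasing) auto
  finally show ?thesis .
qed

lemma n_pos: "n \<ge> 1"
  using m_less by simp

lemma mx_props: "mx > 0" "\<And>j. j < n \<Longrightarrow> int m * p j \<le> mx" "\<exists>j<n. mx = int m * p j"
proof -
  have ne: "(\<lambda>j. int m * p j) ` {..<n} \<noteq> {}" using n_pos by (auto simp: lessThan_empty_iff)
  show 1: "\<And>j. j < n \<Longrightarrow> int m * p j \<le> mx" unfolding mx_def by (intro Max_ge) auto
  show "\<exists>j<n. mx = int m * p j" using Max_in[OF _ ne] by (auto simp: mx_def)
  show "mx > 0" using 1[of 0] p_pos[of 0] n_pos m_pos by (smt (verit) mult_pos_pos of_nat_0_less_iff less_le_trans not_less_eq_eq One_nat_def Suc_le_eq)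
qed

lemma dl_pos: "dl > 0"
  using mx_props(1) by (simp add: dl_def)

lemma JP_pos: "j < n \<Longrightarrow> JP j > 0"
  using p_pos[of j] m_pos K_pos by (simp add: JP_def)

lemma JP_le: "j < n \<Longrightarrow> JP j \<le> int (K ^ 2) * dl"
  using mx_props(2)[of j] unfolding JP_def dl_def by (subst mult.commute) (intro mult_left_mono, auto)

lemma sum_JP: "(\<Sum>j<n. JP j) = int m * av"
  by (simp add: JP_def av_def P_def sum_distrib_left sum_distrib_right algebra_simps)

lemma av_le: "av \<le> int (K ^ 2) * dl"
  unfolding av_def dl_def by (subst mult.commute) (intro mult_left_mono, auto)

lemma th_ge: "l < d \<Longrightarrow> th l \<ge> int K * dl"
proof -
  assume l: "l < d"
  have "int K * 1 \<le> (int K + int (l mod K)) * 2 ^ (l div K)" by (intro mult_mono) auto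
  then show ?thesis using l dl_pos unfolding th_def by (simp add: mult.commute)
qed

lemma th_nonneg: "th l \<ge> 0"
  using dl_pos by (simp add: th_def)

text \<open>The formula also holds at the end of an octave, where
  \<open>2 ^ a * (2 * K - 1) + 2 ^ a\<close> is the start \<open>2 ^ (a + 1) * K\<close> of the next
  one.\<close>

lemma th_Suc: "Suc l < d \<Longrightarrow> th (Suc l) = th l + 2 ^ (l div K) * dl"
proof -
  assume l: "Suc l < d"
  show ?thesis
  proof (cases "Suc (l mod K) = K")
    case True
    then have e: "int K + int (l mod K) = 2 * int K - 1" by simp
    from True have "Suc l mod K = 0" "Suc l div K = Suc (l div K)" by (simp_all add: mod_Suc div_Suc)
    then show ?thesis using l unfolding th_def e by (simp add: algebra_simps)
  next
    case False
    then have "Suc l mod K = Suc (l mod K)" "Suc l div K = l div K" by (simp_all add: mod_Suc div_Suc)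
    then show ?thesis using l unfolding th_def by (simp add: algebra_simps)
  qed
qed

lemma ty_props:
  shows ty_le: "ty j \<le> d" and th_ty: "ty j > 0 \<Longrightarrow> th (ty j - 1) \<le> JP j"
    and ty_greatest: "t \<le> d \<Longrightarrow> t > ty j \<Longrightarrow> JP j < th (t - 1)"
proof -
  let ?Q = "\<lambda>t. t \<le> d \<and> (t = 0 \<or> th (t - 1) \<le> JP j)"
  have "?Q (ty j)" unfolding ty_def by (rule GreatestI_nat[of ?Q 0 d]) auto
  then show "ty j \<le> d" "ty j > 0 \<Longrightarrow> th (ty j - 1) \<le> JP j" by auto
  show "JP j < th (t - 1)" if "t \<le> d" "t > ty j"
  proof (rule ccontr)
    assume "\<not> JP j < th (t - 1)"
    with that have "?Q t" by auto
    then have "t \<le> ty j" unfolding ty_def by (rule Greatest_le_nat[of ?Q t d]) auto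
    with that show False by simp
  qed
qed

lemma small_job: "ty j = 0 \<Longrightarrow> JP j < int K * dl"
  using ty_greatest[of 1 j] d_pos K_pos by (simp add: th_def)

text \<open>A job lies below the next threshold, and the step to it is at most the fraction
  \<open>1 / K\<close> of the current one.\<close>

lemma large_job:
  assumes j: "j < n" and pos: "ty j > 0"
  shows "int K * JP j \<le> (int K + 1) * th (ty j - 1)"
proof -
  define l where "l = ty j - 1"
  have l: "ty j = Suc l" "l < d" using pos ty_le[of j] by (auto simp: l_def)
  show ?thesis
  proof (cases "Suc l < d")
    case True
    then have "JP j < th (Suc l)" using ty_greatest[of "Suc (Suc l)" j] l by simp
    also have "\<dots> = th l + 2 ^ (l div K) * dl" using True by (rule th_Suc)
    finally have "int K * JP j \<le> int K * (th l + 2 ^ (l div K) * dl)" by (intro mult_left_mono) auto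
    also have "int K * (2 ^ (l div K) * dl) \<le> (int K + int (l mod K)) * (2 ^ (l div K) * dl)"
      using dl_pos by (intro mult_right_mono) auto
    then have "int K * (2 ^ (l div K) * dl) \<le> th l" using l by (simp add: th_def algebra_simps)
    then have "int K * (th l + 2 ^ (l div K) * dl) \<le> (int K + 1) * th l" by (simp add: algebra_simps)
    finally show ?thesis by (simp add: l_def)
  next
    case False
    \<comment> \<open>The last type has no next threshold, but its own is at least
      \<open>K ^ 2 * dl\<close>, which bounds all jobs.\<close>
    with l have "Suc l = d" by simp
    then have "l = kap * K + (K - 1)" using K_pos by (simp add: d_def)
    then have "l div K = (kap * K + (K - 1)) div K" by simp
    also have "\<dots> = kap" using K_pos by (subst div_mult_self3) auto
    finally have "l div K = kap" .
    then have "th l = int K * (int K + int (l mod K)) * dl" using l by (simp add: th_def K_def)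
    also have "\<dots> \<ge> int K * int K * dl" using dl_pos by (intro mult_right_mono mult_left_mono) auto
    finally have "JP j \<le> th l" using JP_le[OF j] by (simp add: power2_eq_square)
    then have "int K * JP j \<le> int K * th l" by (intro mult_left_mono) auto
    also have "\<dots> \<le> (int K + 1) * th l" using th_nonneg by (intro mult_right_mono) auto
    finally show ?thesis by (simp add: l_def)
  qed
qed

lemma b_less: "b l < 2 ^ L"
proof -
  have "card {j. j < n \<and> ty j = Suc l} \<le> card {..<n}" by (intro card_mono) auto
  then show ?thesis using m_less n_less by (auto simp: b_def)
qed

section \<open>Packed carries and configurations\<close>

lemma dig_B_less: "dig B h l < B"
  using params(1) by (rule dig_less)

lemma dig_B_less_R: "dig B h l < R"
  using dig_B_less[of h l] params(2) by linarith

lemma dig_EL: "l < D \<Longrightarrow> dig R (EL h) l = dig B h l"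
  unfolding EL_def by (rule dig_code) (rule dig_B_less_R)

lemma EL_less: "EL h < ZF"
  unfolding EL_def ZF_def by (rule code_less) (rule dig_B_less_R)

lemma dig_shift: "l < D \<Longrightarrow> dig R (2 * EL h + BE i) l = 2 * dig B h l + b l div 2 ^ i mod 2"
  and shift_less: "2 * EL h + BE i < ZF"
proof -
  have eq: "2 * EL h + BE i = code R D (\<lambda>l. 2 * dig B h l + b l div 2 ^ i mod 2)"
    by (simp add: EL_def BE_def code_add code_mult)
  have less: "2 * dig B h l + b l div 2 ^ i mod 2 < R" for l
    using dig_B_less[of h l] params(2) mod_less_divisor[of 2 "b l div 2 ^ i"] by linarith
  show "2 * EL h + BE i < ZF" unfolding eq ZF_def using less by (rule code_less)
  assume "l < D"
  then show "dig R (2 * EL h + BE i) l = 2 * dig B h l + b l div 2 ^ i mod 2"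
    unfolding eq using less by (intro dig_code) auto
qed

text \<open>Numbers in \<open>[N, 2 * N)\<close> have leading digit 1 at position \<open>d\<close>;
  subtracting \<open>N\<close> clears exactly this digit, whose weight \<open>th d\<close> is
  0.\<close>

lemma conf_split:
  assumes "q \<in> confs T"
  shows "q - N < N" "\<And>l. dig B q l = dig B (q - N) l + (if l = d then 1 else 0)"
    "dig B q d = 1" "ld q = ld (q - N)"
proof -
  have q: "N \<le> q" "q < 2 * N" using assms by (auto simp: confs_def)
  show less: "q - N < N" using q by linarith
  have "B ^ Suc d = B ^ D" by (simp add: D_def)
  moreover have "q - N + B ^ d = q" using q(1) unfolding N_def by simp
  ultimately have "q - N + B ^ d < B ^ Suc d" using less_le_trans[OF q(2) two_N_le] by simp
  from dig_add_power[OF this] show 1: "dig B q l = dig B (q - N) l + (if l = d then 1 else 0)" for l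
    using q(1) by (simp add: N_def)
  from 1[of d] dig_high[of "q - N" B d] less show "dig B q d = 1" by (simp add: N_def)
  show "ld q = ld (q - N)"
    unfolding ld_def by (rule sum.cong) (use 1 in \<open>auto simp: th_def\<close>)
qed

text \<open>A large job has rounded size at least \<open>K * dl\<close>, so a load of at most
  \<open>2 * K ^ 2 * dl\<close> admits at most \<open>2 * K\<close> of them.\<close>

lemma conf_bound:
  assumes "q \<in> confs T" "T \<le> 2 * int (K ^ 2) * dl" "l < D"
  shows "dig B q l \<le> 2 * K"
proof (cases "l < d")
  case True
  have "int (dig B q l) * (int K * dl) \<le> int (dig B q l) * th l"
    using th_ge[OF True] by (intro mult_left_mono) auto
  also have "\<dots> \<le> ld q"
    unfolding ld_def using assms(3) th_nonneg by (intro member_le_sum) auto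
  also have "\<dots> \<le> 2 * int (K ^ 2) * dl" using assms by (auto simp: confs_def)
  also have "\<dots> = int (2 * K) * (int K * dl)" by (simp add: power2_eq_square)
  finally have "int (dig B q l) \<le> int (2 * K)"
    using dl_pos K_pos by (subst (asm) mult_le_cancel_right_pos) auto
  then show ?thesis by (simp only: of_nat_le_iff)
next
  case False
  with assms(3) have "l = d" by (simp add: D_def)
  then show ?thesis using conf_split(3)[OF assms(1)] K_pos by simp
qed

text \<open>The machine digit limits the other digits by \<open>2 * K\<close> jobs per
  configuration. The summand 1 absorbs the bit dropped when the machine digit is halved, so that the
  bound survives \<open>rc_shift\<close>.\<close>

definition good :: "nat \<Rightarrow> bool" where
  "good c \<longleftrightarrow> c < ZF \<and> dig R c d \<le> R0 \<and> (\<forall>l<d. dig R c l \<le> 2 * K * (dig R c d + 1))"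

text \<open>Since \<open>2 * K * (R0 + 1) < R\<close>, all digit sums stay below the base, so adding
  packed numbers adds digit vectors.\<close>

lemma add_conf:
  assumes g: "good c" and top: "dig R c d < R0" and q: "q \<in> confs T" and T: "T \<le> 2 * int (K ^ 2) * dl"
  shows "l < D \<Longrightarrow> dig R (c + EL q) l = dig R c l + dig B q l" "good (c + EL q)"
proof -
  have c: "c = code R D (dig R c)" using g by (simp add: good_def ZF_def code_dig)
  have eq: "c + EL q = code R D (\<lambda>l. dig R c l + dig B q l)"
    by (subst c) (simp add: EL_def code_add)
  have d1: "dig B q d = 1" using conf_split(3)[OF q] .
  have bnd: "dig R c l + dig B q l \<le> 2 * K * (dig R c d + 1 + 1)" if "l < d" for l
    using that g conf_bound[OF q T, of l] by (auto simp: good_def D_def algebra_simps intro: add_mono)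
  have less: "dig R c l + dig B q l < R" if l: "l < D" for l
  proof (cases "l = d")
    case True
    then show ?thesis using d1 top params(4) by simp
  next
    case False
    with l have "l < d" by (simp add: D_def)
    from bnd[OF this] have "dig R c l + dig B q l \<le> 2 * K * (dig R c d + 1 + 1)" .
    also have "\<dots> \<le> 2 * K * (R0 + 1)" using top by (intro mult_left_mono) auto
    finally show ?thesis using params(5) by linarith
  qed
  show digs: "dig R (c + EL q) l = dig R c l + dig B q l" if "l < D" for l
    unfolding eq using less that by (intro dig_code) auto
  have "c + EL q < ZF" unfolding eq ZF_def using less by (intro code_less)
  moreover have "dig R (c + EL q) d = dig R c d + 1" using digs[of d] d1 by (simp add: D_def)
  ultimately show "good (c + EL q)" unfolding good_def using top bnd digs by (auto simp: D_def)
qed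

lemma top_less_ZB: "c < ZB \<Longrightarrow> dig R c d < R0"
  unfolding ZB_def using dig_top_less params(4) by (metis less_imp_le_nat)

text \<open>The program compares whole states with \<open>ZB\<close> instead of extracting the
  machine digit, which would need a division.\<close>

lemma less_ZB:
  assumes "c < ZF" "dig R c d < R0"
  shows "c < ZB"
proof -
  have "c div R ^ d < R" using assms(1) unfolding ZF_def D_def
    by (intro less_mult_imp_div_less) (simp add: mult.commute)
  then have "c div R ^ d < R0" using assms(2) by (simp add: dig_def)
  then show ?thesis unfolding ZB_def using R_pos by (simp add: div_less_iff_less_mult)
qed

lemma shift_good:
  assumes g: "good (2 * EL h + BE i)"
  shows "good (EL h)"
proof -
  define u where "u = 2 * EL h + BE i"
  have dig: "dig R u l = 2 * dig B h l + b l div 2 ^ i mod 2" if "l < D" for l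
    unfolding u_def using that by (rule dig_shift)
  have dd: "d < D" by (simp add: D_def)
  have "dig B h d \<le> R0" using g dig[OF dd] by (simp add: good_def flip: u_def)
  moreover have "dig B h l \<le> 2 * K * (dig B h d + 1)" if "l < d" for l
  proof -
    have "dig R u l \<le> 2 * K * (dig R u d + 1)" using g that by (simp add: good_def flip: u_def)
    then have "2 * dig B h l \<le> 2 * K * (2 * dig B h d + b d div 2 ^ i mod 2 + 1)"
      using dig[OF dd] dig[of l] that dd by simp
    also have "\<dots> \<le> 2 * K * (2 * dig B h d + 2)" by (intro mult_left_mono) auto
    finally show ?thesis by simp
  qed
  ultimately show ?thesis using EL_less dig_EL dd by (auto simp: good_def D_def)
qed

lemma rc_good:
  assumes "rc T i c" "T \<le> 2 * int (K ^ 2) * dl"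
  shows "i \<le> L \<and> good c"
  using assms(1)
proof (induction rule: rc.induct)
  case rc_init
  show ?case using R_pos by (simp add: good_def ZF_def)
next
  case (rc_add i c q)
  then show ?case using add_conf(2)[OF _ top_less_ZB _ assms(2)] by auto
next
  case (rc_shift i h)
  then show ?case using shift_good by auto
qed

lemma rc_mono: "rc T i c \<Longrightarrow> T \<le> T' \<Longrightarrow> rc T' i c"
  by (induction rule: rc.induct) (auto intro: rc.intros simp: confs_def)

subsection \<open>Completeness of the carry automaton\<close>

lemma finite_confs [simp]: "finite (confs T)"
  by (rule finite_subset[of _ "{..<2 * N}"]) (auto simp: confs_def)

text \<open>The configurations are added one at a time. Each raises the machine digit by 1, so this
  digit is below \<open>R0\<close> before every addition, as \<open>rc_add\<close> demands.\<close>

lemma rc_add_set: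
  assumes T: "T \<le> 2 * int (K ^ 2) * dl" and rc: "rc T i c" and i: "i < L"
    and F: "finite F" "F \<subseteq> confs T" "dig R c d + card F \<le> R0"
  shows "rc T i (c + sum EL F) \<and> (\<forall>l<D. dig R (c + sum EL F) l = dig R c l + (\<Sum>q\<in>F. dig B q l))"
  using F
proof (induction rule: finite_induct)
  case empty
  show ?case using rc by simp
next
  case (insert q F)
  have q: "q \<in> confs T" and F: "F \<subseteq> confs T" using insert.prems(1) by simp_all
  have card: "card (insert q F) = Suc (card F)" using insert.hyps by simp
  have IH: "rc T i (c + sum EL F)" "\<And>l. l < D \<Longrightarrow> dig R (c + sum EL F) l = dig R c l + (\<Sum>q\<in>F. dig B q l)"
    using insert.IH F insert.prems(2) unfolding card by simp_all
  have "(\<Sum>q\<in>F. dig B q d) = (\<Sum>q\<in>F. 1)" by (rule sum.cong) (use F conf_split(3) in auto)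
  then have top: "dig R (c + sum EL F) d < R0"
    using IH(2)[of d] insert.prems(2) unfolding card by (simp add: D_def)
  have good: "good (c + sum EL F)" using rc_good[OF IH(1) T] by simp
  then have "c + sum EL F < ZB" using top by (intro less_ZB) (simp_all add: good_def)
  from rc_add[OF IH(1) i this q] have "rc T i (c + sum EL (insert q F))"
    using insert.hyps by (simp add: add_ac)
  moreover have "dig R (c + sum EL (insert q F)) l = dig R c l + (\<Sum>q\<in>insert q F. dig B q l)" if "l < D" for l
  proof -
    have e: "c + sum EL (insert q F) = c + sum EL F + EL q" using insert.hyps by (simp add: add_ac)
    show ?thesis unfolding e using add_conf(1)[OF good top q T that] IH(2)[OF that] insert.hyps by simp
  qed
  ultimately show ?case by blast
qed

text \<open>Invariant: the carry and a solution \<open>x\<close> for the rest together make up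
  \<open>b l div 2 ^ i\<close>. In every round \<open>x\<close> is exchanged for a solution with
  fewer than \<open>N0\<close> odd multiplicities, its odd configurations enter the carry, and
  everything is halved. The machine digit rises from at most \<open>N0\<close> to at most
  \<open>2 * N0\<close> and falls back.\<close>

lemma rc_complete_aux:
  assumes T: "T \<le> 2 * int (K ^ 2) * dl"
  shows "rc T i c \<Longrightarrow> dig R c d \<le> N0 \<Longrightarrow>
    (\<And>l. l < D \<Longrightarrow> dig R c l + (\<Sum>q\<in>confs T. x q * dig B q l) = b l div 2 ^ i) \<Longrightarrow> rc T L 0"
proof (induction "L - i" arbitrary: i c x)
  case 0
  have g: "i \<le> L" "good c" using rc_good[OF 0(2) T] by simp_all
  with 0 have i: "i = L" by simp
  \<comment> \<open>As \<open>b l < 2 ^ L\<close>, nothing is left to account for after the last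
    bit.\<close>
  have "dig R c l = 0" if "l < D" for l
    using 0(4)[OF that] b_less[of l] i by simp
  then have "code R D (dig R c) = code R D (\<lambda>_. 0)" by (intro code_cong) auto
  then have "c = 0" using g by (simp add: good_def ZF_def code_dig)
  with 0 i show ?case by simp
next
  case (Suc e)
  then have i: "i < L" by simp
  from few_odd_multiplicities[of "confs T" D "dig B" "2 * K" N0 x, OF finite_confs conf_bound[OF _ T] pigeonhole_bound]
  obtain y where y: "\<And>l. l < D \<Longrightarrow> (\<Sum>q\<in>confs T. y q * dig B q l) = (\<Sum>q\<in>confs T. x q * dig B q l)"
    "card {q \<in> confs T. odd (y q)} < N0" by auto
  define F where "F = {q \<in> confs T. odd (y q)}"
  have F: "finite F" "F \<subseteq> confs T" "card F < N0" using y(2) by (auto simp: F_def)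
  define u where "u = c + sum EL F"
  have "dig R c d + card F \<le> R0" using Suc.prems(2) F(3) params(3) by simp
  from rc_add_set[OF T Suc.prems(1) i F(1,2) this]
  have u: "rc T i u" "\<And>l. l < D \<Longrightarrow> dig R u l = dig R c l + (\<Sum>q\<in>F. dig B q l)" by (auto simp: u_def)
  have gu: "good u" using rc_good[OF u(1) T] by simp
  have ysplit: "(\<Sum>q\<in>confs T. y q * dig B q l) = (\<Sum>q\<in>F. dig B q l) + 2 * (\<Sum>q\<in>confs T. (y q div 2) * dig B q l)" for l
  proof -
    have "(\<Sum>q\<in>confs T. y q * dig B q l) =
      (\<Sum>q\<in>confs T. (if odd (y q) then dig B q l else 0) + 2 * ((y q div 2) * dig B q l))"
    proof (rule sum.cong[OF refl])
      fix q
      have "y q = 2 * (y q div 2) + (if odd (y q) then 1 else 0)" by simp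
      then have "y q * dig B q l = (2 * (y q div 2) + (if odd (y q) then 1 else 0)) * dig B q l" by simp
      then show "y q * dig B q l = (if odd (y q) then dig B q l else 0) + 2 * ((y q div 2) * dig B q l)"
        by (simp add: algebra_simps)
    qed
    then show ?thesis by (simp add: sum.distrib sum_distrib_left F_def sum.inter_filter)
  qed
  have eq: "dig R u l + 2 * (\<Sum>q\<in>confs T. (y q div 2) * dig B q l) = b l div 2 ^ i" if "l < D" for l
    using Suc.prems(3)[OF that] y(1)[OF that] u(2)[OF that] ysplit[of l] by simp
  \<comment> \<open>The remaining multiplicities are even, so digit \<open>l\<close> has the parity
    of bit \<open>i\<close> of \<open>b l\<close>, and \<open>w\<close> is the exact half once this
    bit is removed.\<close>
  define w where "w l = dig R u l div 2" for l
  have par: "dig R u l = 2 * w l + b l div 2 ^ i mod 2" if "l < D" for l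
  proof -
    have "b l div 2 ^ i mod 2 = dig R u l mod 2" using eq[OF that, symmetric] by simp
    then show ?thesis by (simp add: w_def)
  qed
  have "(\<Sum>q\<in>F. dig B q d) = card F"
    using F(2) conf_split(3) by (subst sum.cong[OF refl, of F _ "\<lambda>_. 1"]) auto
  then have ud: "dig R u d \<le> 2 * N0" using u(2)[of d] Suc.prems(2) F(3) by (simp add: D_def)
  then have wd: "w d \<le> N0" by (simp add: w_def)
  have wB: "w l < B" if "l < D" for l
  proof (cases "l = d")
    case True
    with wd params(7) show ?thesis by simp
  next
    case False
    with that have "dig R u l \<le> 2 * K * (dig R u d + 1)" using gu by (simp add: good_def D_def)
    also have "\<dots> \<le> 2 * K * (2 * N0 + 1)" using ud by (intro mult_left_mono) auto
    finally have "w l \<le> K * (2 * N0 + 1)" by (simp add: w_def)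
    with params(6) show ?thesis by simp
  qed
  define h where "h = code B D w"
  have digh: "dig B h l = w l" if "l < D" for l unfolding h_def using wB that by (rule dig_code)
  have h: "h < B ^ D" unfolding h_def using wB by (rule code_less)
  \<comment> \<open>States below \<open>ZF\<close> are determined by their digits, so
    \<open>u\<close> has the form to which \<open>rc_shift\<close> applies.\<close>
  have "code R D (dig R u) = code R D (dig R (2 * EL h + BE i))"
    by (rule code_cong) (use par digh dig_shift in auto)
  then have "u = 2 * EL h + BE i" using gu shift_less by (simp add: good_def ZF_def code_dig)
  with u(1) have "rc T i (2 * EL h + BE i)" by simp
  from rc_shift[OF this i h] have rc: "rc T (Suc i) (EL h)" .
  show ?case
  proof (rule Suc.hyps(1)[OF _ rc])
    show "e = L - Suc i" using Suc.hyps(2) by simp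
    show "dig R (EL h) d \<le> N0" using dig_EL[of d h] digh[of d] wd by (simp add: D_def)
    fix l assume l: "l < D"
    have "b l div 2 ^ Suc i = b l div 2 ^ i div 2" by (simp only: power_Suc2 div_mult2_eq)
    also have "\<dots> = w l + (\<Sum>q\<in>confs T. (y q div 2) * dig B q l)"
      unfolding eq[OF l, symmetric] w_def by simp
    finally show "dig R (EL h) l + (\<Sum>q\<in>confs T. (y q div 2) * dig B q l) = b l div 2 ^ Suc i"
      using dig_EL[OF l] digh[OF l] by simp
  qed
qed

lemma rc_complete:
  assumes "T \<le> 2 * int (K ^ 2) * dl"
    and "\<And>l. l < D \<Longrightarrow> (\<Sum>q\<in>confs T. x q * dig B q l) = b l"
  shows "rc T L 0"
  by (rule rc_complete_aux[OF assms(1) rc_init, of x]) (simp_all add: assms(2))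

text \<open>Rounding down keeps the job vector of every machine within \<open>T\<close>; the
  multiplicity of a configuration is the number of machines with this vector.\<close>

lemma schedule_confs:
  assumes a: "\<And>j. j < n \<Longrightarrow> a j < m" and load: "\<And>i. i < m \<Longrightarrow> (\<Sum>j | j < n \<and> a j = i. JP j) \<le> T"
    and T: "T \<le> 2 * int (K ^ 2) * dl"
  shows "\<exists>x. \<forall>l<D. (\<Sum>q\<in>confs T. x q * dig B q l) = b l"
proof -
  define v where "v i l = (if l = d then 1 else card {j. j < n \<and> a j = i \<and> ty j = Suc l})" for i l
  have ty_minus: "ty j - 1 < d" if "ty j > 0" for j using ty_le[of j] that by linarith
  have ldv: "(\<Sum>l<d. int (v i l) * th l) \<le> T" if i: "i < m" for i
  proof -
    have "(\<Sum>l<d. int (v i l) * th l) = (\<Sum>l<d. \<Sum>j | j < n \<and> a j = i \<and> ty j = Suc l. th (ty j - 1))"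
      by (rule sum.cong[OF refl]) (simp add: v_def)
    also have "\<dots> = (\<Sum>l<d. \<Sum>j | j \<in> {j. j < n \<and> a j = i \<and> ty j > 0} \<and> ty j - 1 = l. th (ty j - 1))"
      by (intro sum.cong refl) auto
    also have "\<dots> = (\<Sum>j | j < n \<and> a j = i \<and> ty j > 0. th (ty j - 1))"
    proof (rule sum.group)
      show "(\<lambda>j. ty j - 1) ` {j. j < n \<and> a j = i \<and> ty j > 0} \<subseteq> {..<d}" using ty_minus by blast
    qed simp_all
    also have "\<dots> \<le> (\<Sum>j | j < n \<and> a j = i \<and> ty j > 0. JP j)" by (intro sum_mono th_ty) auto
    also have "\<dots> \<le> (\<Sum>j | j < n \<and> a j = i. JP j)" by (intro sum_mono2) (auto simp: JP_pos less_imp_le)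
    also have "\<dots> \<le> T" using load[OF i] .
    finally show ?thesis .
  qed
  have vB: "v i l < B" if i: "i < m" and l: "l < D" for i l
  proof (cases "l = d")
    case True
    then show ?thesis using params(8) K_pos by (simp add: v_def)
  next
    case False
    with l have l: "l < d" by (simp add: D_def)
    have "int (v i l) * (int K * dl) \<le> int (v i l) * th l"
      using th_ge[OF l] by (intro mult_left_mono) auto
    also have "\<dots> \<le> (\<Sum>l<d. int (v i l) * th l)" using l th_nonneg by (intro member_le_sum) auto
    also have "\<dots> \<le> int (2 * K) * (int K * dl)" using ldv[OF i] T by (simp add: power2_eq_square)
    finally have "int (v i l) \<le> int (2 * K)"
      using dl_pos K_pos by (subst (asm) mult_le_cancel_right_pos) auto
    then show ?thesis using params(8) by linarith
  qed
  define q where "q i = code B D (v i)" for i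
  have digq: "dig B (q i) l = v i l" if "i < m" "l < D" for i l
    unfolding q_def using vB[OF that(1)] that(2) by (rule dig_code)
  have qc: "q i \<in> confs T" if i: "i < m" for i
  proof -
    have "code B d (v i) < N" unfolding N_def using vB[OF i] by (intro code_less) (simp add: D_def)
    moreover have "v i d = 1" by (simp add: v_def)
    then have "q i = code B d (v i) + N" unfolding q_def D_def N_def Suc_eq_plus1[symmetric] code_Suc by simp
    moreover have "ld (q i) = (\<Sum>l<d. int (v i l) * th l)"
    proof -
      have "ld (q i) = (\<Sum>l<d. int (dig B (q i) l) * th l)" unfolding ld_def D_def by (simp add: th_def)
      also have "\<dots> = (\<Sum>l<d. int (v i l) * th l)"
      proof (rule sum.cong[OF refl])
        fix l assume "l \<in> {..<d}"
        then have "dig B (q i) l = v i l" using digq[OF i, of l] unfolding D_def by simp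
        then show "int (dig B (q i) l) * th l = int (v i l) * th l" by (rule arg_cong)
      qed
      finally show ?thesis .
    qed
    ultimately show ?thesis using ldv[OF i] by (simp add: confs_def)
  qed
  have "(\<Sum>r\<in>confs T. card {i. i < m \<and> q i = r} * dig B r l) = b l" if l: "l < D" for l
  proof -
    have "card {i. i < m \<and> q i = r} * dig B r l = (\<Sum>i | i \<in> {..<m} \<and> q i = r. dig B (q i) l)" for r
    proof -
      have "(\<Sum>i | i \<in> {..<m} \<and> q i = r. dig B (q i) l) = (\<Sum>i | i \<in> {..<m} \<and> q i = r. dig B r l)"
        by (rule sum.cong) auto
      then show ?thesis by simp
    qed
    then have "(\<Sum>r\<in>confs T. card {i. i < m \<and> q i = r} * dig B r l) =
       (\<Sum>r\<in>confs T. \<Sum>i | i \<in> {..<m} \<and> q i = r. dig B (q i) l)" by presburger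
    also have "\<dots> = (\<Sum>i\<in>{..<m}. dig B (q i) l)"
    proof (rule sum.group)
      show "q ` {..<m} \<subseteq> confs T" using qc by blast
    qed simp_all
    also have "\<dots> = (\<Sum>i\<in>{..<m}. v i l)"
    proof (rule sum.cong[OF refl])
      fix i assume "i \<in> {..<m}"
      then show "dig B (q i) l = v i l" using digq[OF _ l, of i] by simp
    qed
    also have "\<dots> = b l"
    proof (cases "l = d")
      case True
      then have "v i l = 1" for i by (simp add: v_def)
      moreover have "b l = m" using True by (simp add: b_def)
      ultimately show ?thesis by simp
    next
      case False
      with l have ld: "l < d" by (simp add: D_def)
      have "(\<Sum>i<m. v i l) = (\<Sum>i<m. \<Sum>j | j \<in> {j. j < n \<and> ty j = Suc l} \<and> a j = i. 1)"
      proof (rule sum.cong[OF refl])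
        fix i
        have "{j. j \<in> {j. j < n \<and> ty j = Suc l} \<and> a j = i} = {j. j < n \<and> a j = i \<and> ty j = Suc l}" by blast
        moreover have "v i l = card {j. j < n \<and> a j = i \<and> ty j = Suc l}" using False by (simp add: v_def)
        ultimately show "v i l = (\<Sum>j | j \<in> {j. j < n \<and> ty j = Suc l} \<and> a j = i. 1)" by simp
      qed
      also have "\<dots> = (\<Sum>j | j < n \<and> ty j = Suc l. 1)"
      proof (rule sum.group)
        show "a ` {j. j < n \<and> ty j = Suc l} \<subseteq> {..<m}" using a by blast
      qed simp_all
      also have "\<dots> = b l" unfolding b_def using ld by simp
      finally show ?thesis .
    qed
    finally show ?thesis .
  qed
  then show ?thesis by (intro exI[of _ "\<lambda>r. card {i. i < m \<and> q i = r}"] allI impI)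
qed

subsection \<open>Bounds on the optimum\<close>

lemma finite_assignments: "finite (assignments n m)"
  by (simp add: assignments_def finite_PiE)

lemma assignments_nonempty: "assignments n m \<noteq> {}"
  using m_pos by (auto simp: assignments_def PiE_eq_empty_iff lessThan_empty_iff)

definition opt :: int where "opt = int m * int (K ^ 2) * opt_makespan n m p"

lemma scaled_load: "(\<Sum>j | j < n \<and> a j = i. JP j) = int m * int (K ^ 2) * (\<Sum>j | j < n \<and> a j = i. p j)"
  by (simp add: JP_def sum_distrib_left sum_distrib_right algebra_simps)

lemma load_le_makespan: "i < m \<Longrightarrow> (\<Sum>j | j < n \<and> a j = i. p j) \<le> makespan n m p a"
  unfolding makespan_def by (intro Max_ge) auto

lemma makespan_attained:
  obtains i where "i < m" "makespan n m p a = (\<Sum>j | j < n \<and> a j = i. p j)"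
proof -
  have "makespan n m p a \<in> (\<lambda>i. \<Sum>j | j < n \<and> a j = i. p j) ` {..<m}"
    unfolding makespan_def by (intro Max_in) (use m_pos in \<open>auto simp: lessThan_empty_iff\<close>)
  then show ?thesis using that by auto
qed

lemma opt_attained:
  obtains a where "a \<in> assignments n m" "makespan n m p a = opt_makespan n m p"
proof -
  have "opt_makespan n m p \<in> makespan n m p ` assignments n m"
    unfolding opt_makespan_def using finite_assignments assignments_nonempty by (intro Min_in) auto
  then show ?thesis using that by auto
qed

lemma opt_makespan_le: "a \<in> assignments n m \<Longrightarrow> opt_makespan n m p \<le> makespan n m p a"
  unfolding opt_makespan_def using finite_assignments by (intro Min_le) auto

lemma scale_pos: "int m * int (K ^ 2) > 0"
  using m_pos K_pos by simp

lemma opt_schedule: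
  obtains a where "\<And>j. j < n \<Longrightarrow> a j < m" "\<And>i. i < m \<Longrightarrow> (\<Sum>j | j < n \<and> a j = i. JP j) \<le> opt"
proof -
  obtain a where a: "a \<in> assignments n m" "makespan n m p a = opt_makespan n m p" by (rule opt_attained)
  show ?thesis
  proof (rule that)
    show "a j < m" if "j < n" for j using a(1) that by (auto simp: assignments_def)
    show "(\<Sum>j | j < n \<and> a j = i. JP j) \<le> opt" if "i < m" for i
      unfolding scaled_load opt_def using load_le_makespan[OF that, of a] a(2) scale_pos
      by (intro mult_left_mono) auto
  qed
qed

lemma opt_ge: "int (K ^ 2) * dl \<le> opt"
proof -
  obtain a where a: "\<And>j. j < n \<Longrightarrow> a j < m" "\<And>i. i < m \<Longrightarrow> (\<Sum>j | j < n \<and> a j = i. JP j) \<le> opt"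
    by (rule opt_schedule) blast
  have "int (K ^ 2) * mx \<le> opt"
  proof -
    obtain j where j: "j < n" "mx = int m * p j" using mx_props(3) by blast
    have "int (K ^ 2) * mx = JP j" using j by (simp add: JP_def)
    also have "\<dots> \<le> (\<Sum>i | i < n \<and> a i = a j. JP i)"
      using j by (intro member_le_sum) (auto simp: JP_pos less_imp_le)
    also have "\<dots> \<le> opt" using a j by blast
    finally show ?thesis .
  qed
  moreover have "int (K ^ 2) * P \<le> opt"
  proof -
    have "int m * av = (\<Sum>i<m. \<Sum>j | j \<in> {..<n} \<and> a j = i. JP j)"
      using a(1) unfolding sum_JP[symmetric] by (intro sum.group[symmetric]) auto
    also have "\<dots> \<le> (\<Sum>i<m. opt)" using a(2) by (intro sum_mono) auto
    finally have "int m * av \<le> int m * opt" by simp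
    then show ?thesis using m_pos by (simp add: av_def mult.commute)
  qed
  ultimately show ?thesis by (simp add: dl_def max_def)
qed

lemma av_le_opt: "av \<le> opt"
  using av_le opt_ge by linarith

text \<open>List scheduling with \<open>w\<close> the largest processing time: multiplied by
  \<open>m\<close>, the average load and the largest job are each at most \<open>dl\<close>.\<close>

lemma opt_le: "opt \<le> 2 * int (K ^ 2) * dl"
proof -
  have "\<exists>a. (\<forall>j<n. a j < m) \<and> (\<forall>i<m. int m * (\<Sum>j | j < n \<and> a j = i. p j) \<le> (\<Sum>j<n. p j) + int m * (MAX j\<in>{..<n}. p j))"
  proof (rule list_schedule[OF m_pos])
    have *: "p j \<le> (MAX j\<in>{..<n}. p j)" if "j < n" for j using that by (intro Max_ge) auto
    then show "0 \<le> p j \<and> p j \<le> (MAX j\<in>{..<n}. p j)" if "j < n" for j using p_pos[of j] that by (simp add: less_imp_le)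
    have "p 0 \<le> (MAX j\<in>{..<n}. p j)" "p 0 > 0" using *[of 0] p_pos[of 0] n_pos by simp_all
    then show "(MAX j\<in>{..<n}. p j) \<ge> 0" by linarith
  qed
  then obtain a where a: "\<And>j. j < n \<Longrightarrow> a j < m"
    "\<And>i. i < m \<Longrightarrow> int m * (\<Sum>j | j < n \<and> a j = i. p j) \<le> P + int m * (MAX j\<in>{..<n}. p j)"
    by (auto simp: P_def)
  have "(MAX j\<in>{..<n}. p j) \<in> p ` {..<n}"
    by (intro Max_in) (use m_less in \<open>auto simp: lessThan_empty_iff\<close>)
  then obtain j where "j < n" "(MAX j\<in>{..<n}. p j) = p j" by auto
  with mx_props(2)[of j] have mx: "int m * (MAX j\<in>{..<n}. p j) \<le> dl" by (simp add: dl_def)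
  define a' where "a' = restrict a {..<n}"
  have sums: "(\<Sum>j | j < n \<and> a' j = i. p j) = (\<Sum>j | j < n \<and> a j = i. p j)" for i
    by (rule sum.cong) (auto simp: a'_def)
  have "a' \<in> assignments n m" using a(1) by (auto simp: assignments_def a'_def)
  then have le: "opt_makespan n m p \<le> makespan n m p a'" by (rule opt_makespan_le)
  obtain i where i: "i < m" "makespan n m p a' = (\<Sum>j | j < n \<and> a' j = i. p j)"
    by (rule makespan_attained)
  have "int m * opt_makespan n m p \<le> int m * (\<Sum>j | j < n \<and> a j = i. p j)"
    using le i(2) sums by (intro mult_left_mono) auto
  also have "\<dots> \<le> 2 * dl" using a(2)[OF i(1)] mx by (simp add: dl_def)
  finally have "int (K ^ 2) * (int m * opt_makespan n m p) \<le> int (K ^ 2) * (2 * dl)" by (intro mult_left_mono) auto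
  then show ?thesis by (simp add: opt_def mult_ac)
qed

lemma th_dvd: "dl dvd th l"
  by (simp add: th_def)

lemma ld_dvd: "dl dvd ld h"
  unfolding ld_def using th_dvd by (intro dvd_sum) simp

text \<open>Rounded loads are multiples of \<open>dl\<close>, so lowering the bound from
  \<open>opt\<close> to the largest such multiple loses no configuration.\<close>

definition tau :: nat where "tau = nat (opt div dl)"

lemma tau_le: "int tau * dl \<le> opt" and tau_bounds: "1 \<le> tau" "tau \<le> 2 * K ^ 2"
proof -
  have K2: "1 \<le> int (K ^ 2)" using K_pos by simp
  have ge: "int (K ^ 2) \<le> opt div dl" using zdiv_mono1[OF opt_ge dl_pos] dl_pos by simp
  then have tau: "int tau = opt div dl" using K2 by (simp add: tau_def)
  have "dl * (opt div dl) \<le> opt" using dl_pos mult_div_mod_eq[of dl opt] pos_mod_sign[of dl opt] by linarith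
  then show "int tau * dl \<le> opt" unfolding tau by (simp add: mult.commute)
  show "1 \<le> tau" using ge K2 tau by linarith
  have "opt div dl \<le> (2 * int (K ^ 2) * dl) div dl" using opt_le dl_pos by (intro zdiv_mono1) auto
  then have "int tau \<le> int (2 * K ^ 2)" using dl_pos tau by simp
  then show "tau \<le> 2 * K ^ 2" by (simp only: of_nat_le_iff)
qed

text \<open>Guarantees that the search over multiples of \<open>dl\<close> succeeds at the latest at
  \<open>tau\<close>, hence with a bound of at most \<open>opt\<close>.\<close>

lemma feasible: "rc (int tau * dl) L 0"
proof -
  obtain a where a: "\<And>j. j < n \<Longrightarrow> a j < m" "\<And>i. i < m \<Longrightarrow> (\<Sum>j | j < n \<and> a j = i. JP j) \<le> opt"
    by (rule opt_schedule) blast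
  from schedule_confs[OF a opt_le] obtain x where
    x: "\<forall>l<D. (\<Sum>q\<in>confs opt. x q * dig B q l) = b l" by (rule exE)
  have "ld q \<le> int tau * dl" if le: "ld q \<le> opt" for q
  proof -
    obtain c where c: "ld q = dl * c" using ld_dvd[of q] by (rule dvdE)
    then have "c \<le> opt div dl" using zdiv_mono1[OF le dl_pos] dl_pos by simp
    then have "c \<le> int tau" by (simp add: tau_def)
    then show ?thesis using c dl_pos by simp
  qed
  then have le: "ld q \<le> opt \<longleftrightarrow> ld q \<le> int tau * dl" for q using tau_le by (meson order_trans)
  have eq: "confs opt = confs (int tau * dl)" unfolding confs_def le ..
  show ?thesis
  proof (rule rc_complete)
    show "int tau * dl \<le> 2 * int (K ^ 2) * dl" using tau_le opt_le by (rule order_trans)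
    show "(\<Sum>q\<in>confs (int tau * dl). x q * dig B q l) = b l" if "l < D" for l
      using x that unfolding eq by simp
  qed
qed

text \<open>\<open>(K + 1) / K\<close> is at most \<open>1 + eps\<close> because
  \<open>K >= k >= 1 / eps\<close>, and the scaling by \<open>m * K ^ 2\<close> cancels.\<close>

lemma approximation:
  assumes a: "\<And>j. j < n \<Longrightarrow> a j < m"
    and load: "\<And>i. i < m \<Longrightarrow> int K * (\<Sum>j | j < n \<and> a j = i. JP j) \<le> (int K + 1) * opt"
    and \<epsilon>: "\<epsilon> > 0" "int k = \<lceil>1 / \<epsilon>\<rceil>"
  shows "restrict a {..<n} \<in> assignments n m"
    "real_of_int (makespan n m p (restrict a {..<n})) \<le> (1 + \<epsilon>) * real_of_int (opt_makespan n m p)"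
proof -
  define a' where "a' = restrict a {..<n}"
  have sums: "(\<Sum>j | j < n \<and> a' j = i. p j) = (\<Sum>j | j < n \<and> a j = i. p j)" for i
    by (rule sum.cong) (auto simp: a'_def)
  have mem: "a' \<in> assignments n m" using a by (auto simp: assignments_def a'_def)
  obtain i where i: "i < m" "makespan n m p a' = (\<Sum>j | j < n \<and> a' j = i. p j)"
    by (rule makespan_attained)
  have "int m * int (K ^ 2) * (int K * makespan n m p a') \<le> int m * int (K ^ 2) * ((int K + 1) * opt_makespan n m p)"
    using load[OF i(1)] unfolding scaled_load opt_def i(2) sums
    by (subst (1 2) mult.left_commute)
  then have le: "int K * makespan n m p a' \<le> (int K + 1) * opt_makespan n m p"
    using scale_pos by (simp only: mult_le_cancel_left_pos)
  have pos: "opt_makespan n m p \<ge> 0"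
  proof -
    have "0 \<le> int (K ^ 2) * dl" using dl_pos by simp
    then have "0 \<le> int m * int (K ^ 2) * opt_makespan n m p" using opt_ge unfolding opt_def by linarith
    then show ?thesis using scale_pos by (simp add: zero_le_mult_iff)
  qed
  have "real_of_int (int K * makespan n m p a') \<le> real_of_int ((int K + 1) * opt_makespan n m p)"
    using le by (simp only: of_int_le_iff)
  then have 1: "real K * makespan n m p a' \<le> (real K + 1) * opt_makespan n m p" by simp
  have "1 / \<epsilon> \<le> of_int \<lceil>1 / \<epsilon>\<rceil>" by (rule le_of_int_ceiling)
  also have "\<dots> = real k" unfolding \<epsilon>(2)[symmetric] by simp
  also have "\<dots> \<le> real K" using k_le_K by simp
  finally have "1 \<le> real K * \<epsilon>" using \<epsilon>(1) by (simp add: field_simps)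
  then have "(real K + 1) * opt_makespan n m p \<le> (real K + real K * \<epsilon>) * opt_makespan n m p"
    using pos by (intro mult_right_mono) auto
  with 1 have "real K * makespan n m p a' \<le> real K * ((1 + \<epsilon>) * opt_makespan n m p)"
    by (simp add: algebra_simps)
  then have "makespan n m p a' \<le> (1 + \<epsilon>) * opt_makespan n m p"
    using K_pos by (subst (asm) mult_le_cancel_left_pos) auto
  then show "restrict a {..<n} \<in> assignments n m"
    "real_of_int (makespan n m p (restrict a {..<n})) \<le> (1 + \<epsilon>) * real_of_int (opt_makespan n m p)"
    using mem by (auto simp: a'_def)
qed

end

subsection \<open>The program\<close>

abbreviation (input) vk :: nat where "vk \<equiv> 0"
abbreviation (input) vn :: nat where "vn \<equiv> 1"
abbreviation (input) vm :: nat where "vm \<equiv> 2"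
abbreviation (input) vt :: nat where "vt \<equiv> 3"
abbreviation (input) vK :: nat where "vK \<equiv> 4"
abbreviation (input) vL :: nat where "vL \<equiv> 5"
abbreviation (input) vj :: nat where "vj \<equiv> 6"
abbreviation (input) vP :: nat where "vP \<equiv> 7"
abbreviation (input) vmx :: nat where "vmx \<equiv> 8"
abbreviation (input) vr :: nat where "vr \<equiv> 9"
abbreviation (input) vi :: nat where "vi \<equiv> 10"
abbreviation (input) vw :: nat where "vw \<equiv> 11"
abbreviation (input) vp :: nat where "vp \<equiv> 12"
abbreviation (input) vav :: nat where "vav \<equiv> 13"
abbreviation (input) vdl :: nat where "vdl \<equiv> 14"
abbreviation (input) vx :: nat where "vx \<equiv> 15"
abbreviation (input) vs :: nat where "vs \<equiv> 16"
abbreviation (input) vu :: nat where "vu \<equiv> 17"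
abbreviation (input) vd :: nat where "vd \<equiv> 18"
abbreviation (input) vR :: nat where "vR \<equiv> 19"
abbreviation (input) vB :: nat where "vB \<equiv> 20"
abbreviation (input) vR0 :: nat where "vR0 \<equiv> 21"
abbreviation (input) vZB :: nat where "vZB \<equiv> 22"
abbreviation (input) vZF :: nat where "vZF \<equiv> 23"
abbreviation (input) vlen :: nat where "vlen \<equiv> 24"
abbreviation (input) vstop :: nat where "vstop \<equiv> 25"
abbreviation (input) vN :: nat where "vN \<equiv> 26"
abbreviation (input) vT :: nat where "vT \<equiv> 27"
abbreviation (input) vtop :: nat where "vtop \<equiv> 28"
abbreviation (input) vbase :: nat where "vbase \<equiv> 29"
abbreviation (input) vc :: nat where "vc \<equiv> 30"
abbreviation (input) vq :: nat where "vq \<equiv> 31"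
abbreviation (input) vy :: nat where "vy \<equiv> 32"
abbreviation (input) vh :: nat where "vh \<equiv> 33"
abbreviation (input) vmach :: nat where "vmach \<equiv> 34"
abbreviation (input) vjb :: nat where "vjb \<equiv> 35"

abbreviation (input) aPW :: nat where "aPW \<equiv> 0"
abbreviation (input) aJP :: nat where "aJP \<equiv> 1"
abbreviation (input) aTH :: nat where "aTH \<equiv> 2"
abbreviation (input) aNX :: nat where "aNX \<equiv> 3"
abbreviation (input) aHD :: nat where "aHD \<equiv> 4"
abbreviation (input) aCT :: nat where "aCT \<equiv> 5"
abbreviation (input) aW :: nat where "aW \<equiv> 6"
abbreviation (input) aEL :: nat where "aEL \<equiv> 7"
abbreviation (input) aLD :: nat where "aLD \<equiv> 8"
abbreviation (input) aPA :: nat where "aPA \<equiv> 9"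
abbreviation (input) aTY :: nat where "aTY \<equiv> 10"
abbreviation (input) aBE :: nat where "aBE \<equiv> 11"
abbreviation (input) aVA :: nat where "aVA \<equiv> 12"
abbreviation (input) aXC :: nat where "aXC \<equiv> 13"
abbreviation (input) aOUT :: nat where "aOUT \<equiv> 14"
abbreviation (input) aLO :: nat where "aLO \<equiv> 15"

notation (input) Plus (infixl "\<oplus>" 65)
notation (input) Minus (infixl "\<ominus>" 65)
notation (input) Asg (infix "::=" 61)

text \<open>The variable \<open>y\<close> must hold a power of two.\<close>

definition mulp :: "nat \<Rightarrow> nat \<Rightarrow> com" where
  "mulp x y = vt ::= Num 1 \<then> While (Var y \<ominus> Var vt)
     (vt ::= Var vt \<oplus> Var vt \<then> x ::= Var x \<oplus> Var x)"

lemma mulp_simps [simp]: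
  "mvars (mulp x y) = {vt, x}" "marrs (mulp x y) = {}" "\<not> gets (mulp x y)" "\<not> puts (mulp x y)"
  "cwf (mulp x y) \<longleftrightarrow> x < 64 \<and> y < 64"
  by (auto simp: mulp_def)

lemma ht_Asg_Seq:
  assumes "ht d (s\<lparr>vars := (vars s)(x := aval e s)\<rparr>) U Q" "esize e + 2 + U \<le> V"
  shows "ht (x ::= e \<then> d) s V Q"
  by (rule ht_Seq[OF ht_straight[where Q = "\<lambda>s'. s' = s\<lparr>vars := (vars s)(x := aval e s)\<rparr>"]])
     (use assms in auto)

lemma ht_block:
  assumes "straight c" "\<And>s'. s' = run c s \<Longrightarrow> ht d s' U Q" "cost c + U \<le> V"
  shows "ht (c \<then> d) s V Q"
  by (rule ht_Seq[OF ht_straight[where Q = "\<lambda>s'. s' = run c s"]]) (use assms in auto)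

lemma ht_mulp:
  assumes "x \<noteq> vt" "y \<noteq> vt" "x \<noteq> y" "vars s y = 2 ^ e"
  shows "ht (mulp x y) s (40 * (e + 1)) (\<lambda>s'. vars s' x = vars s x * 2 ^ e)"
  unfolding mulp_def
proof (rule ht_Asg_Seq)
  let ?s = "s\<lparr>vars := (vars s)(vt := aval (Num 1) s)\<rparr>"
  show "ht (While (Var y \<ominus> Var vt) (vt ::= Var vt \<oplus> Var vt \<then> x ::= Var x \<oplus> Var x)) ?s (40 * e + 30)
     (\<lambda>s'. vars s' x = vars s x * 2 ^ e)"
  proof (rule ht_For[where I = "\<lambda>i s'. vars s' vt = 2 ^ i \<and> vars s' x = vars s x * 2 ^ i" and N = e and T = 14])
    show "ht (vt ::= Var vt \<oplus> Var vt \<then> x ::= Var x \<oplus> Var x) s' 14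
        (\<lambda>s'. vars s' vt = 2 ^ Suc i \<and> vars s' x = vars s x * 2 ^ Suc i)"
      if "vars s' vt = 2 ^ i \<and> vars s' x = vars s x * 2 ^ i" for i s'
      by (rule ht_straight) (use that assms(1) in auto)
  qed (use assms in \<open>auto simp: same_def\<close>)
qed auto

lemma nat_int_add_numeral [simp]: "nat (int i + numeral w) = i + numeral w"
  by (simp add: nat_add_distrib)

lemma nat_int_add_one [simp]: "nat (int i + 1) = Suc i"
  by simp

lemma nat_int_diff_one [simp]: "nat (int i - 1) = i - 1"
  by simp

text \<open>Binary digits are read from the top by comparing with and subtracting powers of two,
  which replaces division.\<close>

lemma bit_step:
  fixes w i :: nat
  shows "2 ^ i \<le> w mod 2 ^ Suc i \<Longrightarrow> w mod 2 ^ Suc i = w mod 2 ^ i + 2 ^ i \<and> w div 2 ^ i = 2 * (w div 2 ^ Suc i) + 1"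
    and "\<not> 2 ^ i \<le> w mod 2 ^ Suc i \<Longrightarrow> w mod 2 ^ Suc i = w mod 2 ^ i \<and> w div 2 ^ i = 2 * (w div 2 ^ Suc i)"
proof -
  have e: "w mod 2 ^ Suc i = w mod 2 ^ i + 2 ^ i * (w div 2 ^ i mod 2)"
    unfolding power_Suc2 mod_mult2_eq by simp
  have f: "w div 2 ^ Suc i = w div 2 ^ i div 2"
    by (simp only: power_Suc2 div_mult2_eq)
  have r: "w mod 2 ^ i < 2 ^ i" by simp
  have g: "w div 2 ^ i = 2 * (w div 2 ^ i div 2) + w div 2 ^ i mod 2" by simp
  have c: "w div 2 ^ i mod 2 = 0 \<or> w div 2 ^ i mod 2 = 1" by auto
  show "2 ^ i \<le> w mod 2 ^ Suc i \<Longrightarrow> w mod 2 ^ Suc i = w mod 2 ^ i + 2 ^ i \<and> w div 2 ^ i = 2 * (w div 2 ^ Suc i) + 1"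
    using c e f r g by (elim disjE) (simp_all del: power_Suc)
  show "\<not> 2 ^ i \<le> w mod 2 ^ Suc i \<Longrightarrow> w mod 2 ^ Suc i = w mod 2 ^ i \<and> w div 2 ^ i = 2 * (w div 2 ^ Suc i)"
    using c e f r g by (elim disjE) (simp_all del: power_Suc)
qed

section \<open>Preprocessing: accuracy, bounds, thresholds and job lists\<close>

definition set_accuracy :: com where
  "set_accuracy = vK ::= Num 1 \<then> While (Var vk \<ominus> Var vK) (vK ::= Var vK \<oplus> Var vK)"

definition set_powers :: com where
  "set_powers = (vL ::= Num 0 \<then> Put aPW (Num 0) (Num 1)) \<then>
    While (Var vn \<oplus> Num 1 \<ominus> Arr aPW (Var vL))
      (Put aPW (Var vL \<oplus> Num 1) (Arr aPW (Var vL) \<oplus> Arr aPW (Var vL)) \<then> vL ::= Var vL \<oplus> Num 1)"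

text \<open>Horner's scheme over the binary digits of \<open>m\<close> computes the product with a
  processing time; its \<open>L\<close> rounds per job contribute to the \<open>n log n\<close>
  term.\<close>

definition mult_machines :: com where
  "mult_machines = (vr ::= Num 0 \<then> vi ::= Var vL \<then> vw ::= Var vm) \<then>
    While (Var vi)
      (vi ::= Var vi \<ominus> Num 1 \<then> vr ::= Var vr \<oplus> Var vr \<then>
       Cond (Var vw \<oplus> Num 1 \<ominus> Arr aPW (Var vi))
         (vw ::= Var vw \<ominus> Arr aPW (Var vi) \<then> vr ::= Var vr \<oplus> Var vp) Skip)"

definition read_jobs :: com where
  "read_jobs = (vP ::= Num 0 \<then> vmx ::= Num 0 \<then> vj ::= Num 0) \<then>
    While (Var vn \<ominus> Var vj)
      (Get vp \<then> vP ::= Var vP \<oplus> Var vp \<then> mult_machines \<then>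
       Cond (Var vr \<ominus> Var vmx) (vmx ::= Var vr) Skip \<then>
       mulp vr vK \<then> mulp vr vK \<then> (Put aJP (Var vj) (Var vr) \<then> vj ::= Var vj \<oplus> Num 1))"

definition set_bounds :: com where
  "set_bounds = (vdl ::= Var vP \<then> Cond (Var vmx \<ominus> Var vP) (vdl ::= Var vmx) Skip \<then> vav ::= Var vP) \<then>
    mulp vav vK \<then> mulp vav vK"

text \<open>\<open>vx\<close> is the current threshold and \<open>vs\<close> the step of its octave,
  doubled while \<open>vu\<close> runs through the powers of two up to \<open>K\<close>. Thresholds
  start at index 1; index 0 keeps the value 0 as a sentinel.\<close>

definition set_types :: com where
  "set_types = vx ::= Var vdl \<then> mulp vx vK \<then> (vs ::= Var vdl \<then> vd ::= Num 0 \<then> vu ::= Num 1) \<then>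
    While (Var vK \<oplus> Num 1 \<ominus> Var vu)
      ((vu ::= Var vu \<oplus> Var vu \<then> vi ::= Num 0) \<then>
       While (Var vK \<ominus> Var vi)
         (vd ::= Var vd \<oplus> Num 1 \<then> Put aTH (Var vd) (Var vx) \<then> vx ::= Var vx \<oplus> Var vs \<then>
          vi ::= Var vi \<oplus> Num 1) \<then>
       vs ::= Var vs \<oplus> Var vs)"

text \<open>A linear search down from the largest threshold ends at the sentinel 0 at the latest.
  Counter \<open>d + 1\<close> receives \<open>m\<close>, the right-hand side of the machine
  coordinate.\<close>

definition classify_jobs :: com where
  "classify_jobs = vj ::= Num 0 \<then>
    While (Var vn \<ominus> Var vj)
      (vi ::= Var vd \<then>
       While (Arr aTH (Var vi) \<ominus> Arr aJP (Var vj)) (vi ::= Var vi \<ominus> Num 1) \<then>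
       (Put aNX (Var vj) (Arr aHD (Var vi)) \<then> Put aHD (Var vi) (Var vj \<oplus> Num 1) \<then>
        Put aCT (Var vi) (Arr aCT (Var vi) \<oplus> Num 1) \<then> vj ::= Var vj \<oplus> Num 1)) \<then>
    Put aCT (Var vd \<oplus> Num 1) (Var vm)"

primrec muls :: "nat \<Rightarrow> nat \<Rightarrow> com" where
  "muls 0 x = Skip"
| "muls (Suc e) x = mulp x vK \<then> muls e x"

lemma muls_simps [simp]:
  "mvars (muls e x) = (if e = 0 then {} else {vt, x})" "marrs (muls e x) = {}"
  "\<not> gets (muls e x)" "\<not> puts (muls e x)" "cwf (muls e x) \<longleftrightarrow> e = 0 \<or> x < 64"
  by (induction e) auto

definition set_params :: com where
  "set_params = vR ::= Num 128 \<then> muls 4 vR \<then> vB ::= Num 64 \<then> muls 4 vB \<then> vR0 ::= Num 32 \<then> muls 3 vR0"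

text \<open>Linked lists in an array; links hold the job number plus 1, so that the initial content
  0 of memory means the empty list.\<close>

fun lst :: "(nat \<Rightarrow> int) \<Rightarrow> int \<Rightarrow> nat list \<Rightarrow> bool" where
  "lst nx a [] \<longleftrightarrow> a = 0"
| "lst nx a (x # xs) \<longleftrightarrow> a = int x + 1 \<and> lst nx (nx x) xs"

lemma lst_upd [simp]: "j \<notin> set xs \<Longrightarrow> lst (nx(j := v)) a xs = lst nx a xs"
  by (induction xs arbitrary: a) auto

section \<open>Correctness and cost of the preprocessing stages\<close>

context sched
begin

lemma ht_set_accuracy:
  assumes "vars s vk = int k"
  shows "ht set_accuracy s (40 * (kap + 1)) (\<lambda>s'. vars s' vK = int K)"
  unfolding set_accuracy_def
proof (rule ht_Asg_Seq)
  let ?s = "s\<lparr>vars := (vars s)(vK := aval (Num 1) s)\<rparr>"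
  have cond: "2 ^ i < int k \<longleftrightarrow> i < kap" if "i \<le> kap" for i
  proof -
    have "2 ^ i < int k \<longleftrightarrow> \<not> k \<le> 2 ^ i" by (metis int_ops(3) linorder_not_le of_nat_less_iff of_nat_numeral of_nat_power)
    also have "\<dots> \<longleftrightarrow> i < kap"
      using that k_le_K not_less_Least[of i "\<lambda>e. k \<le> 2 ^ e"] unfolding K_def kap_def[symmetric]
      by (metis le_neq_implies_less nat_less_le)
    finally show ?thesis .
  qed
  show "ht (While (Var vk \<ominus> Var vK) (vK ::= Var vK \<oplus> Var vK)) ?s (40 * kap + 30) (\<lambda>s'. vars s' vK = int K)"
  proof (rule ht_For[where I = "\<lambda>i s'. vars s' vK = 2 ^ i" and N = kap and T = 7])
    show "ht (vK ::= Var vK \<oplus> Var vK) s' 7 (\<lambda>s'. vars s' vK = 2 ^ Suc i)" if "vars s' vK = 2 ^ i" for i s'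
      by (rule ht_straight) (use that in auto)
  qed (use assms cond in \<open>auto simp: same_def K_def\<close>)
qed auto

lemma ht_set_powers:
  assumes "vars s vn = int n"
  shows "ht set_powers s (100 * (L + 1)) (\<lambda>s'. vars s' vL = int L \<and> (\<forall>i\<le>L. arrs s' aPW i = 2 ^ i))"
  unfolding set_powers_def
proof (rule ht_block[where U = "100 * L + 60"], goal_cases)
  case (2 s1)
  let ?I = "\<lambda>i s'. vars s' vL = int i \<and> (\<forall>i'\<le>i. arrs s' aPW i' = 2 ^ i')"
  have cond: "2 ^ i < int n + 1 \<longleftrightarrow> i < L" if "i \<le> L" for i
  proof -
    have "2 ^ i < int n + 1 \<longleftrightarrow> \<not> n < 2 ^ i"
      by (metis add1_zle_eq add.commute int_ops(3) linorder_not_le of_nat_less_iff of_nat_numeral of_nat_power zle_add1_eq_le)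
    also have "\<dots> \<longleftrightarrow> i < L"
      using that n_less not_less_Least[of i "\<lambda>e. n < 2 ^ e"] unfolding L_def[symmetric]
      by (metis le_neq_implies_less nat_less_le)
    finally show ?thesis .
  qed
  show ?case
  proof (rule ht_For[where I = ?I and N = L and T = 60], goal_cases)
    case (2 i s')
    then show ?case by (intro ht_straight) (auto simp: le_Suc_eq)
  qed (use assms cond 2 in \<open>auto simp: same_def\<close>)
qed auto

definition env :: "store \<Rightarrow> bool" where
  "env s \<longleftrightarrow> vars s vn = int n \<and> vars s vm = int m \<and> vars s vK = int K \<and> vars s vL = int L \<and>
     (\<forall>i\<le>L. arrs s aPW i = 2 ^ i)"

lemma env_same:
  "env s \<Longrightarrow> same c s s' \<Longrightarrow> {vn, vm, vK, vL} \<inter> mvars c = {} \<Longrightarrow> aPW \<notin> marrs c \<Longrightarrow> env s'"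
  by (auto simp: env_def same_def)

lemma ht_mult_machines:
  assumes "env s"
  shows "ht mult_machines s (100 * (L + 1)) (\<lambda>s'. vars s' vr = vars s vp * int m)"
  unfolding mult_machines_def
proof (rule ht_block[where U = "100 * L + 60"], goal_cases)
  case (2 s1)
  let ?I = "\<lambda>t s'. vars s' vi = int (L - t) \<and> vars s' vr = vars s vp * int (m div 2 ^ (L - t)) \<and>
     vars s' vw = int (m mod 2 ^ (L - t))"
  have mL: "m < 2 ^ L" using m_less n_less by linarith
  note 0 = 2
  show ?case
  proof (rule ht_For[where I = ?I and N = L and T = 90], goal_cases)
    case (2 t s')
    obtain i where i: "L - t = Suc i" "L - Suc t = i" using 2(1) by (metis Suc_diff_Suc)
    have "i \<le> L" using i by simp
    then have pw: "arrs s' aPW i = 2 ^ i" and p: "vars s' vp = vars s vp"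
      using assms 2 0 by (auto simp: env_def same_def)
    have c: "int x + 1 - 2 ^ i > 0 \<longleftrightarrow> 2 ^ i \<le> x" for x
      by (metis add1_zle_eq add.commute diff_gt_0_iff_gt of_nat_le_iff of_nat_numeral of_nat_power zle_add1_eq_le)
    show ?case
    proof (cases "2 ^ i \<le> m mod 2 ^ Suc i")
      case True
      then show ?thesis
        using bit_step(1)[OF True] 2 pw p c[of "m mod 2 ^ Suc i"] unfolding i
        by (intro ht_straight) (simp_all add: algebra_simps del: power_Suc)
    next
      case False
      then show ?thesis
        using bit_step(2)[OF False] 2 pw p c[of "m mod 2 ^ Suc i"] unfolding i
        by (intro ht_straight) (simp_all add: algebra_simps del: power_Suc)
    qed
  qed (use assms mL 0 in \<open>auto simp: env_def\<close>)
qed auto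

lemma ht_mulp_K:
  assumes "env s" "x \<noteq> vt" "x \<noteq> vK"
  shows "ht (mulp x vK) s (40 * (kap + 1)) (\<lambda>s'. vars s' x = vars s x * int K)"
  using ht_mulp[of x vK s kap] assms by (simp add: env_def K_def)

text \<open>The 0 is the initial value of the running maximum and keeps \<open>Max\<close> away from
  the empty set.\<close>

definition mx_upto :: "nat \<Rightarrow> int" where
  "mx_upto j = Max (insert 0 ((\<lambda>j. int m * p j) ` {..<j}))"

lemma mx_upto_Suc: "mx_upto (Suc j) = max (int m * p j) (mx_upto j)"
proof -
  have "insert 0 ((\<lambda>j. int m * p j) ` {..<Suc j}) = insert (int m * p j) (insert 0 ((\<lambda>j. int m * p j) ` {..<j}))"
    by (auto simp: lessThan_Suc)
  then show ?thesis unfolding mx_upto_def by (simp only:) (rule Max_insert, auto)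
qed

lemma mx_upto_n: "mx_upto n = mx"
  unfolding mx_upto_def mx_def
proof (subst Max_insert)
  show "(\<lambda>j. int m * p j) ` {..<n} \<noteq> {}" using n_pos by (auto simp: lessThan_empty_iff)
  show "max 0 (MAX j\<in>{..<n}. int m * p j) = (MAX j\<in>{..<n}. int m * p j)"
    using mx_props(1) unfolding mx_def by simp
qed auto

lemma ht_read_jobs:
  assumes env: "env s" and inps: "inps s = map p [0..<n]"
  shows "ht read_jobs s (n * (100 * L + 80 * kap + 400) + 30) (\<lambda>s'. vars s' vP = P \<and> vars s' vmx = mx \<and>
     (\<forall>j<n. arrs s' aJP j = JP j))"
  unfolding read_jobs_def
proof (rule ht_block[where U = "n * (100 * L + 80 * kap + 400) + 20"], goal_cases)
  case (2 s1)
  let ?I = "\<lambda>j s'. env s' \<and> vars s' vj = int j \<and> vars s' vP = (\<Sum>i<j. p i) \<and> vars s' vmx = mx_upto j \<and>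
     (\<forall>i<j. arrs s' aJP i = JP i) \<and> inps s' = map p [j..<n]"
  show ?case
  proof (rule ht_For[where I = ?I and N = n and T = "100 * L + 80 * kap + 350"], goal_cases)
    case (2 j s2)
    have inp: "inps s2 = p j # map p [Suc j..<n]" using 2 by (simp add: upt_conv_Cons)
    show ?case
    proof (rule ht_Seq[OF ht_Get[OF inp, where Q = "\<lambda>s'. s' = s2\<lparr>vars := (vars s2)(vp := p j), inps := map p [Suc j..<n]\<rparr>"],
        where U = "100 * L + 80 * kap + 340"], goal_cases)
      case (2 s3)
      have env3: "env s3" using 2(1) \<open>?I j s2\<close> by (simp add: env_def)
      show ?case
      proof (rule ht_block[where U = "100 * L + 80 * kap + 330"], goal_cases)
        case (2 s4)
        have env4: "env s4" using 2 env3 by (simp add: env_def)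
        show ?case
        proof (rule ht_Seq[OF ht_mult_machines[OF env4], where U = "80 * kap + 220"], goal_cases)
          case (1 s5)
          have env5: "env s5" by (rule env_same[OF env4 1(2)]) (auto simp: mult_machines_def)
          have f5: "vars s5 vj = int j" "vars s5 vP = (\<Sum>i<Suc j. p i)" "vars s5 vmx = mx_upto j"
            "arrs s5 = arrs s2" "inps s5 = map p [Suc j..<n]" "vars s5 vr = int m * p j"
            using 1 2 \<open>s3 = _\<close> \<open>?I j s2\<close> by (auto simp: same_def mult_machines_def fun_eq_iff)
          show ?case
          proof (rule ht_block[where U = "80 * kap + 200"], goal_cases)
            case (2 s6)
            have env6: "env s6" using 2 env5 by (simp add: env_def)
            have f6: "vars s6 vmx = mx_upto (Suc j)" using 2 f5 by (simp add: mx_upto_Suc max_def)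
            show ?case
            proof (rule ht_Seq[OF ht_mulp_K[OF env6], where U = "40 * kap + 120"], goal_cases)
              case (3 s7)
              have env7: "env s7" by (rule env_same[OF env6 3(2)]) auto
              show ?case
              proof (rule ht_Seq[OF ht_mulp_K[OF env7], where U = "60"], goal_cases)
                case (3 s8)
                have env8: "env s8" by (rule env_same[OF env7 3(2)]) auto
                have "vars s8 vr = JP j"
                  using 3 \<open>vars s7 vr = _\<close> 2 f5 by (simp add: JP_def power2_eq_square mult_ac)
                moreover have "vars s8 vj = int j" "vars s8 vP = (\<Sum>i<Suc j. p i)" "vars s8 vmx = mx_upto (Suc j)"
                  "arrs s8 = arrs s2" "inps s8 = map p [Suc j..<n]"
                  using 3 \<open>same _ s6 s7\<close> 2 f5 f6 by (auto simp: same_def fun_eq_iff)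
                ultimately show ?case using env8 \<open>?I j s2\<close>
                  by (intro ht_straight) (auto simp: env_def less_Suc_eq)
              qed auto
            qed auto
          qed auto
        qed auto
      qed auto
    qed auto
  qed (use env inps 2 in \<open>auto simp: env_def mx_upto_def mx_upto_n[unfolded mx_upto_def] P_def algebra_simps same_def\<close>)
qed auto

end

lemma nat_one_add_int [simp]: "nat (1 + int i) = Suc i"
  by simp

context sched
begin

lemma ht_muls:
  assumes "env s" "x \<noteq> vt" "x \<notin> {vn, vm, vK, vL}"
  shows "ht (muls e x) s (e * (40 * (kap + 1))) (\<lambda>s'. vars s' x = vars s x * int (K ^ e))"
  using assms
proof (induction e arbitrary: s)
  case 0
  then show ?case by (auto intro: ht_straight)
next
  case (Suc e)
  show ?case unfolding muls.simps
  proof (rule ht_Seq[OF ht_mulp_K[OF Suc.prems(1)], where U = "e * (40 * (kap + 1))"], goal_cases)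
    case (3 s1)
    have env1: "env s1" by (rule env_same[OF Suc.prems(1) 3(2)]) (use Suc.prems in auto)
    show ?case
      by (rule ht_mono[OF Suc.IH[OF env1 Suc.prems(2,3)]]) (use 3 in \<open>simp_all add: mult_ac\<close>)
  qed (use Suc.prems in auto)
qed

lemma ht_set_params:
  assumes env: "env s"
  shows "ht set_params s (500 * (kap + 1)) (\<lambda>s'. vars s' vR = int R \<and> vars s' vB = int B \<and> vars s' vR0 = int R0)"
  unfolding set_params_def
proof (rule ht_block[where U = "490 * (kap + 1)"], goal_cases)
  case (2 s1)
  have e1: "env s1" using env 2 by (simp add: env_def)
  show ?case
  proof (rule ht_Seq[OF ht_muls[OF e1], where U = "320 * (kap + 1)"], goal_cases)
    case (3 s2)
    have e2: "env s2" by (rule env_same[OF e1 3(2)]) auto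
    have v2: "vars s2 vR = int R" using 2 3 by (simp add: R_def)
    show ?case
    proof (rule ht_block[where U = "310 * (kap + 1)"], goal_cases)
      case (2 s3)
      have e3: "env s3" using e2 2 by (simp add: env_def)
      have v3: "vars s3 vR = int R" "vars s3 vB = 64" using 2 v2 by simp_all
      show ?case
      proof (rule ht_Seq[OF ht_muls[OF e3], where U = "140 * (kap + 1)"], goal_cases)
        case (3 s4)
        have e4: "env s4" by (rule env_same[OF e3 3(2)]) auto
        have v4: "vars s4 vR = int R" "vars s4 vB = int B" using 3 v3 by (simp_all add: B_def same_def)
        show ?case
        proof (rule ht_block[where U = "130 * (kap + 1)"], goal_cases)
          case (2 s5)
          have e5: "env s5" using e4 2 by (simp add: env_def)
          have v5: "vars s5 vR = int R" "vars s5 vB = int B" "vars s5 vR0 = 32" using 2 v4 by simp_all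
          show ?case
            by (rule ht_mono[OF ht_muls[OF e5]]) (use v5 in \<open>auto simp: R0_def same_def\<close>)
        qed auto
      qed auto
    qed auto
  qed auto
qed auto

lemma ht_set_bounds:
  assumes env: "env s" and "vars s vP = P" "vars s vmx = mx"
  shows "ht set_bounds s (100 * (kap + 1)) (\<lambda>s'. vars s' vdl = dl \<and> vars s' vav = av)"
  unfolding set_bounds_def
proof (rule ht_block[where U = "80 * (kap + 1)"], goal_cases)
  case (2 s1)
  have e1: "env s1" using env 2 by (simp add: env_def)
  have v1: "vars s1 vdl = dl" "vars s1 vav = P" using 2 assms by (simp_all add: dl_def max_def)
  show ?case
  proof (rule ht_Seq[OF ht_mulp_K[OF e1], where U = "40 * (kap + 1)"], goal_cases)
    case (3 s2)
    have e2: "env s2" by (rule env_same[OF e1 3(2)]) auto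
    show ?case
      by (rule ht_mono[OF ht_mulp_K[OF e2]])
         (use 3 v1 in \<open>auto simp: same_def av_def power2_eq_square\<close>)
  qed auto
qed auto

lemma th_block: "i < K \<Longrightarrow> a \<le> kap \<Longrightarrow> th (a * K + i) = 2 ^ a * (int K + int i) * dl"
proof -
  assume i: "i < K" and a: "a \<le> kap"
  have "a * K + i < a * K + K" using i by simp
  also have "\<dots> \<le> d" using a unfolding d_def by (simp add: mult_le_mono1 add.commute)
  finally show ?thesis using i by (simp add: th_def)
qed

lemma ht_set_types:
  assumes env: "env s" and dl: "vars s vdl = dl" and TH: "arrs s aTH = (\<lambda>_. 0)"
  shows "ht set_types s (200 * (d + 1)) (\<lambda>s'. vars s' vd = int d \<and>
     (\<forall>i. arrs s' aTH i = (if 1 \<le> i \<and> i \<le> d then th (i - 1) else 0)))"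
  unfolding set_types_def
proof (rule ht_block[where U = "200 * d + 190"], goal_cases)
  case (2 s0)
  have e0: "env s0" using env 2 by (simp add: env_def)
  have kd: "kap + 1 \<le> d" unfolding d_def using mult_le_mono2[OF K_pos, of "kap + 1"] by simp
  show ?case
  proof (rule ht_Seq[OF ht_mulp_K[OF e0], where U = "150 * d + 120"], goal_cases)
    case (3 s1)
    have e1: "env s1" by (rule env_same[OF e0 3(2)]) auto
    have x1: "vars s1 vx = dl * int K" "vars s1 vdl = dl" "arrs s1 aTH = (\<lambda>_. 0)"
      using 2 3 dl TH by (simp_all add: same_def)
    show ?case
    proof (rule ht_block[where U = "150 * d + 90"], goal_cases)
      case (2 s2)
      let ?TH = "\<lambda>l s'. \<forall>i. arrs s' aTH i = (if 1 \<le> i \<and> i \<le> l then th (i - 1) else 0)"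
      let ?I = "\<lambda>a s'. vars s' vu = 2 ^ a \<and> vars s' vd = int (a * K) \<and> vars s' vs = 2 ^ a * dl \<and>
        vars s' vx = 2 ^ a * int K * dl \<and> ?TH (a * K) s'"
      have K2: "vars s2 vK = int K" using e1 2 by (simp add: env_def)
      note s2 = 2
      show ?case
      proof (rule ht_For[where I = ?I and N = "kap + 1" and T = "60 * K + 60"], goal_cases)
        case (2 a s3)
        then have a: "a \<le> kap" by simp
        note I = 2(2)
        have K3: "vars s3 vK = int K" using 2(3) K2 by (simp add: same_def)
        show ?case
        proof (rule ht_block[where U = "60 * K + 40"], goal_cases)
          case (2 s4)
          let ?J = "\<lambda>i s'. vars s' vi = int i \<and> vars s' vd = int (a * K + i) \<and>
            vars s' vx = 2 ^ a * (int K + int i) * dl \<and> ?TH (a * K + i) s'"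
          have v4: "vars s4 vu = 2 ^ Suc a" "vars s4 vs = 2 ^ a * dl" "vars s4 vK = int K" "?J 0 s4"
            using 2 I K3 by simp_all
          show ?case
          proof (rule ht_Seq[OF ht_For[where I = ?J and N = K and T = 45
                and U = "60 * K + 20" and Q = "\<lambda>s'. ?J K s'"], where U = 10], goal_cases)
            case (2 i s5)
            define x where "x = a * K + i"
            have thx: "th x = 2 ^ a * (int K + int i) * dl" unfolding x_def using 2(1) a by (rule th_block)
            have vi5: "vars s5 vi = int i" using 2(2) by simp
            have x: "vars s5 vd = int x" "vars s5 vx = th x" "?TH x s5" "a * K + Suc i = Suc x"
              using 2(2) thx by (simp_all add: x_def)
            have "2 ^ a * (int K + int (Suc i)) * dl = th x + 2 ^ a * dl"
              unfolding thx by (simp add: algebra_simps)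
            moreover have "vars s5 vs = 2 ^ a * dl" using 2(3) v4 by (simp add: same_def)
            ultimately show ?case using vi5 x(1-3) unfolding x(4)
              by (intro ht_straight) (auto simp: le_Suc_eq)
          next
            case (6 s6)
            then have "vars s6 vu = 2 ^ Suc a" "vars s6 vs = 2 ^ a * dl" using v4 by (simp_all add: same_def)
            with 6 show ?case
              by (intro ht_straight) (auto simp: algebra_simps)
          qed (use v4 in \<open>auto simp: same_def\<close>)
        qed auto
      next
        case (3 a s3)
        have "(2 :: int) ^ a < int K + 1 \<longleftrightarrow> a \<le> kap"
        proof -
          have "(2 :: int) ^ a < int K + 1 \<longleftrightarrow> (2 :: int) ^ a \<le> 2 ^ kap" by (auto simp: K_def)
          then show ?thesis by simp
        qed
        with 3 K2 show ?case by (auto simp: same_def)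
      next
        case (4 s3)
        then show ?case by (simp add: d_def)
      next
        case 5
        have "(kap + 1) * (60 * K + 70) = 60 * d + 70 * (kap + 1)" by (simp add: d_def algebra_simps)
        with kd show ?case by (simp add: algebra_simps)
      qed (use x1 s2 in auto)
    qed auto
  next
    case 4
    then show ?case using kd by simp
  qed auto
qed auto

text \<open>Reversed because \<open>classify_jobs\<close> inserts at the head.\<close>

definition joblist :: "nat \<Rightarrow> nat \<Rightarrow> nat list" where
  "joblist j t = rev (filter (\<lambda>i. ty i = t) [0..<j])"

lemma joblist_Suc: "joblist (Suc j) t = (if ty j = t then j # joblist j t else joblist j t)"
  by (simp add: joblist_def)

lemma set_joblist: "set (joblist j t) = {i. i < j \<and> ty i = t}"
  by (auto simp: joblist_def)

lemma distinct_joblist: "distinct (joblist j t)"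
  by (simp add: joblist_def)

lemma length_joblist: "length (joblist j t) = card {i. i < j \<and> ty i = t}"
  by (metis distinct_card distinct_joblist set_joblist)

lemma ht_classify_jobs:
  assumes env: "env s" and d: "vars s vd = int d"
    and TH: "\<forall>i. arrs s aTH i = (if 1 \<le> i \<and> i \<le> d then th (i - 1) else 0)"
    and JP: "\<forall>j<n. arrs s aJP j = JP j"
    and zero: "arrs s aHD = (\<lambda>_. 0)" "arrs s aCT = (\<lambda>_. 0)"
  shows "ht classify_jobs s (n * (100 * d + 200) + 100) (\<lambda>s'.
    (\<forall>t\<le>d. lst (arrs s' aNX) (arrs s' aHD t) (joblist n t)) \<and>
    (\<forall>l<D. arrs s' aCT (Suc l) = int (b l)))"
  unfolding classify_jobs_def
proof (rule ht_block[where U = "n * (100 * d + 200) + 80"], goal_cases)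
  case (2 s1)
  let ?I = "\<lambda>j s'. vars s' vj = int j \<and>
    (\<forall>t\<le>d. lst (arrs s' aNX) (arrs s' aHD t) (joblist j t) \<and> arrs s' aCT t = int (length (joblist j t)))"
  have s1: "vars s1 vd = int d" "arrs s1 aTH = arrs s aTH" "arrs s1 aJP = arrs s aJP" "vars s1 vm = int m"
     "vars s1 vn = int n" "?I 0 s1"
    using 2 d env zero by (simp_all add: env_def joblist_def)
  show ?case
  proof (rule ht_Seq[OF ht_For[where I = ?I and N = n and T = "100 * d + 180" and U = "n * (100 * d + 200) + 20"
        and Q = "\<lambda>s'. ?I n s'"], where U = 50], goal_cases)
    case (2 j s2)
    have v2: "vars s2 vd = int d" "arrs s2 aTH = arrs s aTH" "arrs s2 aJP = arrs s aJP"
      using 2 s1 by (simp_all add: same_def)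
    note I = 2(2)
    have j: "j < n" using 2(1) .
    have jp: "arrs s aJP j = JP j" using JP j by simp
    show ?case
    proof (rule ht_block[where U = "100 * d + 170"], goal_cases)
      case (2 s3)
      have v3: "vars s3 vi = int d" "arrs s3 = arrs s2" "?I j s3" using 2 v2 I by simp_all
      show ?case
      proof (rule ht_Seq[OF ht_For[where I = "\<lambda>i s'. vars s' vi = int (d - i)" and N = "d - ty j"
            and T = 10 and U = "100 * d + 60" and Q = "\<lambda>s'. vars s' vi = int (ty j)"], where U = 105], goal_cases)
        case (2 i s4)
        then show ?case by (intro ht_straight) (auto simp: of_nat_diff)
      next
        case (3 i s4)
        have a4: "arrs s4 aTH = arrs s aTH" "arrs s4 aJP = arrs s aJP" "vars s4 vj = int j"
          using 3(3) v3 v2 by (simp_all add: same_def)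
        \<comment> \<open>Thresholds above the type exceed the job by \<open>ty_greatest\<close>;
          the one at the type does not, and for type 0 this is the sentinel.\<close>
        have "JP j < arrs s aTH (d - i) \<longleftrightarrow> i < d - ty j"
        proof (cases "i < d - ty j")
          case True
          then have "JP j < th (d - i - 1)" by (intro ty_greatest) auto
          moreover have "1 \<le> d - i" "d - i \<le> d" using True by auto
          ultimately show ?thesis using TH True by simp
        next
          case False
          with 3(1) ty_le[of j] have "d - i = ty j" by simp
          then show ?thesis using TH False th_ty[of j] JP_pos[OF j] ty_le[of j] by (cases "ty j") auto
        qed
        then show ?case using a4 3(2) jp by simp
      next
        case (6 s4)
        have a4: "arrs s4 = arrs s2" "vars s4 vj = int j"
          using 6(2) v3 by (auto simp: same_def fun_eq_iff)
        have t: "ty j \<le> d" by (rule ty_le)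
        have "j \<notin> set (joblist j t)" for t by (simp add: set_joblist)
        then show ?case using 6(1) a4 I t
          by (intro ht_straight) (auto simp: joblist_Suc)
      next
        case 5
        have "(d - ty j) * 28 \<le> d * 28" by (rule mult_le_mono1) simp
        then show ?case by simp
      next
        case (4 s4)
        then show ?case using ty_le[of j] by simp
      qed (use v3 in auto)
    qed auto
  next
    case (6 s5)
    have "vars s5 vd = int d" "vars s5 vm = int m" using 6(2) s1 by (simp_all add: same_def)
    with 6 show ?case
      by (intro ht_straight) (auto simp: b_def D_def length_joblist less_Suc_eq)
  qed (use s1 in \<open>auto simp: same_def algebra_simps\<close>)
qed auto

end

section \<open>Enumeration of the digit vectors, and the bits of the right-hand side\<close>

definition set_weights :: com where
  "set_weights = (vx ::= Num 1 \<then> vj ::= Num 0) \<then>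
    While (Var vd \<oplus> Num 1 \<ominus> Var vj)
      ((vj ::= Var vj \<oplus> Num 1 \<then> Put aW (Var vj) (Var vx)) \<then> mulp vx vR) \<then>
    (vZF ::= Var vx \<then> vZB ::= Arr aW (Var vd \<oplus> Num 1)) \<then> mulp vZB vR0"

text \<open>Every \<open>h\<close> in \<open>[B ^ l, B ^ (l + 1))\<close> is
  \<open>i + B ^ l\<close> for some \<open>i\<close> listed before, so its packed form and load need
  one addition each and no digit is ever computed. At the end \<open>vN\<close> holds the start
  \<open>B ^ d\<close> of the last block.\<close>

definition list_vectors :: com where
  "list_vectors = (vlen ::= Num 1 \<then> vj ::= Num 0) \<then>
    While (Var vd \<oplus> Num 1 \<ominus> Var vj)
      ((vN ::= Var vlen \<then> vj ::= Var vj \<oplus> Num 1 \<then> vstop ::= Var vlen) \<then> mulp vstop vB \<then>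
       vi ::= Num 0 \<then>
       While (Var vstop \<ominus> Var vlen)
         (Put aEL (Var vlen) (Arr aEL (Var vi) \<oplus> Arr aW (Var vj)) \<then>
          Put aLD (Var vlen) (Arr aLD (Var vi) \<oplus> Arr aTH (Var vj)) \<then>
          Put aPA (Var vlen) (Var vi) \<then> Put aTY (Var vlen) (Var vj) \<then>
          vlen ::= Var vlen \<oplus> Num 1 \<then> vi ::= Var vi \<oplus> Num 1))"

text \<open>Transposes the counters: bit \<open>i\<close> of all of them is collected in one packed
  number, with weight \<open>R ^ l\<close> for coordinate \<open>l\<close>.\<close>

definition set_bits :: com where
  "set_bits = vj ::= Num 0 \<then>
    While (Var vd \<oplus> Num 1 \<ominus> Var vj)
      ((vj ::= Var vj \<oplus> Num 1 \<then> vw ::= Arr aCT (Var vj) \<then> vi ::= Var vL) \<then>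
       While (Var vi)
         (vi ::= Var vi \<ominus> Num 1 \<then>
          Cond (Var vw \<oplus> Num 1 \<ominus> Arr aPW (Var vi))
            (vw ::= Var vw \<ominus> Arr aPW (Var vi) \<then>
             Put aBE (Var vi) (Arr aBE (Var vi) \<oplus> Arr aW (Var vj))) Skip))"

lemma pow_less_int: "0 < int x + 1 - 2 ^ i \<longleftrightarrow> 2 ^ i \<le> x"
  by (metis add1_zle_eq add.commute diff_gt_0_iff_gt of_nat_le_iff of_nat_numeral of_nat_power zle_add1_eq_le)

context sched
begin

lemma K_power: "K ^ e = 2 ^ (e * kap)"
  unfolding K_def power_mult[symmetric] by (subst mult.commute) (rule refl)

lemma pow_forms: "R = 2 ^ (7 + 4 * kap)" "R0 = 2 ^ (5 + 3 * kap)" "B = 2 ^ (6 + 4 * kap)"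
  unfolding R_def R0_def B_def K_power power_add by simp_all

lemma ht_set_weights:
  assumes "vars s vd = int d" "vars s vR = int R" "vars s vR0 = int R0"
  shows "ht set_weights s (D * (160 * kap + 400) + 160 * kap + 400)
    (\<lambda>s'. (\<forall>l<D. arrs s' aW (Suc l) = int (R ^ l)) \<and> vars s' vZF = int ZF \<and> vars s' vZB = int ZB)"
  unfolding set_weights_def
proof (rule ht_block[where U = "D * (160 * kap + 400) + 160 * kap + 380"], goal_cases)
  case (2 s1)
  let ?I = "\<lambda>j s'. vars s' vj = int j \<and> vars s' vx = int (R ^ j) \<and> (\<forall>l<j. arrs s' aW (Suc l) = int (R ^ l))"
  have s1: "vars s1 vd = int d" "vars s1 vR = int R" "vars s1 vR0 = int R0" "?I 0 s1"
    using 2 assms by simp_all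
  show ?case
  proof (rule ht_Seq[OF ht_For[where I = ?I and N = D and T = "160 * kap + 380" and U = "D * (160 * kap + 400) + 30"
        and Q = "\<lambda>s'. ?I D s'"], where U = "160 * kap + 340"], goal_cases)
    case (2 j s2)
    have v2: "vars s2 vd = int d" "vars s2 vR = int R" using 2 s1 by (simp_all add: same_def)
    note I = 2(2)
    show ?case
    proof (rule ht_block[where U = "160 * kap + 320"], goal_cases)
      case (2 s3)
      have v3: "vars s3 vR = 2 ^ (7 + 4 * kap)" using 2 v2 pow_forms(1) by simp
      show ?case
        by (rule ht_mono[OF ht_mulp[where e = "7 + 4 * kap", OF _ _ _ v3]])
           (use 2 I pow_forms(1) in \<open>auto simp: same_def less_Suc_eq\<close>)
    qed auto
  next
    case (6 s2)
    have v2: "vars s2 vd = int d" "vars s2 vR0 = int R0" using 6 s1 by (simp_all add: same_def)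
    note I = 6
    show ?case
    proof (rule ht_block[where U = "160 * kap + 300"], goal_cases)
      case (2 s3)
      have W: "arrs s2 aW (Suc d) = int (R ^ d)" using I(1) by (simp add: D_def)
      have v3: "vars s3 vR0 = 2 ^ (5 + 3 * kap)" using 2 v2 pow_forms(2) by simp
      show ?case
        by (rule ht_mono[OF ht_mulp[where e = "5 + 3 * kap", OF _ _ _ v3]])
           (use 2 I v2 W pow_forms(2) in \<open>auto simp: same_def ZF_def ZB_def\<close>)
    qed auto
  qed (use s1 in \<open>auto simp: same_def D_def algebra_simps\<close>)
qed auto

lemma EL_ld_add:
  assumes "i + B ^ l < B ^ Suc l" "l < D"
  shows "EL (i + B ^ l) = EL i + R ^ l" "ld (i + B ^ l) = ld i + th l"
proof -
  note dg = dig_add_power[OF assms(1)]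
  have "EL (i + B ^ l) = code R D (\<lambda>l'. dig B i l' + (if l' = l then 1 else 0))"
    unfolding EL_def by (rule code_cong) (rule dg)
  also have "\<dots> = EL i + (\<Sum>l'<D. (if l' = l then 1 else 0) * R ^ l')"
    by (simp only: code_add EL_def) (simp only: code_def)
  also have "(\<Sum>l'<D. (if l' = l then 1 else 0) * R ^ l') = (\<Sum>l'<D. if l' = l then R ^ l' else 0)"
    by (rule sum.cong) auto
  also have "\<dots> = R ^ l" using assms(2) by simp
  finally show "EL (i + B ^ l) = EL i + R ^ l" .
  have "ld (i + B ^ l) = (\<Sum>l'<D. int (dig B i l') * th l' + (if l' = l then th l' else 0))"
    unfolding ld_def by (rule sum.cong) (simp_all add: dg distrib_right)
  also have "\<dots> = ld i + th l" using assms(2) by (simp add: sum.distrib ld_def)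
  finally show "ld (i + B ^ l) = ld i + th l" .
qed

text \<open>\<open>aTY\<close> names the leading nonzero digit and \<open>aPA\<close> the vector
  with one unit less there; following \<open>aPA\<close> down to 0 enumerates the jobs of a
  vector.\<close>

definition elist :: "nat \<Rightarrow> store \<Rightarrow> bool" where
  "elist len s \<longleftrightarrow> (\<forall>h<len. arrs s aEL h = int (EL h) \<and> arrs s aLD h = ld h \<and>
     (h > 0 \<longrightarrow> (\<exists>l<D. arrs s aTY h = int (Suc l) \<and> B ^ l \<le> h \<and> h < B ^ Suc l \<and>
       arrs s aPA h = int (h - B ^ l))))"

lemma EL_0 [simp]: "EL 0 = 0" and ld_0 [simp]: "ld 0 = 0"
proof -
  have "EL 0 = code R D (\<lambda>_. 0)" unfolding EL_def by (rule code_cong) simp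
  then show "EL 0 = 0" by simp
  show "ld 0 = 0" by (simp add: ld_def)
qed

lemma ht_list_vectors:
  assumes d: "vars s vd = int d" and vB: "vars s vB = int B"
    and W: "\<forall>l<D. arrs s aW (Suc l) = int (R ^ l)"
    and TH: "\<forall>i. arrs s aTH i = (if 1 \<le> i \<and> i \<le> d then th (i - 1) else 0)"
    and zero: "arrs s aEL = (\<lambda>_. 0)" "arrs s aLD = (\<lambda>_. 0)"
  shows "ht list_vectors s (D * (200 * B ^ D + 160 * kap + 500) + 50) (\<lambda>s'. elist (B ^ D) s' \<and> vars s' vlen = int (B ^ D) \<and> vars s' vN = int N)"
  unfolding list_vectors_def
proof (rule ht_block[where U = "D * (200 * B ^ D + 160 * kap + 500) + 40"], goal_cases)
  case (2 s1)
  let ?I = "\<lambda>j s'. vars s' vj = int j \<and> vars s' vlen = int (B ^ j) \<and> elist (B ^ j) s' \<and> (j > 0 \<longrightarrow> vars s' vN = int (B ^ (j - 1)))"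
  have s1: "vars s1 vd = int d" "vars s1 vB = int B" "arrs s1 aW = arrs s aW" "arrs s1 aTH = arrs s aTH" "?I 0 s1"
    using 2 assms by (simp_all add: elist_def)
  show ?case
  proof (rule ht_For[where I = ?I and N = D and T = "200 * B ^ D + 160 * kap + 480"], goal_cases)
    case (2 l s2)
    have v2: "vars s2 vd = int d" "vars s2 vB = int B" "arrs s2 aW = arrs s aW" "arrs s2 aTH = arrs s aTH"
      using 2 s1 by (simp_all add: same_def)
    note I = 2(2) and l = 2(1)
    have Bl: "B ^ l \<le> B ^ Suc l" using params(1) by simp
    have BD: "B ^ Suc l \<le> B ^ D" using params(1) l by (intro power_increasing) auto
    show ?case
    proof (rule ht_block[where U = "200 * B ^ D + 160 * kap + 460"], goal_cases)
      case (2 s3)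
      have v3: "vars s3 vB = 2 ^ (6 + 4 * kap)" using 2 v2 pow_forms(3) by simp
      note s3 = 2
      show ?case
      proof (rule ht_Seq[OF ht_mulp[where e = "6 + 4 * kap", OF _ _ _ v3], where U = "200 * B ^ D + 140"], goal_cases)
        case (4 s4)
        note s4 = 4
        show ?case
        proof (rule ht_block[where U = "200 * B ^ D + 120"], goal_cases)
          case (2 s5)
          let ?J = "\<lambda>i s'. vars s' vi = int i \<and> vars s' vlen = int (i + B ^ l) \<and> elist (i + B ^ l) s'"
          have v5: "vars s5 vstop = int (B ^ Suc l)" "vars s5 vj = int (Suc l)" "vars s5 vN = int (B ^ l)" "?J 0 s5"
             "arrs s5 aW = arrs s aW" "arrs s5 aTH = arrs s aTH"
            using 2 s3 s4 I v2 pow_forms(3) by (auto simp: same_def elist_def)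
          show ?case
          proof (rule ht_For[where I = ?J and N = "B ^ Suc l - B ^ l" and T = 180], goal_cases)
            case (2 i s6)
            have lt: "i + B ^ l < B ^ Suc l" using 2(1) by simp
            have w: "arrs s6 aW (Suc l) = int (R ^ l)" "arrs s6 aTH (Suc l) = th l" "vars s6 vj = int (Suc l)"
              using 2(3) v5 W TH l by (auto simp: same_def D_def th_def)
            have ii: "i < i + B ^ l" using params(1) by simp
            have ei: "arrs s6 aEL i = int (EL i)" "arrs s6 aLD i = ld i" using 2(2) ii by (auto simp: elist_def)
            from EL_ld_add[OF lt l] have new: "int (EL (i + B ^ l)) = int (EL i) + int (R ^ l)" "ld (i + B ^ l) = ld i + th l"
              by simp_all
            let ?s = "run (Put aEL (Var vlen) (Arr aEL (Var vi) \<oplus> Arr aW (Var vj)) \<then>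
              Put aLD (Var vlen) (Arr aLD (Var vi) \<oplus> Arr aTH (Var vj)) \<then>
              Put aPA (Var vlen) (Var vi) \<then> Put aTY (Var vlen) (Var vj) \<then>
              vlen ::= Var vlen \<oplus> Num 1 \<then> vi ::= Var vi \<oplus> Num 1) s6"
            have ix: "nat (vars s6 vlen) = i + B ^ l" "nat (vars s6 vi) = i" "nat (vars s6 vj) = Suc l"
              using 2(2) w(3) by (simp_all only: nat_int)
            have h: "arrs ?s aEL = (arrs s6 aEL)(i + B ^ l := int (EL (i + B ^ l)))"
              "arrs ?s aLD = (arrs s6 aLD)(i + B ^ l := ld (i + B ^ l))"
              "arrs ?s aPA = (arrs s6 aPA)(i + B ^ l := int i)"
              "arrs ?s aTY = (arrs s6 aTY)(i + B ^ l := int (Suc l))"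
              "vars ?s vlen = int (Suc i + B ^ l)" "vars ?s vi = int (Suc i)"
              using ix w ei new 2(2) by simp_all
            have "elist (Suc i + B ^ l) ?s"
              unfolding elist_def h
            proof (intro allI impI conjI)
              fix x assume x: "x < Suc i + B ^ l"
              show "((arrs s6 aEL)(i + B ^ l := int (EL (i + B ^ l)))) x = int (EL x)"
                "((arrs s6 aLD)(i + B ^ l := ld (i + B ^ l))) x = ld x"
                using x 2(2) by (auto simp: elist_def less_Suc_eq)
              assume x0: "x > 0"
              show "\<exists>la<D. ((arrs s6 aTY)(i + B ^ l := int (Suc l))) x = int (Suc la) \<and> B ^ la \<le> x \<and> x < B ^ Suc la \<and>
                ((arrs s6 aPA)(i + B ^ l := int i)) x = int (x - B ^ la)"
              proof (cases "x = i + B ^ l")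
                case True
                then show ?thesis using lt l by (intro exI[of _ l]) auto
              next
                case False
                with x have "x < i + B ^ l" by simp
                with 2(2) x0 False show ?thesis by (auto simp: elist_def)
              qed
            qed
            with h(5,6) show ?case by (intro ht_straight) auto
          next
            case (3 i s6)
            then have "vars s6 vstop = int (B ^ Suc l)" using v5 by (simp add: same_def)
            then have "aval (Var vstop \<ominus> Var vlen) s6 = int (B ^ Suc l) - int (i + B ^ l)" using 3 by simp
            also have "\<dots> > 0 \<longleftrightarrow> i + B ^ l < B ^ Suc l" by linarith
            finally show ?case by linarith
          next
            case (4 s6)
            have eq: "B ^ Suc l - B ^ l + B ^ l = B ^ Suc l" using Bl by (rule le_add_diff_inverse2)
            have "vars s6 vj = int (Suc l)" "vars s6 vN = int (B ^ l)" using 4(2) v5 by (simp_all add: same_def)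
            then show ?case using 4(1) unfolding eq by simp
          next
            case 5
            have "(B ^ Suc l - B ^ l) * 189 \<le> B ^ D * 189" using BD by (intro mult_le_mono1) linarith
            then show ?case by simp
          qed (use v5 in auto)
        qed auto
      qed auto
    qed auto
  qed (use s1 in \<open>auto simp: same_def D_def N_def algebra_simps\<close>)
qed auto

lemma ht_set_bits:
  assumes env: "env s" and d: "vars s vd = int d"
    and W: "\<forall>l<D. arrs s aW (Suc l) = int (R ^ l)"
    and CT: "\<forall>l<D. arrs s aCT (Suc l) = int (b l)"
    and zero: "arrs s aBE = (\<lambda>_. 0)"
  shows "ht set_bits s (D * (150 * L + 100) + 50) (\<lambda>s'. \<forall>i<L. arrs s' aBE i = int (BE i))"
  unfolding set_bits_def
proof (rule ht_block[where U = "D * (150 * L + 100) + 40"], goal_cases)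
  case (2 s1)
  let ?cd = "\<lambda>j i. int (code R j (\<lambda>l. b l div 2 ^ i mod 2))"
  let ?I = "\<lambda>j s'. vars s' vj = int j \<and> (\<forall>i<L. arrs s' aBE i = ?cd j i)"
  have s1: "vars s1 vd = int d" "arrs s1 aW = arrs s aW" "arrs s1 aCT = arrs s aCT" "arrs s1 aPW = arrs s aPW"
    "vars s1 vL = int L" "?I 0 s1"
    using 2 assms by (simp_all add: env_def code_def)
  show ?case
  proof (rule ht_For[where I = ?I and N = D and T = "150 * L + 80"], goal_cases)
    case (2 l s2)
    have v2: "vars s2 vL = int L" "arrs s2 aW = arrs s aW" "arrs s2 aCT = arrs s aCT" "arrs s2 aPW = arrs s aPW"
      using 2 s1 by (simp_all add: same_def)
    note I = 2(2) and l = 2(1)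
    show ?case
    proof (rule ht_block[where U = "150 * L + 30"], goal_cases)
      case (2 s3)
      \<comment> \<open>Bit levels from \<open>L - t\<close> on already include coordinate
        \<open>l\<close>, the lower ones do not yet.\<close>
      let ?J = "\<lambda>t s'. vars s' vi = int (L - t) \<and> vars s' vw = int (b l mod 2 ^ (L - t)) \<and>
        (\<forall>i<L. arrs s' aBE i = ?cd (if L - t \<le> i then Suc l else l) i)"
      have v3: "vars s3 vj = int (Suc l)" "arrs s3 aW = arrs s aW" "arrs s3 aPW = arrs s aPW" "?J 0 s3"
        using 2 v2 I CT l b_less[of l] by simp_all
      show ?case
      proof (rule ht_For[where I = ?J and N = L and T = 110], goal_cases)
        case (2 t s4)
        obtain i where i: "L - t = Suc i" "L - Suc t = i" using 2(1) by (metis Suc_diff_Suc)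
        have iL: "i < L" using i by simp
        have pw: "arrs s4 aPW i = 2 ^ i" and w: "arrs s4 aW (Suc l) = int (R ^ l)" "vars s4 vj = int (Suc l)"
          using env 2(3) v3 W l iL by (auto simp: env_def same_def)
        have be: "arrs s4 aBE i = ?cd l i" using 2(2) iL i by simp
        have split: "L - t \<le> i' \<longleftrightarrow> Suc i \<le> i'" "L - Suc t \<le> i' \<longleftrightarrow> i \<le> i'" for i' using i by auto
        show ?case
        proof (cases "2 ^ i \<le> b l mod 2 ^ Suc i")
          case True
          from bit_step(1)[OF True] have q: "b l mod 2 ^ Suc i = b l mod 2 ^ i + 2 ^ i" "b l div 2 ^ i mod 2 = 1" by auto
          have "?cd (Suc l) i = ?cd l i + int (R ^ l)" using q(2) by (simp add: code_Suc)
          then show ?thesis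
            using True 2(2) pw w be pow_less_int[of "b l mod 2 ^ Suc i" i] q unfolding split unfolding i
            by (intro ht_straight) (auto simp del: power_Suc)
        next
          case False
          from bit_step(2)[OF False] have q: "b l mod 2 ^ Suc i = b l mod 2 ^ i" "b l div 2 ^ i mod 2 = 0" by auto
          have "?cd (Suc l) i = ?cd l i" using q(2) by (simp add: code_Suc)
          then have "\<forall>i'<L. arrs s4 aBE i' = ?cd (if i \<le> i' then Suc l else l) i'"
            using 2(2) be unfolding split by (auto simp: le_less Suc_le_eq)
          then show ?thesis
            using False 2(2) pw w be pow_less_int[of "b l mod 2 ^ Suc i" i] q unfolding split unfolding i
            by (intro ht_straight) (simp_all del: power_Suc)
        qed
      next
        case (4 s4)
        then have "vars s4 vj = int (Suc l)" using v3 by (simp add: same_def)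
        with 4 show ?case by simp
      qed (use v3 in auto)
    qed auto
  qed (use s1 in \<open>auto simp: same_def D_def BE_def algebra_simps\<close>)
qed auto

end

subsection \<open>The carry automaton on the machine\<close>

text \<open>Adding a configuration increases the state, so one pass in increasing order of
  \<open>c\<close> closes the layer under additions. A cell keeps its first entry; as entries are
  never negative, \<open>1 - entry > 0\<close> tests for an empty cell.\<close>

definition add_confs :: com where
  "add_confs = vc ::= Num 0 \<then>
    While (Var vZB \<ominus> Var vc)
      (Cond (Arr aVA (Var vbase \<oplus> Var vc))
         ((vq ::= Var vN \<then> vy ::= Var vN \<oplus> Var vN) \<then>
          While (Var vy \<ominus> Var vq)
            (Cond (Var vT \<oplus> Num 1 \<ominus> Arr aLD (Var vq))
               (vx ::= Var vbase \<oplus> Var vc \<oplus> Arr aEL (Var vq) \<then>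
                Cond (Num 1 \<ominus> Arr aVA (Var vx)) (Put aVA (Var vx) (Var vq)) Skip) Skip \<then>
             vq ::= Var vq \<oplus> Num 1)) Skip \<then>
       vc ::= Var vc \<oplus> Num 1)"

text \<open>Running over the halved carries \<open>h\<close> and looking up
  \<open>2 * EL h + BE i\<close> avoids parity tests and the halving of digits.\<close>

definition shift_layer :: com where
  "shift_layer = vh ::= Num 0 \<then>
    While (Var vlen \<ominus> Var vh)
      (Cond (Arr aVA (Var vbase \<oplus> Arr aEL (Var vh) \<oplus> Arr aEL (Var vh) \<oplus> Arr aBE (Var vi)))
         (vx ::= Var vbase \<oplus> Var vZF \<oplus> Arr aEL (Var vh) \<then>
          Cond (Num 1 \<ominus> Arr aVA (Var vx)) (Put aVA (Var vx) (Num 1)) Skip) Skip \<then>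
       vh ::= Var vh \<oplus> Num 1)"

text \<open>The bounds \<open>T\<close> are tried in increasing order on the same table: a larger
  \<open>T\<close> only admits more configurations, so old entries stay valid.\<close>

definition run_automaton :: com where
  "run_automaton = (vT ::= Num 0 \<then> Put aVA (Num 0) (Num 1) \<then> vtop ::= Num 0 \<then> vi ::= Num 0) \<then>
    While (Var vL \<ominus> Var vi) (vtop ::= Var vtop \<oplus> Var vZF \<then> vi ::= Var vi \<oplus> Num 1) \<then>
    While (Num 1 \<ominus> Arr aVA (Var vtop))
      ((vT ::= Var vT \<oplus> Var vdl \<then> vbase ::= Num 0 \<then> vi ::= Num 0) \<then>
       While (Var vL \<ominus> Var vi)
         (add_confs \<then> shift_layer \<then> (vi ::= Var vi \<oplus> Num 1 \<then> vbase ::= Var vbase \<oplus> Var vZF)))"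

lemma add_confs_simps [simp]: "mvars add_confs = {vc, vq, vy, vx}" "marrs add_confs = {aVA}" "\<not> gets add_confs" "\<not> puts add_confs"
  by (auto simp: add_confs_def)

lemma shift_layer_simps [simp]: "mvars shift_layer = {vh, vx}" "marrs shift_layer = {aVA}" "\<not> gets shift_layer" "\<not> puts shift_layer"
  by (auto simp: shift_layer_def)

definition grows :: "(nat \<Rightarrow> int) \<Rightarrow> (nat \<Rightarrow> int) \<Rightarrow> bool" where
  "grows f g \<longleftrightarrow> (\<forall>y. f y \<noteq> 0 \<longrightarrow> g y \<noteq> 0)"

lemma grows_refl [simp]: "grows f f"
  by (simp add: grows_def)

lemma grows_trans: "grows f g \<Longrightarrow> grows g h \<Longrightarrow> grows f h"
  by (simp add: grows_def)

lemma grows_upd: "v \<noteq> 0 \<Longrightarrow> grows f (f(x := v))"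
  by (simp add: grows_def)

context sched
begin

text \<open>\<open>f\<close> is the table of the automaton with one layer of \<open>ZF\<close> cells per bit. A nonzero cell is
  reachable, and its value names its predecessor: 1 for a shift (or the initial state), otherwise the
  configuration that was added.\<close>

definition just :: "int \<Rightarrow> (nat \<Rightarrow> int) \<Rightarrow> nat \<Rightarrow> nat \<Rightarrow> int \<Rightarrow> bool" where
  "just T f i c v \<longleftrightarrow>
     v = 1 \<and> (i = 0 \<and> c = 0 \<or> (\<exists>i' h. i = Suc i' \<and> h < B ^ D \<and> c = EL h \<and> f (i' * ZF + (2 * EL h + BE i')) \<noteq> 0)) \<or>
     (\<exists>q\<in>confs T. v = int q \<and> EL q \<le> c \<and> c - EL q < ZB \<and> f (i * ZF + (c - EL q)) \<noteq> 0)"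

text \<open>Soundness only. That all reachable cells are marked is established layer by layer for
  the current \<open>T\<close>.\<close>

definition table :: "int \<Rightarrow> (nat \<Rightarrow> int) \<Rightarrow> bool" where
  "table T f \<longleftrightarrow> (\<forall>y. f y \<ge> 0) \<and>
     (\<forall>i\<le>L. \<forall>c<ZF. f (i * ZF + c) \<noteq> 0 \<longrightarrow> rc T i c \<and> just T f i c (f (i * ZF + c)))"

lemma just_mono: "just T f i c v \<Longrightarrow> grows f g \<Longrightarrow> T \<le> T' \<Longrightarrow> just T' g i c v"
  unfolding just_def grows_def confs_def by fastforce

lemma table_mono: "table T f \<Longrightarrow> T \<le> T' \<Longrightarrow> table T' f"
  unfolding table_def using rc_mono just_mono grows_refl by meson

lemma cell_inj: "i * ZF + c = i' * ZF + c' \<Longrightarrow> c < ZF \<Longrightarrow> c' < ZF \<Longrightarrow> i = i' \<and> c = c'"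
proof -
  assume eq: "i * ZF + c = i' * ZF + c'" and c: "c < ZF" "c' < ZF"
  have "(i * ZF + c) div ZF = i" "(i' * ZF + c') div ZF = i'" using c by auto
  with eq have "i = i'" by metis
  with eq show ?thesis by simp
qed

text \<open>\<open>just\<close> only asks a predecessor cell to be nonzero, so writing a positive
  value preserves all other justifications.\<close>

lemma table_upd:
  assumes t: "table T f" and c: "c < ZF" and v: "v > 0" and rc: "rc T i c" and j: "just T f i c v"
  shows "table T (f(i * ZF + c := v))"
proof -
  have g: "grows f (f(i * ZF + c := v))" using v by (intro grows_upd) simp
  show ?thesis
    unfolding table_def
  proof (intro conjI allI impI)
    show "(f(i * ZF + c := v)) y \<ge> 0" for y using t v by (simp add: table_def)
    fix i' c' assume i': "i' \<le> L" and c': "c' < ZF" and nz: "(f(i * ZF + c := v)) (i' * ZF + c') \<noteq> 0"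
    have "rc T i' c' \<and> just T f i' c' ((f(i * ZF + c := v)) (i' * ZF + c'))"
    proof (cases "i' * ZF + c' = i * ZF + c")
      case True
      from cell_inj[OF True c' c] rc j show ?thesis by simp
    next
      case False
      with nz t i' c' show ?thesis by (simp add: table_def)
    qed
    then show "rc T i' c'" "just T (f(i * ZF + c := v)) i' c' ((f(i * ZF + c := v)) (i' * ZF + c'))"
      using just_mono[OF _ g order_refl] by simp_all
  qed
qed

text \<open>The states in which layer \<open>i\<close> is entered, before any configuration of this
  level is added.\<close>

definition ent :: "int \<Rightarrow> nat \<Rightarrow> nat \<Rightarrow> bool" where
  "ent T i c \<longleftrightarrow> i = 0 \<and> c = 0 \<or> (\<exists>i' h. i = Suc i' \<and> h < B ^ D \<and> c = EL h \<and> rc T i' (2 * EL h + BE i'))"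

lemma rc_ent_or_add:
  assumes "rc T i c"
  shows "ent T i c \<or> (\<exists>c' q. c = c' + EL q \<and> rc T i c' \<and> c' < ZB \<and> q \<in> confs T \<and> i < L)"
  using assms by (cases rule: rc.cases) (auto simp: ent_def)

text \<open>This strict increase makes a single pass per layer sufficient and lets the backtracking
  terminate.\<close>

lemma EL_conf_pos: "q \<in> confs T \<Longrightarrow> EL q > 0"
proof -
  assume "q \<in> confs T"
  then have "dig R (EL q) d = 1" using dig_EL[of d q] conf_split(3) by (simp add: D_def)
  then show "EL q > 0" by (cases "EL q = 0") auto
qed

lemma ZB_le: "ZB \<le> ZF"
  unfolding ZB_def ZF_def D_def using params(4) by (simp add: mult_le_mono1 less_imp_le)

definition env2 :: "store \<Rightarrow> bool" where
  "env2 s \<longleftrightarrow> vars s vdl = dl \<and> vars s vL = int L \<and> vars s vZF = int ZF \<and> vars s vZB = int ZB \<and>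
     vars s vN = int N \<and> vars s vlen = int (B ^ D) \<and> (\<forall>i<L. arrs s aBE i = int (BE i)) \<and> elist (B ^ D) s"

lemma env2_same:
  "env2 s \<Longrightarrow> same c s s' \<Longrightarrow> mvars c \<inter> {vdl, vL, vZF, vZB, vN, vlen} = {} \<Longrightarrow>
   marrs c \<inter> {aBE, aEL, aLD, aTY, aPA} = {} \<Longrightarrow> env2 s'"
proof -
  assume e: "env2 s" and sm: "same c s s'" and v: "mvars c \<inter> {vdl, vL, vZF, vZB, vN, vlen} = {}"
    and a: "marrs c \<inter> {aBE, aEL, aLD, aTY, aPA} = {}"
  have v: "vars s' x = vars s x" if "x \<in> {vdl, vL, vZF, vZB, vN, vlen}" for x
    using that sm v unfolding same_def by blast
  have a: "arrs s' x = arrs s x" if "x \<in> {aBE, aEL, aLD, aTY, aPA}" for x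
    using that sm a unfolding same_def by blast
  show "env2 s'" using e unfolding env2_def elist_def by (simp add: v a)
qed

lemma env2_EL: "env2 s \<Longrightarrow> h < B ^ D \<Longrightarrow> arrs s aEL h = int (EL h) \<and> arrs s aLD h = ld h"
  by (simp add: env2_def elist_def)

lemma conf_less: "q < 2 * N \<Longrightarrow> q < B ^ D"
  using two_N_le by linarith

lemma ht_add_confs:
  assumes env: "env2 s" and T: "vars s vT = T" "T \<le> 2 * int (K ^ 2) * dl" and i: "i < L"
    and base: "vars s vbase = int (i * ZF)" and tab: "table T (arrs s aVA)"
    and entry: "\<And>c. ent T i c \<Longrightarrow> arrs s aVA (i * ZF + c) \<noteq> 0"
  shows "ht add_confs s (ZB * (200 * N + 100) + 50)
    (\<lambda>s'. table T (arrs s' aVA) \<and> grows (arrs s aVA) (arrs s' aVA) \<and>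
      (\<forall>c. rc T i c \<longrightarrow> arrs s' aVA (i * ZF + c) \<noteq> 0))"
  unfolding add_confs_def
proof (rule ht_block[where U = "ZB * (200 * N + 100) + 40"], goal_cases)
  case (2 s1)
  let ?f = "arrs s aVA"
  let ?G = "\<lambda>c f. table T f \<and> grows ?f f \<and> (\<forall>c'<c. rc T i c' \<longrightarrow> (\<forall>q\<in>confs T. f (i * ZF + (c' + EL q)) \<noteq> 0))"
  let ?I = "\<lambda>c s'. vars s' vc = int c \<and> ?G c (arrs s' aVA)"
  have e1: "env2 s1" using env 2 by (simp add: env2_def elist_def)
  have s1: "vars s1 vT = T" "vars s1 vbase = int (i * ZF)" "?I 0 s1" using 2 T base tab by simp_all
  show ?case
  proof (rule ht_For[where I = ?I and N = ZB and T = "200 * N + 90"], goal_cases)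
    case (2 c s2)
    have e2: "env2 s2" by (rule env2_same[OF e1 2(3)]) auto
    have v2: "vars s2 vT = T" "vars s2 vbase = int (i * ZF)" using 2(3) s1 by (simp_all add: same_def)
    note I = 2(2) and c = 2(1)
    have cF: "c < ZF" using c ZB_le by linarith
    have idx: "nat (int (i * ZF) + int c) = i * ZF + c" by (simp only: nat_int flip: of_nat_add)
    \<comment> \<open>All predecessors of \<open>c\<close> in this layer are smaller and have been
      expanded, so the mark of \<open>c\<close> is final when \<open>c\<close> is visited.\<close>
    have marked: "rc T i c \<longleftrightarrow> arrs s2 aVA (i * ZF + c) \<noteq> 0"
    proof
      assume rc: "rc T i c"
      from rc_ent_or_add[OF this] show "arrs s2 aVA (i * ZF + c) \<noteq> 0"
      proof
        assume "ent T i c"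
        with entry I show ?thesis by (simp add: grows_def)
      next
        assume "\<exists>c' q. c = c' + EL q \<and> rc T i c' \<and> c' < ZB \<and> q \<in> confs T \<and> i < L"
        then obtain c' q where "c = c' + EL q" "rc T i c'" "q \<in> confs T" by blast
        moreover from this have "c' < c" using EL_conf_pos by simp
        ultimately show ?thesis using I by blast
      qed
    next
      assume "arrs s2 aVA (i * ZF + c) \<noteq> 0"
      with I i cF show "rc T i c" by (simp add: table_def)
    qed
    show ?case
    proof (rule ht_Seq[where Q = "\<lambda>s'. ?I c s' \<and> (\<forall>q\<in>confs T. rc T i c \<longrightarrow> arrs s' aVA (i * ZF + (c + EL q)) \<noteq> 0)"
        and T = "200 * N + 80" and U = 8], goal_cases)
      case 1
      show ?case
      proof (rule ht_Cond[where T = "200 * N + 50"], goal_cases)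
        case 1
        then have rc: "rc T i c" and nz: "arrs s2 aVA (i * ZF + c) \<noteq> 0"
          using marked v2 I idx by auto
        show ?case
        proof (rule ht_block[where U = "200 * N + 35"], goal_cases)
          case (2 s3)
          let ?J = "\<lambda>k s'. vars s' vq = int (N + k) \<and> ?G c (arrs s' aVA) \<and> grows (arrs s2 aVA) (arrs s' aVA) \<and>
            (\<forall>q\<in>confs T. q < N + k \<longrightarrow> arrs s' aVA (i * ZF + (c + EL q)) \<noteq> 0)"
          have e3: "env2 s3" using e2 2 by (simp add: env2_def elist_def)
          have J0: "?J 0 s3" using 2 e2 I by (auto simp: env2_def confs_def)
          have v3: "vars s3 vT = T" "vars s3 vbase = int (i * ZF)" "vars s3 vc = int c" "vars s3 vy = int (2 * N)"
            using 2 v2 I e2 by (simp_all add: env2_def)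
          show ?case
          proof (rule ht_For[where I = ?J and N = N and T = 170], goal_cases)
            case (2 k s4)
            let ?q = "N + k"
            have e4: "env2 s4" by (rule env2_same[OF e3 2(3)]) auto
            have v4: "vars s4 vT = T" "vars s4 vbase = int (i * ZF)" "vars s4 vc = int c" "vars s4 vq = int ?q"
              using 2 v3 by (simp_all add: same_def)
            have q: "?q < B ^ D" using conf_less[of ?q] 2(1) by simp
            have el: "arrs s4 aEL ?q = int (EL ?q)" "arrs s4 aLD ?q = ld ?q" using env2_EL[OF e4 q] by auto
            note J = 2(2)
            show ?case
            proof (cases "ld ?q \<le> T")
              case True
              then have qc: "?q \<in> confs T" using 2(1) by (simp add: confs_def)
              let ?x = "i * ZF + (c + EL ?q)"
              have ix: "nat (int (i * ZF) + int c + int (EL ?q)) = ?x"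
                by (simp only: nat_int add.assoc flip: of_nat_add)
              have rcq: "rc T i (c + EL ?q)" by (rule rc_add[OF rc i c qc])
              \<comment> \<open>The sum stays within its layer, so the cell belongs to no other
                bit.\<close>
              have xF: "c + EL ?q < ZF" using rc_good[OF rcq T(2)] by (simp add: good_def)
              have nzc: "arrs s4 aVA (i * ZF + c) \<noteq> 0" using J nz by (simp add: grows_def)
              show ?thesis
              proof (cases "arrs s4 aVA ?x = 0")
                case zero: True
                let ?g = "(arrs s4 aVA)(?x := int ?q)"
                have gr: "grows (arrs s4 aVA) ?g" using N_ge by (intro grows_upd) simp
                have tg: "table T ?g"
                proof (rule table_upd[OF _ xF _ rcq])
                  show "just T (arrs s4 aVA) i (c + EL ?q) (int ?q)"
                    unfolding just_def using qc c nzc by (intro disjI2 bexI[of _ ?q]) auto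
                qed (use J N_ge in auto)
                let ?s = "run (Cond (Var vT \<oplus> Num 1 \<ominus> Arr aLD (Var vq))
                  (vx ::= Var vbase \<oplus> Var vc \<oplus> Arr aEL (Var vq) \<then>
                   Cond (Num 1 \<ominus> Arr aVA (Var vx)) (Put aVA (Var vx) (Var vq)) Skip) Skip \<then>
                  vq ::= Var vq \<oplus> Num 1) s4"
                have r: "arrs ?s aVA = ?g" "vars ?s vq = int (N + Suc k)"
                  using v4 el True ix zero by (simp_all add: nat_int del: of_nat_add of_nat_mult)
                have "?J (Suc k) ?s"
                  unfolding r using J gr tg grows_trans[OF _ gr] N_ge by (auto simp: grows_def less_Suc_eq)
                then show ?thesis by (intro ht_straight) (simp, assumption, simp)
              next
                case nzx: False
                with J have pos: "arrs s4 aVA ?x > 0" by (simp add: table_def order_less_le)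
                let ?s = "run (Cond (Var vT \<oplus> Num 1 \<ominus> Arr aLD (Var vq))
                  (vx ::= Var vbase \<oplus> Var vc \<oplus> Arr aEL (Var vq) \<then>
                   Cond (Num 1 \<ominus> Arr aVA (Var vx)) (Put aVA (Var vx) (Var vq)) Skip) Skip \<then>
                  vq ::= Var vq \<oplus> Num 1) s4"
                have r: "arrs ?s aVA = arrs s4 aVA" "vars ?s vq = int (N + Suc k)"
                  using v4 el True ix pos by (simp_all add: nat_int del: of_nat_add of_nat_mult)
                have "?J (Suc k) ?s"
                  unfolding r using J nzx by (auto simp: less_Suc_eq)
                then show ?thesis by (intro ht_straight) (simp, assumption, simp)
              qed
            next
              case False
              then have "?q \<notin> confs T" by (simp add: confs_def)
              then have *: "\<forall>q\<in>confs T. q < N + Suc k \<longrightarrow> q < N + k" by (auto simp: less_Suc_eq)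
              let ?s = "run (Cond (Var vT \<oplus> Num 1 \<ominus> Arr aLD (Var vq))
                (vx ::= Var vbase \<oplus> Var vc \<oplus> Arr aEL (Var vq) \<then>
                 Cond (Num 1 \<ominus> Arr aVA (Var vx)) (Put aVA (Var vx) (Var vq)) Skip) Skip \<then>
                vq ::= Var vq \<oplus> Num 1) s4"
              have r: "arrs ?s aVA = arrs s4 aVA" "vars ?s vq = int (N + Suc k)"
                using v4 el False by (simp_all add: nat_int del: of_nat_add of_nat_mult)
              have "?J (Suc k) ?s" unfolding r using J * by simp
              then show ?thesis by (intro ht_straight) (simp, assumption, simp)
            qed
          next
            case (3 k s4)
            then show ?case using v3 by (auto simp: same_def)
          next
            case (4 s4)
            then show ?case using v3 by (auto simp: same_def confs_def)
          qed (use J0 in auto)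
        qed auto
      next
        case 2
        then have "arrs s2 aVA (i * ZF + c) \<le> 0" using v2 I idx by simp
        moreover have "arrs s2 aVA (i * ZF + c) \<ge> 0" using I by (simp add: table_def)
        ultimately have "\<not> rc T i c" using marked by simp
        then show ?case using I by (intro ht_straight) auto
      qed auto
    next
      case (2 s3)
      then show ?case by (intro ht_straight) (auto simp: less_Suc_eq)
    qed auto
  next
    case (3 c s2)
    have "env2 s2" by (rule env2_same[OF e1 3(3)]) auto
    with 3 show ?case by (simp add: env2_def)
  next
    case (4 s2)
    have "arrs s2 aVA (i * ZF + c) \<noteq> 0" if "rc T i c" for c
      using rc_ent_or_add[OF that]
    proof
      assume "ent T i c"
      with entry 4(1) show ?thesis by (simp add: grows_def)
    next
      assume "\<exists>c' q. c = c' + EL q \<and> rc T i c' \<and> c' < ZB \<and> q \<in> confs T \<and> i < L"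
      with 4(1) show ?thesis by blast
    qed
    with 4(1) show ?case by blast
  qed (use s1 in \<open>auto simp: algebra_simps\<close>)
qed auto

lemma ht_shift_layer:
  assumes env: "env2 s" and vi: "vars s vi = int i" and i: "i < L"
    and base: "vars s vbase = int (i * ZF)" and tab: "table T (arrs s aVA)"
    and compl: "\<And>c. rc T i c \<Longrightarrow> arrs s aVA (i * ZF + c) \<noteq> 0"
  shows "ht shift_layer s (B ^ D * 200 + 50)
    (\<lambda>s'. table T (arrs s' aVA) \<and> grows (arrs s aVA) (arrs s' aVA) \<and>
      (\<forall>c. ent T (Suc i) c \<longrightarrow> arrs s' aVA (Suc i * ZF + c) \<noteq> 0))"
  unfolding shift_layer_def
proof (rule ht_block[where U = "B ^ D * 200 + 40"], goal_cases)
  case (2 s1)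
  let ?f = "arrs s aVA"
  let ?I = "\<lambda>h s'. vars s' vh = int h \<and> table T (arrs s' aVA) \<and> grows ?f (arrs s' aVA) \<and>
    (\<forall>h'<h. rc T i (2 * EL h' + BE i) \<longrightarrow> arrs s' aVA (Suc i * ZF + EL h') \<noteq> 0)"
  have e1: "env2 s1" using env 2 by (simp add: env2_def elist_def)
  have s1: "vars s1 vi = int i" "vars s1 vbase = int (i * ZF)" "?I 0 s1" using 2 vi base tab by simp_all
  show ?case
  proof (rule ht_For[where I = ?I and N = "B ^ D" and T = 180], goal_cases)
    case (2 h s2)
    have e2: "env2 s2" by (rule env2_same[OF e1 2(3)]) auto
    have v2: "vars s2 vi = int i" "vars s2 vbase = int (i * ZF)" using 2(3) s1 by (simp_all add: same_def)
    note I = 2(2) and h = 2(1)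
    have el: "arrs s2 aEL h = int (EL h)" using env2_EL[OF e2 h] by simp
    have be: "arrs s2 aBE i = int (BE i)" "vars s2 vZF = int ZF" using e2 i by (auto simp: env2_def)
    let ?y = "i * ZF + (2 * EL h + BE i)" and ?x = "Suc i * ZF + EL h"
    have iy: "nat (int (i * ZF) + int (EL h) + int (EL h) + int (BE i)) = ?y"
      by (simp only: nat_int flip: of_nat_add, simp?)
    have ix: "nat (int (i * ZF) + int ZF + int (EL h)) = ?x"
      by (simp only: nat_int flip: of_nat_add, simp?)
    have marked: "rc T i (2 * EL h + BE i) \<longleftrightarrow> arrs s2 aVA ?y \<noteq> 0"
    proof
      show "rc T i (2 * EL h + BE i) \<Longrightarrow> arrs s2 aVA ?y \<noteq> 0" using compl I by (simp add: grows_def)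
      show "arrs s2 aVA ?y \<noteq> 0 \<Longrightarrow> rc T i (2 * EL h + BE i)" using I i shift_less by (simp add: table_def)
    qed
    let ?c = "Cond (Arr aVA (Var vbase \<oplus> Arr aEL (Var vh) \<oplus> Arr aEL (Var vh) \<oplus> Arr aBE (Var vi)))
         (vx ::= Var vbase \<oplus> Var vZF \<oplus> Arr aEL (Var vh) \<then>
          Cond (Num 1 \<ominus> Arr aVA (Var vx)) (Put aVA (Var vx) (Num 1)) Skip) Skip \<then>
       vh ::= Var vh \<oplus> Num 1"
    have nonneg: "arrs s2 aVA y \<ge> 0" for y using I by (simp add: table_def)
    show ?case
    proof (cases "arrs s2 aVA ?y = 0")
      case True
      have r: "arrs (run ?c s2) aVA = arrs s2 aVA" "vars (run ?c s2) vh = int (Suc h)"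
        using v2 I el be iy True by (simp_all add: nat_int del: of_nat_add of_nat_mult)
      have "?I (Suc h) (run ?c s2)" unfolding r using I True marked by (auto simp: less_Suc_eq)
      then show ?thesis by (intro ht_straight) (simp, assumption, simp)
    next
      case nz: False
      then have pos: "arrs s2 aVA ?y > 0" using nonneg[of ?y] by simp
      from nz marked have rc: "rc T i (2 * EL h + BE i)" by simp
      from rc_shift[OF this i h] have rc': "rc T (Suc i) (EL h)" .
      show ?thesis
      proof (cases "arrs s2 aVA ?x = 0")
        case zero: True
        let ?g = "(arrs s2 aVA)(?x := 1)"
        have gr: "grows (arrs s2 aVA) ?g" by (intro grows_upd) simp
        have tg: "table T ?g"
        proof (rule table_upd[OF _ EL_less _ rc'])
          show "just T (arrs s2 aVA) (Suc i) (EL h) 1" unfolding just_def using h nz by blast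
        qed (use I in auto)
        have r: "arrs (run ?c s2) aVA = ?g" "vars (run ?c s2) vh = int (Suc h)"
          using v2 I el be iy ix pos zero by (simp_all add: nat_int del: of_nat_add of_nat_mult mult_Suc)
        have "?I (Suc h) (run ?c s2)"
          unfolding r using I gr tg grows_trans[OF _ gr] by (auto simp: grows_def less_Suc_eq)
        then show ?thesis by (intro ht_straight) (simp, assumption, simp)
      next
        case nzx: False
        then have posx: "arrs s2 aVA ?x > 0" using nonneg[of ?x] by simp
        have r: "arrs (run ?c s2) aVA = arrs s2 aVA" "vars (run ?c s2) vh = int (Suc h)"
          using v2 I el be iy ix pos posx by (simp_all add: nat_int del: of_nat_add of_nat_mult mult_Suc)
        have "?I (Suc h) (run ?c s2)" unfolding r using I nzx by (auto simp: less_Suc_eq)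
        then show ?thesis by (intro ht_straight) (simp, assumption, simp)
      qed
    qed
  next
    case (3 h s2)
    have "env2 s2" by (rule env2_same[OF e1 3(3)]) auto
    with 3 show ?case by (simp add: env2_def)
  next
    case (4 s2)
    then show ?case by (auto simp: ent_def)
  qed (use s1 in auto)
qed auto

lemma ht_run_automaton:
  assumes env: "env2 s" and zero: "arrs s aVA = (\<lambda>_. 0)"
  shows "ht run_automaton s (2 * K ^ 2 * (L * (ZB * (200 * N + 100) + B ^ D * 200 + 300) + 200) + L * 30 + 200)
    (\<lambda>s'. \<exists>T\<le>opt. table T (arrs s' aVA) \<and> vars s' vtop = int (L * ZF) \<and> arrs s' aVA (L * ZF) \<noteq> 0)"
  unfolding run_automaton_def
proof (rule ht_block[where U = "2 * K ^ 2 * (L * (ZB * (200 * N + 100) + B ^ D * 200 + 300) + 200) + L * 30 + 150"], goal_cases)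
  case (2 s1)
  have e1: "env2 s1" using env 2 by (simp add: env2_def elist_def)
  let ?I = "\<lambda>i s'. vars s' vi = int i \<and> vars s' vtop = int (i * ZF)"
  have I0: "?I 0 s1" "vars s1 vT = 0" "arrs s1 aVA = (\<lambda>_. 0)(0 := 1)" using 2 zero by (simp_all add: fun_eq_iff)
  have T2: "T \<le> 2 * int (K ^ 2) * dl" if "T = int t * dl" "t \<le> tau" for T t
  proof -
    have "T \<le> int tau * dl" using that dl_pos by simp
    with tau_le opt_le show ?thesis by linarith
  qed
  show ?case
  proof (rule ht_Seq[OF ht_For[where I = ?I and N = L and T = 20 and U = "L * 30 + 20" and Q = "?I L"],
      where U = "2 * K ^ 2 * (L * (ZB * (200 * N + 100) + B ^ D * 200 + 300) + 200) + 100"], goal_cases)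
    case (2 i s2)
    have "env2 s2" by (rule env2_same[OF e1 2(3)]) auto
    with 2 show ?case by (intro ht_straight) (auto simp: env2_def)
  next
    case (3 i s2)
    have "env2 s2" by (rule env2_same[OF e1 3(3)]) auto
    with 3 show ?case by (simp add: env2_def)
  next
    case (6 s2)
    have e2: "env2 s2" by (rule env2_same[OF e1 6(2)]) auto
    have v2: "vars s2 vtop = int (L * ZF)" "vars s2 vT = 0" "arrs s2 aVA = (\<lambda>_. 0)(0 := 1)"
      using 6 I0 by (simp_all add: same_def)
    have t0: "table 0 (arrs s2 aVA)"
      unfolding table_def v2
    proof (intro conjI allI impI)
      fix i c assume c: "c < ZF" and nz: "((\<lambda>_. 0 :: int)(0 := 1)) (i * ZF + c) \<noteq> 0"
      then have "i * ZF + c = 0" by (auto split: if_splits)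
      then have "i = 0" "c = 0" using c by auto
      then show "rc 0 i c" "just 0 ((\<lambda>_. 0)(0 := 1)) i c (((\<lambda>_. 0)(0 := 1)) (i * ZF + c))"
        by (auto simp: just_def intro: rc_init)
    qed simp
    let ?V = "\<lambda>s'. arrs s' aVA"
    \<comment> \<open>The last conjunct bounds the number of rounds: while the target cell is empty,
      \<open>t\<close> is below \<open>tau\<close>.\<close>
    let ?W = "\<lambda>t s'. vars s' vT = int t * dl \<and> t \<le> tau \<and> table (int t * dl) (?V s') \<and> ?V s' 0 \<noteq> 0 \<and>
      (?V s' (L * ZF) = 0 \<longrightarrow> t < tau)"
    show ?case
    proof (rule ht_While[where I = "\<lambda>s'. \<exists>t. ?W t s'" and v = "\<lambda>s'. tau - nat (vars s' vT div dl)" and N = "2 * K ^ 2"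
        and T = "L * (ZB * (200 * N + 100) + B ^ D * 200 + 300) + 150"], goal_cases)
      case 1
      have "?W 0 s2" using v2 t0 tau_bounds(1) by simp
      then show ?case by blast
    next
      case (2 s3)
      have e3: "env2 s3" by (rule env2_same[OF e2 2(2)]) auto
      have top: "vars s3 vtop = int (L * ZF)" using 2(2) v2 by (simp add: same_def)
      obtain t where W: "?W t s3" using 2(1) by (rule exE)
      have "?V s3 (L * ZF) \<ge> 0" using W by (simp add: table_def)
      then have z: "?V s3 (L * ZF) = 0" using 2(3) top by (simp add: nat_int del: of_nat_mult)
      then have t: "Suc t \<le> tau" using W by auto
      let ?T = "int (Suc t) * dl"
      have TT: "?T \<le> 2 * int (K ^ 2) * dl" using T2 t by blast
      have le: "int t * dl \<le> ?T" using dl_pos by simp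
      show ?case
      proof (rule ht_block[where U = "L * (ZB * (200 * N + 100) + B ^ D * 200 + 300) + 100"], goal_cases)
        case (2 s4)
        let ?J = "\<lambda>i s'. vars s' vi = int i \<and> vars s' vbase = int (i * ZF) \<and> vars s' vT = ?T \<and> table ?T (?V s') \<and>
          ?V s' 0 \<noteq> 0 \<and> (\<forall>c. ent ?T i c \<longrightarrow> ?V s' (i * ZF + c) \<noteq> 0)"
        have e4: "env2 s4" using e3 2 by (simp add: env2_def elist_def)
        have dl3: "vars s3 vdl = dl" using e3 by (simp add: env2_def)
        have "table ?T (?V s3)" using W le table_mono by blast
        then have J0: "?J 0 s4" using 2 W dl3 by (simp add: ent_def algebra_simps)
        show ?case
        proof (rule ht_For[where I = ?J and N = L and T = "ZB * (200 * N + 100) + B ^ D * 200 + 200"], goal_cases)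
          case (2 i s5)
          have e5: "env2 s5" by (rule env2_same[OF e4 2(3)]) auto
          note J = 2(2) and i = 2(1)
          show ?case
          proof (rule ht_Seq[OF ht_add_confs[OF e5 _ TT i], where U = "B ^ D * 200 + 120"], goal_cases)
            case (5 s6)
            have e6: "env2 s6" by (rule env2_same[OF e5 5(2)]) auto
            have v6: "vars s6 vi = int i" "vars s6 vbase = int (i * ZF)" "vars s6 vT = ?T" "?V s6 0 \<noteq> 0"
              using 5 J by (simp_all add: same_def grows_def)
            show ?case
            proof (rule ht_Seq[OF ht_shift_layer[where T = ?T, OF e6 v6(1) i v6(2)], where U = 50], goal_cases)
              case (3 s7)
              have e7: "env2 s7" by (rule env2_same[OF e6 3(2)]) auto
              have v7: "vars s7 vi = int i" "vars s7 vbase = int (i * ZF)" "vars s7 vT = ?T" "?V s7 0 \<noteq> 0" "vars s7 vZF = int ZF"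
                using 3 v6 e7 by (simp_all add: same_def grows_def env2_def)
              with 3(1) show ?case by (intro ht_straight) (auto simp: add_ac)
            qed (use 5 in auto)
          qed (use J in auto)
        next
          case (3 i s5)
          have "env2 s5" by (rule env2_same[OF e4 3(3)]) auto
          with 3 show ?case by (simp add: env2_def)
        next
          case (4 s5)
          have reached: "?V s5 (L * ZF) \<noteq> 0" if "Suc t = tau"
          proof -
            \<comment> \<open>Since \<open>rc_add\<close> demands \<open>i < L\<close>, a state of
              the last layer can only be an entry state, and these are known to be marked.\<close>
            have "rc ?T L 0" using feasible that by simp
            from rc_ent_or_add[OF this] have "ent ?T L 0" by auto
            with 4(1) show ?thesis by (metis add.right_neutral)
          qed
          have "?W (Suc t) s5" using 4(1) t reached by (auto simp: le_less)
          moreover have "nat (vars s5 vT div dl) = Suc t" "nat (vars s3 vT div dl) = t"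
            using 4(1) W dl_pos by (simp_all add: nat_add_distrib)
          ultimately show ?case using t by (intro conjI exI[of _ "Suc t"]) auto
        next
          case 5
          show ?case by (simp add: algebra_simps)
        qed (use J0 in auto)
      qed auto
    next
      case (3 s3)
      obtain t where W: "?W t s3" using 3(1) by (rule exE)
      have top: "vars s3 vtop = int (L * ZF)" using 3(2) v2 by (simp add: same_def)
      then have "?V s3 (L * ZF) \<noteq> 0" using 3(3) by (simp add: nat_int del: of_nat_mult)
      moreover have "int t * dl \<le> opt"
      proof -
        have "int t * dl \<le> int tau * dl" using W dl_pos by simp
        with tau_le show ?thesis by linarith
      qed
      ultimately show ?case using W top by blast
    next
      case 4
      show ?case using tau_bounds(2) by simp
    next
      case 5
      show ?case by (simp add: algebra_simps)
    qed
  qed (use I0 in auto)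
qed auto

end

subsection \<open>Reconstruction of a schedule\<close>

text \<open>Undoing an addition in layer \<open>i\<close> credits \<open>2 ^ i\<close> machines to
  the configuration; undoing a shift restores the state as twice the carry plus the bits. The
  initial state is recognised by \<open>vi + vc = 0\<close>.\<close>

definition backtrack :: com where
  "backtrack = (vi ::= Var vL \<then> vc ::= Num 0 \<then> vbase ::= Var vtop) \<then>
    While (Var vi \<oplus> Var vc)
      (vq ::= Arr aVA (Var vbase \<oplus> Var vc) \<then>
       Cond (Var vq \<ominus> Num 1)
         (Put aXC (Var vq) (Arr aXC (Var vq) \<oplus> Arr aPW (Var vi)) \<then> vc ::= Var vc \<ominus> Arr aEL (Var vq))
         (vi ::= Var vi \<ominus> Num 1 \<then> vbase ::= Var vbase \<ominus> Var vZF \<then>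
          vc ::= Var vc \<oplus> Var vc \<oplus> Arr aBE (Var vi)))"

definition pop_job :: com where
  "pop_job = vjb ::= Arr aHD (Var vu) \<then> Put aHD (Var vu) (Arr aNX (Var vjb \<ominus> Num 1)) \<then>
    Put aOUT (Var vjb \<ominus> Num 1) (Var vmach) \<then>
    Put aLO (Var vmach) (Arr aLO (Var vmach) \<oplus> Arr aJP (Var vjb \<ominus> Num 1))"

definition assign_large :: com where
  "assign_large = (vmach ::= Num 0 \<then> vq ::= Var vN) \<then>
    While (Var vm \<ominus> Var vmach)
      (Cond (Arr aXC (Var vq))
         ((Put aXC (Var vq) (Arr aXC (Var vq) \<ominus> Num 1) \<then> vi ::= Var vq \<ominus> Var vN) \<then>
          While (Var vi) (vu ::= Arr aTY (Var vi) \<then> pop_job \<then> vi ::= Arr aPA (Var vi)) \<then>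
          vmach ::= Var vmach \<oplus> Num 1)
         (vq ::= Var vq \<oplus> Num 1))"

definition assign_small :: com where
  "assign_small = (vmach ::= Num 0 \<then> vu ::= Num 0) \<then>
    While (Arr aHD (Var vu))
      (Cond (Var vav \<ominus> Arr aLO (Var vmach)) pop_job (vmach ::= Var vmach \<oplus> Num 1))"

definition output_machines :: com where
  "output_machines = vj ::= Num 0 \<then>
    While (Var vn \<ominus> Var vj) (Out (Arr aOUT (Var vj)) \<then> vj ::= Var vj \<oplus> Num 1)"

lemma pop_job_simps [simp]: "mvars pop_job = {vjb}" "marrs pop_job = {aHD, aOUT, aLO}" "\<not> gets pop_job" "\<not> puts pop_job"
  "straight pop_job" "cost pop_job = 109"
  by (auto simp: pop_job_def)

lemma sum_fun_upd_nat:
  fixes f x :: "'a \<Rightarrow> nat"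
  assumes "finite C" "q \<in> C"
  shows "(\<Sum>r\<in>C. (x(q := a)) r * f r) + x q * f q = (\<Sum>r\<in>C. x r * f r) + a * f q"
proof -
  have "(\<Sum>r\<in>C. (x(q := a)) r * f r) = a * f q + (\<Sum>r\<in>C - {q}. x r * f r)"
    using assms by (subst sum.remove[of C q]) auto
  moreover have "(\<Sum>r\<in>C. x r * f r) = x q * f q + (\<Sum>r\<in>C - {q}. x r * f r)"
    using assms by (rule sum.remove)
  ultimately show ?thesis by simp
qed

text \<open>The measure is a ghost index involving an abstract list, not a given function of the
  store; \<open>LEAST\<close> turns it into one.\<close>

lemma ht_While_index:
  fixes I :: "nat \<Rightarrow> store \<Rightarrow> bool"
  assumes "I k s"
    and "\<And>k s'. I k s' \<Longrightarrow> same c s s' \<Longrightarrow> aval e s' > 0 \<Longrightarrow> ht c s' T (\<lambda>s''. \<exists>k'<k. I k' s'')"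
    and "\<And>k s'. I k s' \<Longrightarrow> same c s s' \<Longrightarrow> aval e s' \<le> 0 \<Longrightarrow> Q s'"
    and "k \<le> N" "N * (T + esize e + 3) + esize e + 3 \<le> U"
  shows "ht (While e c) s U Q"
proof (rule ht_While[where I = "\<lambda>s. \<exists>k. I k s" and v = "\<lambda>s. LEAST k. I k s" and N = N and T = T])
  show "\<exists>k. I k s" using assms(1) by blast
  show "(LEAST k. I k s) \<le> N" using Least_le[of "\<lambda>k. I k s", OF assms(1)] assms(4) by linarith
  show "Q s'" if "\<exists>k. I k s'" "same c s s'" "aval e s' \<le> 0" for s' using that assms(3) by blast
  show "ht c s' T (\<lambda>s''. (\<exists>k. I k s'') \<and> (LEAST k. I k s'') < (LEAST k. I k s'))"
    if "\<exists>k. I k s'" "same c s s'" "aval e s' > 0" for s'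
  proof (rule ht_mono[OF assms(2)[OF _ that(2,3)] order_refl])
    show "I (LEAST k. I k s') s'" using that(1) by (rule LeastI_ex)
    fix s'' assume "\<exists>k'<(LEAST k. I k s'). I k' s''"
    then obtain k' where k': "k' < (LEAST k. I k s')" "I k' s''" by blast
    then show "(\<exists>k. I k s'') \<and> (LEAST k. I k s'') < (LEAST k. I k s')"
      using Least_le[of "\<lambda>k. I k s''", OF k'(2)] by auto
  qed
qed (rule assms(5))

context sched
begin

lemma ht_backtrack:
  assumes env: "env s" and env2: "env2 s" and tab: "table T (arrs s aVA)" and T: "T \<le> opt"
    and top: "vars s vtop = int (L * ZF)" "arrs s aVA (L * ZF) \<noteq> 0" and zero: "arrs s aXC = (\<lambda>_. 0)"
  shows "ht backtrack s (L * ZF * 200 + 50) (\<lambda>s'. \<exists>x. (\<forall>q. arrs s' aXC q = int (x q)) \<and>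
    (\<forall>q. x q \<noteq> 0 \<longrightarrow> q \<in> confs T) \<and> (\<forall>l<D. (\<Sum>q\<in>confs T. x q * dig B q l) = b l))"
  unfolding backtrack_def
proof (rule ht_block[where U = "L * ZF * 200 + 30"], goal_cases)
  case (2 s1)
  let ?f = "arrs s aVA"
  \<comment> \<open>\<open>x\<close> collects what has been undone; with \<open>2 ^ i\<close> times
    the carry and the low \<open>i\<close> bits of \<open>b l\<close> it always adds up to
    \<open>b l\<close>. At the end the other two summands vanish.\<close>
  let ?X = "\<lambda>i c x s'. i \<le> L \<and> c < ZF \<and> ?f (i * ZF + c) \<noteq> 0 \<and> vars s' vi = int i \<and> vars s' vc = int c \<and>
    vars s' vbase = int (i * ZF) \<and> (\<forall>q. arrs s' aXC q = int (x q)) \<and> (\<forall>q. x q \<noteq> 0 \<longrightarrow> q \<in> confs T) \<and>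
    (\<forall>l<D. (\<Sum>q\<in>confs T. x q * dig B q l) + 2 ^ i * dig R c l + b l mod 2 ^ i = b l)"
  have e1: "env s1" "env2 s1" using env env2 2 by (simp_all add: env_def env2_def elist_def)
  have T2: "T \<le> 2 * int (K ^ 2) * dl" using T opt_le by linarith
  have ZF_pos: "ZF > 0" using R_pos by (simp add: ZF_def)
  have X0: "?X L 0 (\<lambda>_. 0) s1" using 2 top zero env ZF_pos b_less by (simp add: env_def)
  have f1: "arrs s1 aVA = ?f" using 2 by simp
  show ?case
  proof (rule ht_While[where I = "\<lambda>s'. \<exists>i c x. ?X i c x s'" and v = "\<lambda>s'. nat (vars s' vi) * ZF + nat (vars s' vc)"
      and N = "L * ZF" and T = 180], goal_cases)
    case 1
    show ?case by (rule exI[of _ L], rule exI[of _ 0], rule exI[of _ "\<lambda>_. 0"], rule X0)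
  next
    case (2 s2)
    have e2: "env s2" by (rule env_same[OF e1(1) 2(2)]) auto
    have e2': "env2 s2" by (rule env2_same[OF e1(2) 2(2)]) auto
    have f2: "arrs s2 aVA = ?f" using 2(2) f1 by (simp add: same_def)
    from 2(1) obtain i c x where X: "?X i c x s2" by (elim exE)
    have ix: "nat (int (i * ZF) + int c) = i * ZF + c" by (simp only: nat_int flip: of_nat_add)
    let ?body = "vq ::= Arr aVA (Var vbase \<oplus> Var vc) \<then>
       Cond (Var vq \<ominus> Num 1)
         (Put aXC (Var vq) (Arr aXC (Var vq) \<oplus> Arr aPW (Var vi)) \<then> vc ::= Var vc \<ominus> Arr aEL (Var vq))
         (vi ::= Var vi \<ominus> Num 1 \<then> vbase ::= Var vbase \<ominus> Var vZF \<then>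
          vc ::= Var vc \<oplus> Var vc \<oplus> Arr aBE (Var vi))"
    have rcj: "rc T i c" "just T ?f i c (?f (i * ZF + c))" using tab X by (simp_all add: table_def)
    have meas: "nat (vars s2 vi) * ZF + nat (vars s2 vc) = i * ZF + c" using X by simp
    from rcj(2) consider (shift) i' h where "?f (i * ZF + c) = 1" "i = Suc i'" "h < B ^ D" "c = EL h"
        "?f (i' * ZF + (2 * EL h + BE i')) \<noteq> 0"
      | (start) "i = 0" "c = 0"
      | (conf) q where "q \<in> confs T" "?f (i * ZF + c) = int q" "EL q \<le> c" "c - EL q < ZB" "?f (i * ZF + (c - EL q)) \<noteq> 0"
      unfolding just_def by blast
    then show ?case
    proof cases
      case start
      then show ?thesis using 2(3) X by simp
    next
      case conf
      define c' where "c' = c - EL q"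
      have c': "c = c' + EL q" "c' < ZB" using conf by (simp_all add: c'_def)
      have c'F: "c' < ZF" using c'(2) ZB_le by linarith
      \<comment> \<open>As \<open>q >= 2\<close>, the entry cannot be mistaken for the shift marker
        1.\<close>
      have q: "q < 2 * N" "q \<ge> 2" using conf(1) N_ge by (auto simp: confs_def)
      have el: "arrs s2 aEL q = int (EL q)" using env2_EL[OF e2' conf_less[OF q(1)]] by simp
      have pw: "arrs s2 aPW i = 2 ^ i" using e2 X by (simp add: env_def)
      have rc': "rc T i c'" using tab conf(5) c'F X by (simp add: table_def c'_def)
      have good': "good c'" using rc_good[OF rc' T2] by simp
      have digs: "dig R c l = dig R c' l + dig B q l" if "l < D" for l
        unfolding c'(1) by (rule add_conf(1)[OF good' top_less_ZB[OF c'(2)] conf(1) T2 that])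
      let ?x = "x(q := x q + 2 ^ i)"
      have r: "vars (run ?body s2) vi = int i" "vars (run ?body s2) vc = int c'" "vars (run ?body s2) vbase = int (i * ZF)"
        "arrs (run ?body s2) aXC = (arrs s2 aXC)(q := int (x q + 2 ^ i))"
        using X f2 ix conf q el pw by (simp_all add: c'(1) del: of_nat_mult)
      have "(\<Sum>r\<in>confs T. ?x r * dig B r l) + 2 ^ i * dig R c' l + b l mod 2 ^ i = b l" if "l < D" for l
      proof -
        have "(\<Sum>r\<in>confs T. ?x r * dig B r l) = (\<Sum>r\<in>confs T. x r * dig B r l) + 2 ^ i * dig B q l"
          using sum_fun_upd_nat[OF finite_confs conf(1), of x "x q + 2 ^ i" "\<lambda>r. dig B r l"]
          by (simp add: distrib_right)
        moreover have "(\<Sum>r\<in>confs T. x r * dig B r l) + 2 ^ i * dig R c l + b l mod 2 ^ i = b l" using X that by blast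
        ultimately show ?thesis unfolding digs[OF that] by (simp add: distrib_left)
      qed
      then have "?X i c' ?x (run ?body s2)"
        unfolding r using X conf c'F by (auto simp: c'_def)
      then have "\<exists>i c x. ?X i c x (run ?body s2)"
        by - (rule exI[of _ i], rule exI[of _ c'], rule exI[of _ ?x])
      moreover have "nat (vars (run ?body s2) vi) * ZF + nat (vars (run ?body s2) vc) < i * ZF + c"
        unfolding r using EL_conf_pos[OF conf(1)] c'(1) by simp
      ultimately have "(\<exists>i c x. ?X i c x (run ?body s2)) \<and>
          nat (vars (run ?body s2) vi) * ZF + nat (vars (run ?body s2) vc) < nat (vars s2 vi) * ZF + nat (vars s2 vc)"
        unfolding meas by (rule conjI)
      then show ?thesis by (intro ht_straight) (simp, assumption, simp)
    next
      case shift
      let ?c = "2 * EL h + BE i'"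
      have i': "i' < L" using X shift by simp
      have be: "arrs s2 aBE i' = int (BE i')" "vars s2 vZF = int ZF" using e2' i' by (simp_all add: env2_def)
      have v: "?f (nat (vars s2 vbase + vars s2 vc)) = 1" using X ix shift by simp
      have r: "vars (run ?body s2) vi = int i'" "vars (run ?body s2) vc = int ?c" "vars (run ?body s2) vbase = int (i' * ZF)"
        "arrs (run ?body s2) aXC = arrs s2 aXC"
        using X f2 v shift be by (simp_all add: algebra_simps)
      have cF: "?c < ZF" by (rule shift_less)
      have "(\<Sum>r\<in>confs T. x r * dig B r l) + 2 ^ i' * dig R ?c l + b l mod 2 ^ i' = b l" if l: "l < D" for l
      proof -
        have "b l mod 2 ^ Suc i' = 2 ^ i' * (b l div 2 ^ i' mod 2) + b l mod 2 ^ i'"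
          unfolding power_Suc2 by (rule mod_mult2_eq)
        moreover have "dig R ?c l = 2 * dig B h l + b l div 2 ^ i' mod 2" using l by (rule dig_shift)
        moreover have "dig R c l = dig B h l" unfolding shift using l by (rule dig_EL)
        moreover have "(\<Sum>r\<in>confs T. x r * dig B r l) + 2 ^ Suc i' * dig R c l + b l mod 2 ^ Suc i' = b l"
          using X l shift(2) by blast
        ultimately show ?thesis by (simp add: algebra_simps)
      qed
      then have "?X i' ?c x (run ?body s2)"
        unfolding r using X i' cF shift by auto
      then have "\<exists>i c x. ?X i c x (run ?body s2)"
        by - (rule exI[of _ i'], rule exI[of _ ?c], rule exI[of _ x])
      \<comment> \<open>The carry may grow at a shift, but it stays below \<open>ZF\<close>, the
        amount gained by lowering \<open>i\<close>.\<close>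
      moreover have "nat (vars (run ?body s2) vi) * ZF + nat (vars (run ?body s2) vc) < i * ZF + c"
        unfolding r shift(2) using cF by (simp del: of_nat_add of_nat_mult)
      ultimately have "(\<exists>i c x. ?X i c x (run ?body s2)) \<and>
          nat (vars (run ?body s2) vi) * ZF + nat (vars (run ?body s2) vc) < nat (vars s2 vi) * ZF + nat (vars s2 vc)"
        unfolding meas by (rule conjI)
      then show ?thesis by (intro ht_straight) (simp, assumption, simp)
    qed
  next
    case (3 s2)
    from 3(1) obtain i c x where X: "?X i c x s2" by (elim exE)
    have "int i + int c \<le> 0" using 3(3) X by simp
    then have "i = 0" "c = 0" by simp_all
    with X show ?case by (intro exI[of _ x]) simp
  next
    case 4
    show ?case using X0 by simp
  qed auto
qed auto

text \<open>Partial schedule: \<open>jl t\<close> lists the jobs of type \<open>t\<close> that still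
  have to be assigned, and \<open>aLO\<close> holds the scaled loads of the assigned ones.\<close>

definition part :: "store \<Rightarrow> (nat \<Rightarrow> nat list) \<Rightarrow> bool" where
  "part s jl \<longleftrightarrow>
     (\<forall>t\<le>d. lst (arrs s aNX) (arrs s aHD t) (jl t) \<and> distinct (jl t) \<and> set (jl t) \<subseteq> {j. j < n \<and> ty j = t}) \<and>
     (\<forall>j<n. arrs s aJP j = JP j) \<and>
     (\<forall>j<n. j \<notin> set (jl (ty j)) \<longrightarrow> (\<exists>i<m. arrs s aOUT j = int i)) \<and>
     (\<forall>i<m. arrs s aLO i = (\<Sum>j | j < n \<and> j \<notin> set (jl (ty j)) \<and> arrs s aOUT j = int i. JP j))"

lemma part_pop:
  assumes part: "part s jl" and u: "vars s vu = int t" "t \<le> d" and x: "jl t = x # xs"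
    and i: "vars s vmach = int i" "i < m"
  shows "part (run pop_job s) (jl(t := xs))" "arrs (run pop_job s) aLO = (arrs s aLO)(i := arrs s aLO i + JP x)"
    "x < n" "ty x = t"
proof -
  have l: "lst (arrs s aNX) (arrs s aHD t) (x # xs)" "distinct (x # xs)" "set (x # xs) \<subseteq> {j. j < n \<and> ty j = t}"
    unfolding x[symmetric] using part u(2) unfolding part_def by blast+
  then show xn: "x < n" "ty x = t" by auto
  have hd: "arrs s aHD t = int x + 1" and tl: "lst (arrs s aNX) (arrs s aNX x) xs" using l by auto
  have jp: "arrs s aJP x = JP x" using part xn by (simp add: part_def)
  let ?s = "run pop_job s"
  have r: "arrs ?s aHD = (arrs s aHD)(t := arrs s aNX x)" "arrs ?s aOUT = (arrs s aOUT)(x := int i)"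
    "arrs ?s aNX = arrs s aNX" "arrs ?s aJP = arrs s aJP"
    and lo: "arrs ?s aLO = (arrs s aLO)(i := arrs s aLO i + JP x)"
    using u i hd jp by (simp_all add: pop_job_def)
  then show "arrs ?s aLO = (arrs s aLO)(i := arrs s aLO i + JP x)" by simp
  let ?jl = "jl(t := xs)"
  have mem: "j \<notin> set (?jl (ty j)) \<longleftrightarrow> j \<notin> set (jl (ty j)) \<or> j = x" for j
    using l(2) x xn by (auto simp: fun_upd_def)
  have xin: "x \<in> set (jl (ty x))" using x xn by simp
  show "part ?s ?jl"
    unfolding part_def r lo
  proof (intro conjI allI impI)
    fix t' assume t': "t' \<le> d"
    show "lst (arrs s aNX) (((arrs s aHD)(t := arrs s aNX x)) t') (?jl t')" "distinct (?jl t')"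
      "set (?jl t') \<subseteq> {j. j < n \<and> ty j = t'}"
      using part t' tl l by (auto simp: part_def)
  next
    fix j assume j: "j < n"
    then show "arrs s aJP j = JP j" using part by (simp add: part_def)
    assume "j \<notin> set (?jl (ty j))"
    then show "\<exists>i'<m. ((arrs s aOUT)(x := int i)) j = int i'"
      using part j i(2) unfolding mem by (auto simp: part_def)
  next
    fix i' assume i': "i' < m"
    have old: "arrs s aLO i' = (\<Sum>j | j < n \<and> j \<notin> set (jl (ty j)) \<and> arrs s aOUT j = int i'. JP j)"
      using part i' by (simp add: part_def)
    let ?S = "{j. j < n \<and> j \<notin> set (jl (ty j)) \<and> arrs s aOUT j = int i'}"
    have eqS: "{j. j < n \<and> j \<notin> set (?jl (ty j)) \<and> ((arrs s aOUT)(x := int i)) j = int i'} =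
      (if i' = i then insert x ?S else ?S)"
      unfolding mem using xin xn by auto
    have "sum JP (insert x ?S) = JP x + sum JP ?S" by (rule sum.insert) (use xin in auto)
    then show "((arrs s aLO)(i := arrs s aLO i + JP x)) i' =
      (\<Sum>j | j < n \<and> j \<notin> set (?jl (ty j)) \<and> ((arrs s aOUT)(x := int i)) j = int i'. JP j)"
      unfolding eqS using old by (cases "i' = i") simp_all
  qed
qed

text \<open>The estimate of \<open>conf_bound\<close> for all types together; it bounds the number
  of large jobs placed on one machine.\<close>

lemma conf_total:
  assumes "q \<in> confs T" "T \<le> 2 * int (K ^ 2) * dl"
  shows "(\<Sum>l<d. dig B q l) \<le> 2 * K"
proof -
  have "int (\<Sum>l<d. dig B q l) * (int K * dl) = (\<Sum>l<d. int (dig B q l) * (int K * dl))"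
    by (simp add: sum_distrib_right)
  also have "\<dots> \<le> (\<Sum>l<d. int (dig B q l) * th l)" using th_ge by (intro sum_mono mult_left_mono) auto
  also have "\<dots> = ld q" unfolding ld_def D_def by (simp add: th_def)
  also have "\<dots> \<le> 2 * int (K ^ 2) * dl" using assms by (auto simp: confs_def)
  also have "\<dots> = int (2 * K) * (int K * dl)" by (simp add: power2_eq_square)
  finally have "int (\<Sum>l<d. dig B q l) \<le> int (2 * K)"
    using dl_pos K_pos by (subst (asm) mult_le_cancel_right_pos) auto
  then show ?thesis by (simp only: of_nat_le_iff)
qed

text \<open>Distribution of the jobs of one configuration: the digits of \<open>idx\<close> count the jobs still to be
  taken for machine \<open>i\<close>, and \<open>Y\<close> counts those of the remaining machines.\<close>

lemma ht_chain:
  assumes env2: "env2 s" and part: "part s jl" and i: "vars s vmach = int i" "i < m"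
    and vi: "vars s vi = int idx" "idx < N"
    and len: "\<And>l. l < d \<Longrightarrow> length (jl (Suc l)) = Y l + dig B idx l"
    and tot: "(\<Sum>l<d. dig B idx l) \<le> 2 * K" and lo: "arrs s aLO i = 0"
  shows "ht (While (Var vi) (vu ::= Arr aTY (Var vi) \<then> pop_job \<then> vi ::= Arr aPA (Var vi))) s (2 * K * 220 + 50)
    (\<lambda>s'. \<exists>jl. part s' jl \<and> (\<forall>l<d. length (jl (Suc l)) = Y l) \<and>
       (\<forall>i'. i' \<noteq> i \<longrightarrow> arrs s' aLO i' = arrs s aLO i') \<and> int K * arrs s' aLO i \<le> (int K + 1) * ld idx)"
proof -
  \<comment> \<open>\<open>ld idx - ld x\<close> is the rounded size of the jobs placed so far;
    their true size exceeds it by a factor of at most \<open>1 + 1 / K\<close>.\<close>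
  let ?X = "\<lambda>x jl s'. x < N \<and> part s' jl \<and> vars s' vi = int x \<and> (\<forall>l<d. length (jl (Suc l)) = Y l + dig B x l) \<and>
    (\<forall>i'. i' \<noteq> i \<longrightarrow> arrs s' aLO i' = arrs s aLO i') \<and> int K * arrs s' aLO i \<le> (int K + 1) * (ld idx - ld x)"
  let ?v = "\<lambda>s'. \<Sum>l<d. dig B (nat (vars s' vi)) l"
  show ?thesis
  proof (rule ht_While[where I = "\<lambda>s'. \<exists>x jl. ?X x jl s'" and v = ?v and N = "2 * K" and T = 200], goal_cases)
    case 1
    have "?X idx jl s" using assms by simp
    then show ?case by blast
  next
    case (2 s2)
    have e2: "env2 s2" by (rule env2_same[OF env2 2(2)]) auto
    have mach: "vars s2 vmach = int i" using 2(2) i by (simp add: same_def)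
    from 2(1) obtain x jl where X: "?X x jl s2" by (elim exE)
    have x0: "x > 0" using 2(3) X by simp
    have xD: "x < B ^ D" using X two_N_le N_ge by linarith
    with e2 x0 obtain l where l: "l < D" "arrs s2 aTY x = int (Suc l)" "B ^ l \<le> x" "x < B ^ Suc l" "arrs s2 aPA x = int (x - B ^ l)"
      unfolding env2_def elist_def by blast
    have ld: "l < d"
    proof (rule ccontr)
      assume "\<not> l < d"
      then have "B ^ d \<le> B ^ l" using params(1) by (intro power_increasing) auto
      with l(3) X show False by (simp add: N_def)
    qed
    define y where "y = x - B ^ l"
    have y: "x = y + B ^ l" "y < N" unfolding y_def using l(3) X by linarith+
    have lt: "y + B ^ l < B ^ Suc l" using l(4) y by simp
    have digs: "dig B x l' = dig B y l' + (if l' = l then 1 else 0)" for l'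
      unfolding y(1) by (rule dig_add_power[OF lt])
    have ldx: "ld x = ld y + th l" unfolding y(1) by (rule EL_ld_add(2)[OF lt l(1)])
    have "length (jl (Suc l)) = Y l + dig B x l" using X ld by blast
    then have "length (jl (Suc l)) \<noteq> 0" using digs[of l] by simp
    then obtain z zs where z: "jl (Suc l) = z # zs" by (cases "jl (Suc l)") auto
    let ?s1 = "run (vu ::= Arr aTY (Var vi)) s2"
    have p1: "part ?s1 jl" using X by (simp add: part_def)
    have v1: "vars ?s1 vu = int (Suc l)" "vars ?s1 vmach = int i" "arrs ?s1 = arrs s2" using X l mach by simp_all
    have sl: "Suc l \<le> d" using ld by simp
    note pop = part_pop[OF p1 v1(1) sl z v1(2) i(2)]
    let ?s2 = "run pop_job ?s1"
    let ?s = "run (vu ::= Arr aTY (Var vi) \<then> pop_job \<then> vi ::= Arr aPA (Var vi)) s2"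
    have same12: "same pop_job ?s1 ?s2" using ht_straight_aux[of pop_job ?s1] exe_same by auto
    have "vars ?s2 vi = int x" "arrs ?s2 aPA = arrs s2 aPA" using same12 X by (simp_all add: same_def)
    then have s: "vars ?s vi = int y" "arrs ?s = arrs ?s2" using l(5) by (simp_all add: y_def)
    let ?jl = "jl(Suc l := zs)"
    have "part ?s ?jl" using pop(1) unfolding part_def s(2) .
    moreover have "length (?jl (Suc l')) = Y l' + dig B y l'" if "l' < d" for l'
    proof -
      have "length (jl (Suc l')) = Y l' + dig B x l'" using X that by blast
      then show ?thesis using digs[of l'] z by auto
    qed
    moreover have "arrs ?s aLO i' = arrs s aLO i'" if "i' \<noteq> i" for i'
      using X that pop(2) unfolding s(2) v1(3) by simp
    moreover have "int K * arrs ?s aLO i \<le> (int K + 1) * (ld idx - ld y)"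
    proof -
      have "int K * JP z \<le> (int K + 1) * th l" using large_job[OF pop(3)] pop(4) by simp
      moreover have "int K * arrs s2 aLO i \<le> (int K + 1) * (ld idx - ld x)" using X by blast
      ultimately show ?thesis unfolding s(2) pop(2) v1(3) ldx by (simp add: algebra_simps)
    qed
    ultimately have X': "?X y ?jl ?s" using y(2) s(1) by blast
    have "(\<Sum>l'<d. dig B x l') = (\<Sum>l'<d. dig B y l') + 1"
      unfolding digs sum.distrib using ld by simp
    then have "?v ?s < ?v s2" unfolding s(1) using X by simp
    with X' have "(\<exists>x jl. ?X x jl ?s) \<and> ?v ?s < ?v s2" by blast
    then show ?case by (intro ht_straight) (simp, assumption, simp)
  next
    case (3 s2)
    from 3(1) obtain x jl where X: "?X x jl s2" by (elim exE)
    then have "x = 0" using 3(3) by simp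
    with X show ?case by (intro exI[of _ jl]) simp
  next
    case 4
    show ?case using tot vi by simp
  qed auto
qed

text \<open>Each round fills a machine or moves on to the next configuration, so there are at most
  \<open>m + N\<close> rounds. The equation of the machine coordinate says that the multiplicities
  sum up to \<open>m\<close>.\<close>

lemma ht_assign_large:
  assumes env: "env s" and env2: "env2 s" and part: "part s (joblist n)" and T: "T \<le> opt"
    and x: "\<And>q. arrs s aXC q = int (x q)" "\<And>q. x q \<noteq> 0 \<Longrightarrow> q \<in> confs T"
      "\<And>l. l < D \<Longrightarrow> (\<Sum>q\<in>confs T. x q * dig B q l) = b l"
    and lo: "arrs s aLO = (\<lambda>_. 0)"
  shows "ht assign_large s ((m + N) * (2 * K * 220 + 200) + 60) (\<lambda>s'. \<exists>jl. part s' jl \<and>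
    (\<forall>t. 1 \<le> t \<and> t \<le> d \<longrightarrow> jl t = []) \<and> (\<forall>i<m. int K * arrs s' aLO i \<le> (int K + 1) * opt))"
  unfolding assign_large_def
proof (rule ht_block[where U = "(m + N) * (2 * K * 220 + 200) + 40"], goal_cases)
  case (2 s1)
  let ?X = "\<lambda>i q x jl s'. i \<le> m \<and> vars s' vmach = int i \<and> vars s' vq = int q \<and> N \<le> q \<and> part s' jl \<and>
    (\<forall>r. arrs s' aXC r = int (x r)) \<and> (\<forall>r. x r \<noteq> 0 \<longrightarrow> r \<in> confs T) \<and> (\<forall>r<q. x r = 0) \<and>
    (\<forall>l<d. length (jl (Suc l)) = (\<Sum>r\<in>confs T. x r * dig B r l)) \<and> (\<Sum>r\<in>confs T. x r) = m - i \<and>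
    (\<forall>i'. i \<le> i' \<longrightarrow> arrs s' aLO i' = 0) \<and> (\<forall>i'<i. int K * arrs s' aLO i' \<le> (int K + 1) * T)"
  let ?v = "\<lambda>s'. m - nat (vars s' vmach) + (2 * N - nat (vars s' vq))"
  have e1: "env s1" "env2 s1" using env env2 2 by (simp_all add: env_def env2_def elist_def)
  have T2: "T \<le> 2 * int (K ^ 2) * dl" using T opt_le by linarith
  have X0: "?X 0 N x (joblist n) s1"
  proof (intro conjI allI impI)
    show "vars s1 vmach = int 0" "vars s1 vq = int N" using 2 env2 by (simp_all add: env2_def)
    show "part s1 (joblist n)" using 2 part by (simp add: part_def)
    show "arrs s1 aXC r = int (x r)" for r using 2 x(1) by simp
    show "r \<in> confs T" if "x r \<noteq> 0" for r using that by (rule x(2))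
    show "x r = 0" if "r < N" for r using x(2)[of r] that by (auto simp: confs_def)
    show "length (joblist n (Suc l)) = (\<Sum>r\<in>confs T. x r * dig B r l)" if "l < d" for l
      using x(3)[of l] that by (simp add: length_joblist b_def D_def)
    have "(\<Sum>r\<in>confs T. x r) = (\<Sum>r\<in>confs T. x r * dig B r d)"
      by (rule sum.cong) (simp_all add: conf_split(3))
    also have "\<dots> = m" using x(3)[of d] by (simp add: b_def D_def)
    finally show "(\<Sum>r\<in>confs T. x r) = m - 0" by simp
    show "arrs s1 aLO i' = 0" for i' using 2 lo by simp
  qed auto
  show ?case
  proof (rule ht_While[where I = "\<lambda>s'. \<exists>i q x jl. ?X i q x jl s'" and v = ?v and N = "m + N" and T = "2 * K * 220 + 180"], goal_cases)
    case 1
    show ?case by (rule exI[of _ 0], rule exI[of _ N], rule exI[of _ x], rule exI[of _ "joblist n"], rule X0)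
  next
    case (2 s2)
    have e2: "env s2" by (rule env_same[OF e1(1) 2(2)]) auto
    have e2': "env2 s2" by (rule env2_same[OF e1(2) 2(2)]) auto
    from 2(1) obtain i q x jl where X: "?X i q x jl s2" by (elim exE)
    have im: "i < m" using 2(3) X e2 by (simp add: env_def)
    show ?case
    proof (rule ht_Cond[where T = "2 * K * 220 + 150"], goal_cases)
      case 1
      have xq: "x q > 0" using 1 X by simp
      then have qc: "q \<in> confs T" using X by simp
      note sp = conf_split[OF qc]
      let ?x = "x(q := x q - 1)"
      have sums: "(\<Sum>r\<in>confs T. x r * f r) = (\<Sum>r\<in>confs T. ?x r * f r) + f q" for f :: "nat \<Rightarrow> nat"
      proof -
        have "x q * f q = (x q - 1) * f q + f q" using xq by (cases "x q") auto
        then show ?thesis using sum_fun_upd_nat[OF finite_confs qc, of x "x q - 1" f] by linarith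
      qed
      show ?case
      proof (rule ht_block[where U = "2 * K * 220 + 100"], goal_cases)
        case (2 s3)
        have e3: "env2 s3" using e2' 2 by (simp add: env2_def elist_def)
        have p3: "part s3 jl" using X 2 by (simp add: part_def)
        have v3: "vars s3 vmach = int i" "vars s3 vi = int (q - N)" "vars s3 vq = int q"
          "arrs s3 aXC = (arrs s2 aXC)(q := int (x q - 1))" "arrs s3 aLO = arrs s2 aLO"
          using X 2 e2' xq by (simp_all add: env2_def of_nat_diff)
        have digq: "dig B (q - N) l = dig B q l" if "l < d" for l using sp(2)[of l] that by simp
        have tot: "(\<Sum>l<d. dig B (q - N) l) \<le> 2 * K"
          using conf_total[OF qc T2] digq by simp
        have len: "length (jl (Suc l)) = (\<Sum>r\<in>confs T. ?x r * dig B r l) + dig B (q - N) l" if "l < d" for l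
        proof -
          have "length (jl (Suc l)) = (\<Sum>r\<in>confs T. x r * dig B r l)" using X that by blast
          then show ?thesis unfolding sums[of "\<lambda>r. dig B r l"] digq[OF that] .
        qed
        have lo3: "arrs s3 aLO i = 0" using X v3 by simp
        show ?case
        proof (rule ht_Seq[OF ht_chain[where Y = "\<lambda>l. \<Sum>r\<in>confs T. ?x r * dig B r l",
              OF e3 p3 v3(1) im v3(2) sp(1) len tot lo3], where U = 10], goal_cases)
          case (2 s4)
          then obtain jl' where jl': "part s4 jl'" "\<forall>l<d. length (jl' (Suc l)) = (\<Sum>r\<in>confs T. ?x r * dig B r l)"
            "\<forall>i'. i' \<noteq> i \<longrightarrow> arrs s4 aLO i' = arrs s3 aLO i'" "int K * arrs s4 aLO i \<le> (int K + 1) * ld (q - N)"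
            by (elim exE conjE)
          have v4: "vars s4 vmach = int i" "vars s4 vq = int q" "arrs s4 aXC = arrs s3 aXC"
            using 2(2) v3 by (simp_all add: same_def pop_job_def)
          let ?s = "run (vmach ::= Var vmach \<oplus> Num 1) s4"
          have "ld (q - N) \<le> T" using qc sp(4) by (simp add: confs_def)
          then have "(int K + 1) * ld (q - N) \<le> (int K + 1) * T" by (intro mult_left_mono) auto
          with jl'(4) have loi: "int K * arrs s4 aLO i \<le> (int K + 1) * T" by linarith
          have "?X (Suc i) q ?x jl' ?s"
          proof (intro conjI allI impI)
            show "Suc i \<le> m" "N \<le> q" using im X by auto
            show "vars ?s vmach = int (Suc i)" "vars ?s vq = int q" using v4 by simp_all
            show "part ?s jl'" using jl'(1) by (simp add: part_def)
            show "arrs ?s aXC r = int (?x r)" for r using v4 v3 X by simp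
            show "r \<in> confs T" if "?x r \<noteq> 0" for r using that X qc by (cases "r = q") auto
            show "?x r = 0" if "r < q" for r using that X by simp
            show "length (jl' (Suc l)) = (\<Sum>r\<in>confs T. ?x r * dig B r l)" if "l < d" for l using jl'(2) that by blast
            have "(\<Sum>r\<in>confs T. x r) = m - i" using X by blast
            then show "(\<Sum>r\<in>confs T. ?x r) = m - Suc i" using sums[of "\<lambda>_. 1"] im by simp
            show "arrs ?s aLO i' = 0" if "Suc i \<le> i'" for i' using that jl'(3) v3 X by simp
            show "int K * arrs ?s aLO i' \<le> (int K + 1) * T" if "i' < Suc i" for i'
            proof (cases "i' = i")
              case True
              then show ?thesis using loi by simp
            next
              case False
              then have "i' < i" using that by simp
              then show ?thesis using X jl'(3) v3(5) by simp
            qed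
          qed
          then have "\<exists>i q x jl. ?X i q x jl ?s"
            by - (rule exI[of _ "Suc i"], rule exI[of _ q], rule exI[of _ ?x], rule exI[of _ jl'])
          moreover have "?v ?s < ?v s2" using v4 X im by simp
          ultimately have "(\<exists>i q x jl. ?X i q x jl ?s) \<and> ?v ?s < ?v s2" by (rule conjI)
          then show ?case by (intro ht_straight) (simp, assumption, simp)
        qed simp_all
      qed auto
    next
      case 2
      have xq: "x q = 0" using 2 X by simp
      \<comment> \<open>While machines are left, some multiplicity is positive, so the search cannot
        leave the range of the configurations.\<close>
      have q: "q < 2 * N"
      proof (rule ccontr)
        assume ge: "\<not> q < 2 * N"
        have "(\<Sum>r\<in>confs T. x r) = (\<Sum>r\<in>confs T. 0)"
        proof (rule sum.cong[OF refl])
          fix r assume "r \<in> confs T"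
          then have "r < q" using ge by (simp add: confs_def)
          then show "x r = 0" using X by blast
        qed
        moreover have "(\<Sum>r\<in>confs T. x r) = m - i" using X by blast
        ultimately show False using im by simp
      qed
      let ?s = "run (vq ::= Var vq \<oplus> Num 1) s2"
      have "part s2 jl" using X by blast
      then have "part ?s jl" by (simp add: part_def)
      then have "?X i (Suc q) x jl ?s" using X xq by (simp add: less_Suc_eq)
      then have ex: "\<exists>i q x jl. ?X i q x jl ?s"
        by - (rule exI[of _ i], rule exI[of _ "Suc q"], rule exI[of _ x], rule exI[of _ jl])
      have vs: "vars ?s vmach = int i" "vars ?s vq = int (Suc q)" "vars s2 vmach = int i" "vars s2 vq = int q"
        using X by simp_all
      have "?v ?s < ?v s2" unfolding vs nat_int using q by arith
      with ex have "(\<exists>i q x jl. ?X i q x jl ?s) \<and> ?v ?s < ?v s2" by (rule conjI)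
      then show ?case by (intro ht_straight) (simp, assumption, simp)
    qed simp
  next
    case (3 s2)
    have e2: "env s2" by (rule env_same[OF e1(1) 3(2)]) auto
    from 3(1) obtain i q x jl where X: "?X i q x jl s2" by (elim exE)
    have i: "i = m" using 3(3) X e2 by (simp add: env_def)
    have "(\<Sum>r\<in>confs T. x r) = 0" using X i by simp
    then have "\<forall>r\<in>confs T. x r = 0" by simp
    then have len: "length (jl (Suc l)) = 0" if "l < d" for l using X that by simp
    have "jl t = []" if "1 \<le> t" "t \<le> d" for t using len[of "t - 1"] that by simp
    moreover have "int K * arrs s2 aLO i' \<le> (int K + 1) * opt" if "i' < m" for i'
    proof -
      have "(int K + 1) * T \<le> (int K + 1) * opt" using T by (intro mult_left_mono) auto
      moreover have "int K * arrs s2 aLO i' \<le> (int K + 1) * T" using X i that by blast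
      ultimately show ?thesis by linarith
    qed
    moreover have "part s2 jl" using X by blast
    ultimately show ?case by (intro exI[of _ jl]) blast
  next
    case 4
    show ?case using X0 by simp
  qed (auto simp: algebra_simps)
qed auto

lemma assigned_load:
  assumes "part s jl"
  shows "(\<Sum>i<m. arrs s aLO i) = (\<Sum>j | j < n \<and> j \<notin> set (jl (ty j)). JP j)"
proof -
  let ?S = "{j. j < n \<and> j \<notin> set (jl (ty j))}"
  have out: "\<exists>i<m. arrs s aOUT j = int i" if "j \<in> ?S" for j using assms that by (simp add: part_def)
  have "(\<Sum>i<m. arrs s aLO i) = (\<Sum>i<m. \<Sum>j | j \<in> ?S \<and> nat (arrs s aOUT j) = i. JP j)"
  proof (rule sum.cong[OF refl])
    fix i assume i: "i \<in> {..<m}"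
    have "{j. j < n \<and> j \<notin> set (jl (ty j)) \<and> arrs s aOUT j = int i} = {j. j \<in> ?S \<and> nat (arrs s aOUT j) = i}"
      using out by force
    then show "arrs s aLO i = (\<Sum>j | j \<in> ?S \<and> nat (arrs s aOUT j) = i. JP j)"
      using assms i by (simp add: part_def)
  qed
  also have "\<dots> = (\<Sum>j\<in>?S. JP j)"
  proof (rule sum.group)
    show "(\<lambda>j. nat (arrs s aOUT j)) ` ?S \<subseteq> {..<m}" using out by force
  qed simp_all
  finally show ?thesis .
qed

text \<open>A machine receives small jobs only while its load is below \<open>av <= opt\<close>. A
  small job is smaller than \<open>K * dl\<close>, which is at most \<open>opt / K\<close>, so such
  a load stays within \<open>opt + opt / K\<close>.\<close>

lemma ht_assign_small:
  assumes env: "env s" and av: "vars s vav = av" and part: "part s jl"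
    and empty: "\<And>t. 1 \<le> t \<Longrightarrow> t \<le> d \<Longrightarrow> jl t = []"
    and load: "\<And>i. i < m \<Longrightarrow> int K * arrs s aLO i \<le> (int K + 1) * opt"
  shows "ht assign_small s ((n + m) * 300 + 60) (\<lambda>s'. part s' (\<lambda>_. []) \<and> (\<forall>i<m. int K * arrs s' aLO i \<le> (int K + 1) * opt))"
  unfolding assign_small_def
proof (rule ht_block[where U = "(n + m) * 300 + 40"], goal_cases)
  case (2 s1)
  let ?X = "\<lambda>i xs s'. vars s' vmach = int i \<and> i \<le> m \<and> part s' (jl(0 := xs)) \<and> vars s' vu = 0 \<and>
    (\<forall>i'<i. av \<le> arrs s' aLO i') \<and> (\<forall>i<m. int K * arrs s' aLO i \<le> (int K + 1) * opt)"
  have len0: "length (jl 0) \<le> n"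
  proof -
    have "distinct (jl 0)" "set (jl 0) \<subseteq> {..<n}" using part unfolding part_def by auto
    then have "card (set (jl 0)) \<le> card {..<n}" by (intro card_mono) auto
    then show ?thesis using \<open>distinct (jl 0)\<close> by (simp add: distinct_card)
  qed
  have X0: "?X 0 (jl 0) s1" using 2 part load by (simp add: part_def)
  have av1: "vars s1 vav = av" using 2 av by simp
  have hd: "lst (arrs s' aNX) (arrs s' aHD 0) xs" if "?X i xs s'" for i xs s'
  proof -
    have "lst (arrs s' aNX) (arrs s' aHD 0) ((jl(0 := xs)) 0)" using that unfolding part_def by blast
    then show ?thesis by simp
  qed
  show ?case
  proof (rule ht_While_index[where I = "\<lambda>k s'. \<exists>i xs. ?X i xs s' \<and> k = m - i + length xs" and k = "m + length (jl 0)"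
      and T = 250 and N = "n + m"], goal_cases)
    case 1
    show ?case by (rule exI[of _ 0], rule exI[of _ "jl 0"]) (use X0 in simp)
  next
    case (2 k s2)
    from 2(1) obtain i xs where Xk: "?X i xs s2 \<and> k = m - i + length xs" by (elim exE)
    have X: "?X i xs s2" and k: "k = m - i + length xs" using conjunct1[OF Xk] conjunct2[OF Xk] .
    have avs: "vars s2 vav = av" using 2(2) av1 by (simp add: same_def pop_job_def)
    have "arrs s2 aHD 0 > 0" using 2(3) X by simp
    with hd[OF X] obtain x ys where xs: "xs = x # ys" by (cases xs) auto
    have p: "part s2 (jl(0 := xs))" using X by blast
    have xn: "x < n" "ty x = 0"
    proof -
      have "set ((jl(0 := xs)) 0) \<subseteq> {j. j < n \<and> ty j = 0}" using p unfolding part_def by blast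
      then show "x < n" "ty x = 0" using xs by auto
    qed
    \<comment> \<open>If all machines had load at least \<open>av\<close>, the assigned jobs alone
      would reach the total \<open>m * av\<close> of all jobs, although \<open>x\<close> is
      unassigned.\<close>
    have im: "i < m"
    proof (rule ccontr)
      assume "\<not> i < m"
      with X have "i = m" by simp
      then have "(\<Sum>i<m. av) \<le> (\<Sum>i<m. arrs s2 aLO i)" using X by (intro sum_mono) auto
      also have "\<dots> = (\<Sum>j | j < n \<and> j \<notin> set ((jl(0 := xs)) (ty j)). JP j)" by (rule assigned_load[OF p])
      also have "\<dots> \<le> (\<Sum>j\<in>{..<n} - {x}. JP j)"
      proof (rule sum_mono2)
        show "{j. j < n \<and> j \<notin> set ((jl(0 := xs)) (ty j))} \<subseteq> {..<n} - {x}" using xn xs by auto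
      qed (auto simp: JP_pos less_imp_le)
      also have "\<dots> < (\<Sum>j<n. JP j)" using xn JP_pos[OF xn(1)] by (subst (2) sum.remove[of _ x]) auto
      finally show False unfolding sum_JP by simp
    qed
    show ?case
    proof (rule ht_Cond[where T = 200], goal_cases)
      case 1
      then have lo: "arrs s2 aLO i < av" using X avs by simp
      have v: "vars s2 vu = int 0" "vars s2 vmach = int i" using X by simp_all
      have jx: "(jl(0 := xs)) 0 = x # ys" using xs by simp
      note pop = part_pop[OF p v(1) le0 jx v(2) im]
      let ?s = "run pop_job s2"
      have same: "same pop_job s2 ?s" using ht_straight_aux[of pop_job s2] exe_same by auto
      have new: "int K * (arrs s2 aLO i + JP x) \<le> (int K + 1) * opt"
      proof -
        have "int K * arrs s2 aLO i \<le> int K * opt" using lo av_le_opt by (intro mult_left_mono) auto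
        moreover have "int K * JP x \<le> int K * (int K * dl)" using small_job[OF xn(2)] by (intro mult_left_mono) auto
        moreover have "int K * (int K * dl) \<le> opt" using opt_ge by (simp add: power2_eq_square mult.assoc)
        ultimately show ?thesis by (simp add: distrib_left distrib_right)
      qed
      have "?X i ys ?s"
      proof (intro conjI allI impI)
        show "vars ?s vmach = int i" "vars ?s vu = 0" using same X by (simp_all add: same_def)
        show "i \<le> m" using im by simp
        show "part ?s (jl(0 := ys))" using pop(1) unfolding fun_upd_upd .
        show "av \<le> arrs ?s aLO i'" if "i' < i" for i' using X that unfolding pop(2) by simp
        show "int K * arrs ?s aLO i' \<le> (int K + 1) * opt" if "i' < m" for i'
          using X that new unfolding pop(2) by (cases "i' = i") simp_all
      qed
      then have "\<exists>i' zs. ?X i' zs ?s \<and> k - 1 = m - i' + length zs"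
        by - (rule exI[of _ i], rule exI[of _ ys], simp add: k xs)
      moreover have "k - 1 < k" using k xs by simp
      ultimately have "\<exists>k'<k. \<exists>i xs. ?X i xs ?s \<and> k' = m - i + length xs"
        by - (rule exI[of _ "k - 1"], rule conjI)
      then show ?case by (intro ht_straight) (simp, assumption, simp)
    next
      case 2
      then have lo: "av \<le> arrs s2 aLO i" using X avs by simp
      let ?s = "run (vmach ::= Var vmach \<oplus> Num 1) s2"
      have "part ?s (jl(0 := xs))" using p by (simp add: part_def)
      then have Xs: "?X (Suc i) xs ?s" using X lo im by (simp add: less_Suc_eq)
      have "k - 1 = m - Suc i + length xs" using k im by simp
      with Xs have "?X (Suc i) xs ?s \<and> k - 1 = m - Suc i + length xs" by (rule conjI)
      then have "\<exists>i' zs. ?X i' zs ?s \<and> k - 1 = m - i' + length zs"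
        by - (rule exI[of _ "Suc i"], rule exI[of _ xs])
      moreover have "k - 1 < k" using k xs by simp
      ultimately have "\<exists>k'<k. \<exists>i xs. ?X i xs ?s \<and> k' = m - i + length xs"
        by - (rule exI[of _ "k - 1"], rule conjI)
      then show ?case by (intro ht_straight) (simp, assumption, simp)
    qed simp
  next
    case (3 k s2)
    from 3(1) obtain i xs where Xk: "?X i xs s2 \<and> k = m - i + length xs" by (elim exE)
    have X: "?X i xs s2" using conjunct1[OF Xk] .
    have "arrs s2 aHD 0 \<le> 0" using 3(3) X by simp
    with hd[OF X] have xs: "xs = []" by (cases xs) auto
    have "part s2 (\<lambda>_. [])"
    proof -
      have "(jl(0 := xs)) t = []" if "t \<le> d" for t using empty[of t] xs that by (cases t) auto
      moreover from this have "(jl(0 := xs)) (ty j) = []" for j using ty_le by blast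
      ultimately show ?thesis using X unfolding part_def by (simp del: fun_upd_apply)
    qed
    with X show ?case by blast
  next
    case 4
    show ?case using len0 by simp
  qed auto
qed auto

lemma ht_output_machines:
  assumes "vars s vn = int n"
  shows "ht output_machines s (n * 60 + 30) (\<lambda>s'. outs s' = outs s @ map (arrs s aOUT) [0..<n])"
  unfolding output_machines_def
proof (rule ht_block[where U = "n * 60 + 20"], goal_cases)
  case (2 s1)
  let ?I = "\<lambda>j s'. vars s' vj = int j \<and> outs s' = outs s @ map (arrs s aOUT) [0..<j]"
  have s1: "vars s1 vn = int n" "arrs s1 = arrs s" "?I 0 s1" using 2 assms by simp_all
  show ?case
  proof (rule ht_For[where I = ?I and N = n and T = 40], goal_cases)
    case (2 j s2)
    have "arrs s2 = arrs s" using 2(3) s1 by (simp add: same_def fun_eq_iff)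
    with 2 show ?case by (intro ht_straight) auto
  qed (use s1 in \<open>auto simp: same_def\<close>)
qed auto

end

section \<open>The complete program\<close>

definition output_identity :: com where
  "output_identity = vj ::= Num 0 \<then> While (Var vn \<ominus> Var vj) (Out (Var vj) \<then> vj ::= Var vj \<oplus> Num 1)"

definition schedule :: com where
  "schedule = set_accuracy \<then> set_powers \<then> read_jobs \<then> set_bounds \<then> set_types \<then> classify_jobs \<then> set_params \<then> set_weights \<then> list_vectors \<then> set_bits \<then>
    run_automaton \<then> backtrack \<then> assign_large \<then> assign_small \<then> output_machines"

definition eptas :: com where
  "eptas = Get vk \<then> Get vn \<then> Get vm \<then> Cond (Var vn \<ominus> Var vm) schedule output_identity"

lemmas stage_defs = set_accuracy_def set_powers_def mult_machines_def read_jobs_def set_bounds_def set_types_def classify_jobs_def set_params_def set_weights_def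
  list_vectors_def set_bits_def add_confs_def shift_layer_def run_automaton_def backtrack_def pop_job_def assign_large_def assign_small_def output_machines_def

lemma cwf_eptas: "cwf eptas"
  by (simp add: eptas_def schedule_def output_identity_def stage_defs)

lemma stage_vars [simp]:
  "mvars set_accuracy = {vK}" "mvars set_powers = {vL}" "mvars read_jobs = {vP, vmx, vj, vp, vr, vi, vw, vt}"
  "mvars set_bounds = {vdl, vav, vt}" "mvars set_types = {vx, vs, vd, vu, vi, vt}" "mvars classify_jobs = {vj, vi}"
  "mvars set_params = {vR, vB, vR0, vt}" "mvars set_weights = {vx, vj, vZF, vZB, vt}"
  "mvars list_vectors = {vlen, vj, vN, vstop, vi, vt}" "mvars set_bits = {vj, vw, vi}"
  "mvars run_automaton = {vT, vtop, vi, vbase, vc, vq, vy, vx, vh}" "mvars backtrack = {vi, vc, vbase, vq}"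
  "mvars assign_large = {vmach, vq, vi, vu, vjb}" "mvars assign_small = {vmach, vu, vjb}"
  by (auto simp: stage_defs)

lemma stage_arrs [simp]:
  "marrs set_accuracy = {}" "marrs set_powers = {aPW}" "marrs read_jobs = {aJP}" "marrs set_bounds = {}" "marrs set_types = {aTH}"
  "marrs classify_jobs = {aNX, aHD, aCT}" "marrs set_params = {}" "marrs set_weights = {aW}"
  "marrs list_vectors = {aEL, aLD, aPA, aTY}" "marrs set_bits = {aBE}" "marrs run_automaton = {aVA}" "marrs backtrack = {aXC}"
  "marrs assign_large = {aXC, aHD, aOUT, aLO}" "marrs assign_small = {aHD, aOUT, aLO}"
  by (auto simp: stage_defs)

lemma stage_io [simp]:
  "\<not> gets set_accuracy" "\<not> gets set_powers" "\<not> puts set_accuracy" "\<not> puts set_powers" "\<not> puts read_jobs" "\<not> puts set_bounds" "\<not> puts set_types"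
  "\<not> puts classify_jobs" "\<not> puts set_params" "\<not> puts set_weights" "\<not> puts list_vectors" "\<not> puts set_bits" "\<not> puts run_automaton"
  "\<not> puts backtrack" "\<not> puts assign_large" "\<not> puts assign_small"
  by (auto simp: stage_defs)

subsection \<open>Running time\<close>

context sched
begin

abbreviation (input) "t_read \<equiv> n * (100 * L + 80 * kap + 400) + 30"
abbreviation (input) "t_class \<equiv> n * (100 * d + 200) + 100"
abbreviation (input) "t_weights \<equiv> D * (160 * kap + 400) + 160 * kap + 400"
abbreviation (input) "t_list \<equiv> D * (200 * B ^ D + 160 * kap + 500) + 50"
abbreviation (input) "t_bits \<equiv> D * (150 * L + 100) + 50"
abbreviation (input) "t_dp \<equiv> 2 * K ^ 2 * (L * (ZB * (200 * N + 100) + B ^ D * 200 + 300) + 200) + L * 30 + 200"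
abbreviation (input) "t_back \<equiv> L * ZF * 200 + 50"
abbreviation (input) "t_assign \<equiv> (m + N) * (2 * K * 220 + 200) + 60"
abbreviation (input) "t_small \<equiv> (n + m) * 300 + 60"
abbreviation (input) "t_print \<equiv> n * 60 + 30"

text \<open>Nested to the right like \<open>schedule\<close>, so that every application of
  \<open>ht_Seq\<close> splits the bound by reflexivity.\<close>

definition t_main :: nat where
  "t_main = 40 * (kap + 1) + (100 * (L + 1) + (t_read + (100 * (kap + 1) + (200 * (d + 1) + (t_class +
    (500 * (kap + 1) + (t_weights + (t_list + (t_bits + (t_dp + (t_back + (t_assign + (t_small + t_print)))))))))))))"

lemma ht_schedule:
  assumes vk: "vars s vk = int k" and vn: "vars s vn = int n" and vm: "vars s vm = int m"
    and inps: "inps s = map p [0..<n]" and zero: "arrs s = (\<lambda>_ _. 0)" and outs: "outs s = []"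
  shows "ht schedule s t_main (\<lambda>s'. \<exists>a. outs s' = map (\<lambda>j. int (a j)) [0..<n] \<and> (\<forall>j<n. a j < m) \<and>
    (\<forall>i<m. int K * (\<Sum>j | j < n \<and> a j = i. JP j) \<le> (int K + 1) * opt))"
  unfolding schedule_def t_main_def
proof (rule ht_Seq[OF ht_set_accuracy[OF vk] _ order_refl], goal_cases)
  case (1 s1)
  note sm1 = 1(2)[unfolded same_def, simplified]
  have vn1: "vars s1 vn = int n" using sm1 vn by simp
  show ?case
  proof (rule ht_Seq[OF ht_set_powers[OF vn1] _ order_refl], goal_cases)
    case (1 s2)
    note sm2 = 1(2)[unfolded same_def, simplified]
    have e2: "env s2" using 1(1) \<open>vars s1 vK = int K\<close> sm1 sm2 vn vm by (simp add: env_def)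
    have i2: "inps s2 = map p [0..<n]" using sm1 sm2 inps by simp
    have z2: "arrs s2 x = (\<lambda>_. 0)" if "x \<noteq> aPW" for x using sm1 sm2 zero that by simp
    have o2: "outs s2 = []" using sm1 sm2 outs by simp
    show ?case
    proof (rule ht_Seq[OF ht_read_jobs[OF e2 i2] _ order_refl], goal_cases)
      case (1 s3)
      have e3: "env s3" by (rule env_same[OF e2 1(2)]) auto
      note sm3 = 1(2)[unfolded same_def, simplified]
      have z3: "arrs s3 x = (\<lambda>_. 0)" if "x \<notin> {aPW, aJP}" for x using sm3 z2 that by simp
      have v3: "vars s3 vP = P" "vars s3 vmx = mx" "\<forall>j<n. arrs s3 aJP j = JP j" "outs s3 = []"
        using 1(1) sm3 o2 by simp_all
      show ?case
      proof (rule ht_Seq[OF ht_set_bounds[OF e3 v3(1,2)] _ order_refl], goal_cases)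
        case (1 s4)
        have e4: "env s4" by (rule env_same[OF e3 1(2)]) auto
        note sm4 = 1(2)[unfolded same_def, simplified]
        have z4: "arrs s4 x = (\<lambda>_. 0)" if "x \<notin> {aPW, aJP}" for x using sm4 z3 that by simp
        have v4: "vars s4 vdl = dl" "vars s4 vav = av" "\<forall>j<n. arrs s4 aJP j = JP j" "outs s4 = []"
          using 1(1) sm4 v3 by simp_all
        have th4: "arrs s4 aTH = (\<lambda>_. 0)" by (rule z4) simp
        show ?case
        proof (rule ht_Seq[OF ht_set_types[OF e4 v4(1) th4] _ order_refl], goal_cases)
          case (1 s5)
          have e5: "env s5" by (rule env_same[OF e4 1(2)]) auto
          note sm5 = 1(2)[unfolded same_def, simplified]
          have z5: "arrs s5 x = (\<lambda>_. 0)" if "x \<notin> {aPW, aJP, aTH}" for x using sm5 z4 that by simp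
          have v5: "vars s5 vdl = dl" "vars s5 vav = av" "\<forall>j<n. arrs s5 aJP j = JP j" "outs s5 = []"
            "vars s5 vd = int d" "\<forall>i. arrs s5 aTH i = (if 1 \<le> i \<and> i \<le> d then th (i - 1) else 0)"
            using 1(1) sm5 v4 by simp_all
          have hd5: "arrs s5 aHD = (\<lambda>_. 0)" "arrs s5 aCT = (\<lambda>_. 0)" by (rule z5, simp)+
          show ?case
          proof (rule ht_Seq[OF ht_classify_jobs[OF e5 v5(5,6,3) hd5] _ order_refl], goal_cases)
            case (1 s6)
            have e6: "env s6" by (rule env_same[OF e5 1(2)]) auto
            note sm6 = 1(2)[unfolded same_def, simplified]
            have z6: "arrs s6 x = (\<lambda>_. 0)" if "x \<notin> {aPW, aJP, aTH, aNX, aHD, aCT}" for x using sm6 z5 that by simp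
            have v6: "vars s6 vdl = dl" "vars s6 vav = av" "\<forall>j<n. arrs s6 aJP j = JP j" "outs s6 = []"
              "vars s6 vd = int d" "\<forall>i. arrs s6 aTH i = (if 1 \<le> i \<and> i \<le> d then th (i - 1) else 0)"
              using sm6 v5 by simp_all
            note c6 = 1(1)
            show ?case
            proof (rule ht_Seq[OF ht_set_params[OF e6] _ order_refl], goal_cases)
              case (1 s7)
              have e7: "env s7" by (rule env_same[OF e6 1(2)]) auto
              note sm7 = 1(2)[unfolded same_def, simplified]
              have a7: "arrs s7 x = arrs s6 x" for x using sm7 by simp
              have v7: "vars s7 vdl = dl" "vars s7 vav = av" "outs s7 = []" "vars s7 vd = int d"
                "vars s7 vR = int R" "vars s7 vB = int B" "vars s7 vR0 = int R0"
                using sm7 v6 1(1) by simp_all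
              show ?case
              proof (rule ht_Seq[OF ht_set_weights[OF v7(4,5,7)] _ order_refl], goal_cases)
                case (1 s8)
                have e8: "env s8" by (rule env_same[OF e7 1(2)]) auto
                note sm8 = 1(2)[unfolded same_def, simplified]
                have a8: "arrs s8 x = arrs s6 x" if "x \<noteq> aW" for x using sm8 a7 that by simp
                have v8: "vars s8 vdl = dl" "vars s8 vav = av" "outs s8 = []" "vars s8 vd = int d"
                  "vars s8 vB = int B" "vars s8 vZF = int ZF" "vars s8 vZB = int ZB"
                  "\<forall>l<D. arrs s8 aW (Suc l) = int (R ^ l)"
                  using sm8 v7 1(1) by simp_all
                have th8: "\<forall>i. arrs s8 aTH i = (if 1 \<le> i \<and> i \<le> d then th (i - 1) else 0)"
                  using v6(6) a8[of aTH] by simp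
                have z8: "arrs s8 aEL = (\<lambda>_. 0)" "arrs s8 aLD = (\<lambda>_. 0)"
                  using z6[of aEL] a8[of aEL] z6[of aLD] a8[of aLD] by simp_all
                show ?case
                proof (rule ht_Seq[OF ht_list_vectors[OF v8(4,5,8) th8 z8] _ order_refl], goal_cases)
                  case (1 s9)
                  have e9: "env s9" by (rule env_same[OF e8 1(2)]) auto
                  note sm9 = 1(2)[unfolded same_def, simplified]
                  have a9: "arrs s9 x = arrs s6 x" if "x \<notin> {aW, aEL, aLD, aPA, aTY}" for x using sm9 a8 that by simp
                  have v9: "vars s9 vdl = dl" "vars s9 vav = av" "outs s9 = []" "vars s9 vd = int d"
                    "vars s9 vZF = int ZF" "vars s9 vZB = int ZB" "\<forall>l<D. arrs s9 aW (Suc l) = int (R ^ l)"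
                    "elist (B ^ D) s9" "vars s9 vlen = int (B ^ D)" "vars s9 vN = int N"
                    using sm9 v8 1(1) by simp_all
                  have ct9: "\<forall>l<D. arrs s9 aCT (Suc l) = int (b l)" using c6 a9[of aCT] by simp
                  have z9: "arrs s9 aBE = (\<lambda>_. 0)" using z6[of aBE] a9[of aBE] by simp
                  show ?case
                  proof (rule ht_Seq[OF ht_set_bits[OF e9 v9(4,7) ct9 z9] _ order_refl], goal_cases)
                    case (1 s10)
                    have e10: "env s10" by (rule env_same[OF e9 1(2)]) auto
                    note sm10 = 1(2)[unfolded same_def, simplified]
                    have a10: "arrs s10 x = arrs s6 x" if "x \<notin> {aW, aEL, aLD, aPA, aTY, aBE}" for x
                      using sm10 a9 that by simp
                    have el10: "elist (B ^ D) s10" using v9(8) sm10 by (simp add: elist_def)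
                    have f10: "env2 s10" using v9 el10 sm10 1(1) e10 by (simp add: env2_def env_def)
                    have v10: "vars s10 vav = av" "outs s10 = []" using v9 sm10 by simp_all
                    have z10: "arrs s10 aVA = (\<lambda>_. 0)" using z6[of aVA] a10[of aVA] by simp
                    show ?case
                    proof (rule ht_Seq[OF ht_run_automaton[OF f10 z10] _ order_refl], goal_cases)
                      case (1 s11)
                      have e11: "env s11" by (rule env_same[OF e10 1(2)]) auto
                      have f11: "env2 s11" by (rule env2_same[OF f10 1(2)]) auto
                      note sm11 = 1(2)[unfolded same_def, simplified]
                      have a11: "arrs s11 x = arrs s6 x" if "x \<notin> {aW, aEL, aLD, aPA, aTY, aBE, aVA}" for x
                        using sm11 a10 that by simp
                      have v11: "vars s11 vav = av" "outs s11 = []" using v10 sm11 by simp_all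
                      obtain T where T: "T \<le> opt" "table T (arrs s11 aVA)" "vars s11 vtop = int (L * ZF)" "arrs s11 aVA (L * ZF) \<noteq> 0"
                        using 1(1) by blast
                      have z11: "arrs s11 aXC = (\<lambda>_. 0)" using z6[of aXC] a11[of aXC] by simp
                      show ?case
                      proof (rule ht_Seq[OF ht_backtrack[OF e11 f11 T(2,1,3,4) z11] _ order_refl], goal_cases)
                        case (1 s12)
                        have e12: "env s12" by (rule env_same[OF e11 1(2)]) auto
                        have f12: "env2 s12" by (rule env2_same[OF f11 1(2)]) auto
                        note sm12 = 1(2)[unfolded same_def, simplified]
                        have a12: "arrs s12 x = arrs s6 x" if "x \<notin> {aW, aEL, aLD, aPA, aTY, aBE, aVA, aXC}" for x
                          using sm12 a11 that by simp
                        have v12: "vars s12 vav = av" "outs s12 = []" using v11 sm12 by simp_all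
                        obtain x where x: "\<forall>q. arrs s12 aXC q = int (x q)" "\<forall>q. x q \<noteq> 0 \<longrightarrow> q \<in> confs T"
                          "\<forall>l<D. (\<Sum>q\<in>confs T. x q * dig B q l) = b l" using 1(1) by (elim exE conjE)
                        have lo12: "arrs s12 aLO = (\<lambda>_. 0)" using z6[of aLO] a12[of aLO] by simp
                        have p12: "part s12 (joblist n)"
                        proof -
                          have none: "{j. j < n \<and> j \<notin> set (joblist n (ty j)) \<and> arrs s12 aOUT j = int i} = {}" for i
                            by (auto simp: set_joblist)
                          show ?thesis
                            using c6 v6(3) lo12 a12[of aNX] a12[of aHD] a12[of aJP]
                            unfolding part_def none by (auto simp: set_joblist distinct_joblist)
                        qed
                        show ?case
                        proof (rule ht_Seq[OF ht_assign_large[OF e12 f12 p12 T(1) x(1)[rule_format] x(2)[rule_format] x(3)[rule_format] lo12]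
                            _ order_refl], goal_cases)
                          case (3 s13)
                          have e13: "env s13" by (rule env_same[OF e12 3(2)]) auto
                          note sm13 = 3(2)[unfolded same_def, simplified]
                          have v13: "vars s13 vav = av" "outs s13 = []" using v12 sm13 by simp_all
                          obtain jl where jl: "part s13 jl" "\<forall>t. 1 \<le> t \<and> t \<le> d \<longrightarrow> jl t = []"
                            "\<forall>i<m. int K * arrs s13 aLO i \<le> (int K + 1) * opt" using 3(1) by (elim exE conjE)
                          have em: "jl t = []" if "1 \<le> t" "t \<le> d" for t using jl(2) that by simp
                          have lo: "int K * arrs s13 aLO i \<le> (int K + 1) * opt" if "i < m" for i using jl(3) that by simp
                          show ?case
                          proof (rule ht_Seq[OF ht_assign_small[OF e13 v13(1) jl(1) em lo] _ order_refl], goal_cases)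
                            case (4 s14)
                            have vn14: "vars s14 vn = int n" and o14: "outs s14 = []"
                              using 4(2) e13 v13 by (simp_all add: same_def env_def)
                            define a where "a j = nat (arrs s14 aOUT j)" for j
                            have out: "arrs s14 aOUT j = int (a j)" "a j < m" if jn: "j < n" for j
                            proof -
                              obtain i where "i < m" "arrs s14 aOUT j = int i" using 4(1) jn by (auto simp: part_def)
                              then show "arrs s14 aOUT j = int (a j)" "a j < m" by (simp_all add: a_def)
                            qed
                            have load: "int K * (\<Sum>j | j < n \<and> a j = i. JP j) \<le> (int K + 1) * opt" if i: "i < m" for i
                            proof -
                              have "{j. j < n \<and> a j = i} = {j. j < n \<and> arrs s14 aOUT j = int i}" using out by auto
                              then have "arrs s14 aLO i = (\<Sum>j | j < n \<and> a j = i. JP j)"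
                                using 4(1) i by (simp add: part_def)
                              then show ?thesis using 4(1) i by auto
                            qed
                            have "map (arrs s14 aOUT) [0..<n] = map (\<lambda>j. int (a j)) [0..<n]" using out by simp
                            then show ?case
                              using out load o14 by (intro ht_mono[OF ht_output_machines[OF vn14] order_refl]) auto
                          qed auto
                        qed auto
                      qed
                    qed
                  qed
                qed
              qed
            qed
          qed
        qed
      qed
    qed
  qed
qed

text \<open>\<open>ZF\<close> dominates all quantities that depend on the accuracy alone, which
  leaves only \<open>n\<close>, \<open>L\<close> and \<open>ZF\<close> in the time bound.\<close>

lemma size_bounds:
  "B ^ D \<le> ZF" "ZB \<le> ZF" "N \<le> ZF" "K \<le> ZF" "K ^ 2 \<le> ZF" "D \<le> ZF" "kap \<le> K" "K \<le> d" "1 \<le> ZF" "2 ^ d \<le> ZF"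
proof -
  have RD: "R \<le> R ^ D" using R_pos by (intro self_le_power) (auto simp: D_def)
  show "B ^ D \<le> ZF" unfolding ZF_def using params(2) by (intro power_mono) auto
  then show "N \<le> ZF" using two_N_le by linarith
  show "ZB \<le> ZF" by (rule ZB_le)
  have "K \<le> K ^ 4" "K ^ 2 \<le> K ^ 4" using K_pos power_increasing[of 1 4 K] power_increasing[of 2 4 K] by auto
  with RD show "K \<le> ZF" "K ^ 2 \<le> ZF" unfolding ZF_def R_def by linarith+
  have 2: "2 ^ D \<le> ZF" unfolding ZF_def using params(2,8) K_pos by (intro power_mono) auto
  moreover have "D < 2 ^ D" by (rule less_exp)
  ultimately show "D \<le> ZF" by linarith
  have "(2 :: nat) ^ d \<le> 2 ^ D" by (intro power_increasing) (auto simp: D_def)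
  with 2 show "2 ^ d \<le> ZF" by linarith
  show "kap \<le> K" unfolding K_def using less_exp[of kap] by linarith
  show "K \<le> d" by (simp add: d_def)
  show "1 \<le> ZF" using R_pos by (simp add: ZF_def Suc_le_eq)
qed

text \<open>If \<open>d > L\<close>, then \<open>n < 2 ^ L <= 2 ^ d <= ZF\<close>, and both factors
  are at most \<open>ZF\<close>.\<close>

lemma job_type_bound: "n * d \<le> n * L + ZF * ZF"
proof (cases "d \<le> L")
  case True
  then have "n * d \<le> n * L" by (rule mult_le_mono2)
  then show ?thesis by (rule trans_le_add1)
next
  case False
  then have "(2 :: nat) ^ L \<le> 2 ^ d" by (intro power_increasing) auto
  then have n: "n \<le> ZF" using n_less size_bounds(10) by linarith
  have "d \<le> ZF" using size_bounds(6) by (simp add: D_def)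
  with n have "n * d \<le> ZF * ZF" by (rule mult_le_mono)
  then show ?thesis by (rule trans_le_add2)
qed

text \<open>All accuracy parameters are replaced by \<open>M = ZF\<close>. Comparing
  \<open>L + 1\<close> with \<open>M ^ 3\<close> separates the mixed term
  \<open>(L + 1) * M ^ 3\<close>, which produces the sixth power; the square of \<open>L + 1\<close>
  is absorbed by \<open>n * (L + 1)\<close>.\<close>

lemma t_main_le: "t_main + 20 \<le> 22000 * (n * (L + 1)) + 16000 * ZF ^ 6"
proof -
  note sb = size_bounds
  define M where "M = ZF"
  define X where "X = (L + 1) * M ^ 3"
  have M1: "1 \<le> M" using sb(9) by (simp add: M_def)
  have M3: "M ^ 3 = M * M * M" by (simp add: power3_eq_cube)
  have MM: "M \<le> M * M" "M * M \<le> M * M * M" using M1 by simp_all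
  have X1: "M * M * M \<le> X" unfolding X_def M3 by simp
  have XL: "L * (M * M * M) \<le> X" unfolding X_def M3 by simp
  have LM: "L * M \<le> L * (M * M * M)" "L \<le> L * (M * M * M)" using MM M1 by simp_all
  have bnd: "B ^ D \<le> M" "ZB \<le> M" "N \<le> M" "K \<le> M" "K ^ 2 \<le> M" "D \<le> M" "kap \<le> M" "d \<le> M" "ZF \<le> M"
    using sb by (auto simp: M_def D_def)
  have kd: "kap \<le> d" "K \<le> d" using sb by auto
  have "t_dp \<le> 2 * M * (L * (M * (200 * M + 100 * M) + M * 200 + 300 * M) + 200 * M) + L * 30 + 200"
    using bnd M1 by (intro add_mono mult_mono order_refl) auto
  also have "\<dots> = 600 * (L * (M * M * M)) + 1000 * (L * (M * M)) + 400 * (M * M) + 30 * L + 200"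
    by (simp add: algebra_simps)
  also have "L * (M * M) \<le> L * (M * M * M)" using MM by simp
  finally have dp: "t_dp \<le> 2300 * X" using XL X1 MM M1 LM by linarith
  have "t_weights \<le> M * (160 * M + 400 * M) + 160 * M + 400 * M"
    using bnd M1 by (intro add_mono mult_mono order_refl) auto
  also have "\<dots> = 560 * (M * M) + 560 * M" by (simp add: algebra_simps)
  finally have weights: "t_weights \<le> 1200 * X" using X1 MM by linarith
  have "t_list \<le> M * (200 * M + 160 * M + 500 * M) + 50 * M"
    using bnd M1 by (intro add_mono mult_mono order_refl) auto
  also have "\<dots> = 860 * (M * M) + 50 * M" by (simp add: algebra_simps)
  finally have lst: "t_list \<le> 1000 * X" using X1 MM by linarith
  have "t_bits \<le> M * (150 * L + 100) + 50 * M"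
    using bnd M1 by (intro add_mono mult_mono order_refl) auto
  also have "\<dots> = 150 * (L * M) + 150 * M" by (simp add: algebra_simps)
  finally have bits: "t_bits \<le> 300 * X" using X1 MM XL LM by linarith
  have "t_back \<le> L * M * 200 + 50 * M" using M1 by (simp add: M_def)
  then have bck: "t_back \<le> 300 * X" using X1 MM XL LM by linarith
  have "t_assign \<le> (n * (2 * d * 220 + 200)) + M * (2 * M * 220 + 200 * M) + 60 * M"
    unfolding add_mult_distrib using bnd kd M1 m_less by (intro add_mono mult_mono order_refl) auto
  also have "\<dots> = 440 * (n * d) + 200 * n + 640 * (M * M) + 60 * M" by (simp add: algebra_simps)
  finally have assign: "t_assign \<le> 440 * (n * d) + 200 * n + 700 * X" using X1 MM by linarith
  have XM: "M \<le> X" "1 \<le> X" "L \<le> X" using X1 XL MM M1 LM by linarith+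
  have "t_small = 300 * n + 300 * m + 60" by simp
  then have small: "t_small \<le> 600 * n + 60 * X" using m_less XM(2) by linarith
  have nk: "n * kap \<le> n * d" using kd(1) by (rule mult_le_mono2)
  have "t_read = 100 * (n * L) + 80 * (n * kap) + 400 * n + 30" by (simp add: algebra_simps)
  then have rd: "t_read \<le> 100 * (n * L) + 80 * (n * d) + 400 * n + 30 * X" using nk XM(2) by linarith
  have "t_class = 100 * (n * d) + 200 * n + 100" by (simp add: algebra_simps)
  then have cls: "t_class \<le> 100 * (n * d) + 200 * n + 100 * X" using XM(2) by linarith
  have "kap + 1 \<le> 2 * X" "d + 1 \<le> 2 * X" "L + 1 \<le> 2 * X" using bnd(7,8) XM by simp_all
  then have rest: "40 * (kap + 1) \<le> 80 * X" "100 * (kap + 1) \<le> 200 * X" "500 * (kap + 1) \<le> 1000 * X"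
    "200 * (d + 1) \<le> 400 * X" "100 * (L + 1) \<le> 200 * X" by simp_all
  have pr: "t_print \<le> 60 * n + 30 * X" using XM(2) by simp
  have nd: "n * d \<le> n * L + X" using job_type_bound X1 MM(2) unfolding M_def[symmetric] by linarith
  \<comment> \<open>Stated for variables, so that linear arithmetic treats the products as
    atoms.\<close>
  have sum: "x1 + (x2 + (x3 + (x4 + (x5 + (x6 + (x7 + (x8 + (x9 + (x10 + (x11 + (x12 + (x13 + (x14 + x15)))))))))))))
      + 20 \<le> 720 * nl + 1460 * n + 10000 * X"
    if "x1 \<le> 80 * X" "x2 \<le> 200 * X" "x3 \<le> 100 * nl + 80 * nd + 400 * n + 30 * X" "x4 \<le> 200 * X" "x5 \<le> 400 * X"
      "x6 \<le> 100 * nd + 200 * n + 100 * X" "x7 \<le> 1000 * X" "x8 \<le> 1200 * X" "x9 \<le> 1000 * X" "x10 \<le> 300 * X"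
      "x11 \<le> 2300 * X" "x12 \<le> 300 * X" "x13 \<le> 440 * nd + 200 * n + 700 * X" "x14 \<le> 600 * n + 60 * X"
      "x15 \<le> 60 * n + 30 * X" "nd \<le> nl + X" "1 \<le> X"
    for x1 x2 x3 x4 x5 x6 x7 x8 x9 x10 x11 x12 x13 x14 x15 nl nd n X :: nat
    using that by linarith
  have "t_main + 20 \<le> 720 * (n * L) + 1460 * n + 10000 * X"
    unfolding t_main_def
    by (rule sum[OF rest(1) rest(5) rd rest(2) rest(4) cls rest(3) weights lst bits dp bck assign small pr nd XM(2)])
  also have "X \<le> (L + 1) ^ 2 + M ^ 6"
  proof -
    have "X \<le> (L + 1) * (L + 1) + M ^ 3 * M ^ 3"
      unfolding X_def
    proof (cases "L + 1 \<le> M ^ 3")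
      case True
      then have "(L + 1) * M ^ 3 \<le> M ^ 3 * M ^ 3" by (rule mult_right_mono) simp
      then show "(L + 1) * M ^ 3 \<le> (L + 1) * (L + 1) + M ^ 3 * M ^ 3" by linarith
    next
      case False
      then have "(L + 1) * M ^ 3 \<le> (L + 1) * (L + 1)" by (intro mult_left_mono) auto
      then show "(L + 1) * M ^ 3 \<le> (L + 1) * (L + 1) + M ^ 3 * M ^ 3" by linarith
    qed
    then show ?thesis by (simp add: power2_eq_square flip: power_add)
  qed
  also have "(L + 1) ^ 2 \<le> 2 * (n * (L + 1))"
  proof -
    have "L + 1 \<le> 2 * n" using less_exp[of L] pow_L_le by linarith
    then have "(L + 1) * (L + 1) \<le> 2 * n * (L + 1)" by (rule mult_right_mono) simp
    then show ?thesis by (simp add: power2_eq_square mult.assoc)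
  qed
  finally have "t_main + 20 \<le> 720 * (n * L) + 1460 * n + 10000 * (2 * (n * (L + 1)) + M ^ 6)" by simp
  then show ?thesis by (simp add: M_def algebra_simps)
qed

end

text \<open>Bounds the binary logarithm of \<open>16000 * ZF ^ 6\<close>: 14 for the constant,
  \<open>7 + 4 * kap\<close> for \<open>R\<close> with \<open>kap <= log 2 k + 1\<close>, and the
  last factor for \<open>D\<close>, using \<open>K <= 2 * k\<close>. It is of order \<open>k\<close>
  times the square of \<open>log 2 k\<close>.\<close>

definition exponent :: "real \<Rightarrow> real" where
  "exponent k = 14 + 6 * ((11 + 4 * log 2 k) * ((log 2 k + 2) * (2 * k) + 1))"

lemma exponent_mono: "1 \<le> x \<Longrightarrow> x \<le> y \<Longrightarrow> exponent x \<le> exponent y"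
  unfolding exponent_def by (intro add_mono mult_mono order_refl) (auto intro!: mult_nonneg_nonneg add_nonneg_nonneg)

lemma (in sched) table_size_le: "16000 * real ZF ^ 6 \<le> 2 powr exponent (real k)"
proof -
  have k: "real k \<ge> 1" using k_pos by simp
  have "2 ^ kap \<le> 2 * k" using K_le by (simp add: K_def)
  then have K2: "2 ^ kap \<le> 2 * real k" by (metis of_nat_le_iff of_nat_mult of_nat_numeral of_nat_power)
  then have "log 2 (2 ^ kap) \<le> log 2 (2 * real k)" using k by (subst log_le_cancel_iff) auto
  then have kap: "real kap \<le> log 2 (real k) + 1" using k by (simp add: log_mult)
  have D: "real D \<le> (log 2 (real k) + 2) * (2 * real k) + 1"
  proof -
    have e: "real D = (real kap + 1) * real K + 1" by (simp add: D_def d_def algebra_simps)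
    have K: "real K \<le> 2 * real k" using K_le by linarith
    have kap': "real kap + 1 \<le> log 2 (real k) + 2" using kap by linarith
    have "(real kap + 1) * real K \<le> (log 2 (real k) + 2) * (2 * real k)"
      using kap' K
    proof (rule mult_mono)
      show "0 \<le> log 2 (real k) + 2" using kap' by linarith
    qed simp
    with e show ?thesis by linarith
  qed
  have "16000 * real ZF ^ 6 \<le> 2 ^ 14 * 2 ^ ((7 + 4 * kap) * D * 6)"
    unfolding ZF_def pow_forms(1) by (simp add: power_mult)
  also have "\<dots> = 2 powr (14 + 6 * ((7 + 4 * real kap) * real D))"
    by (simp add: powr_realpow[symmetric] powr_add algebra_simps)
  also have "\<dots> \<le> 2 powr exponent (real k)"
  proof (rule powr_mono)
    have a: "7 + 4 * real kap \<le> 11 + 4 * log 2 (real k)" using kap by simp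
    have "(7 + 4 * real kap) * real D \<le> (11 + 4 * log 2 (real k)) * ((log 2 (real k) + 2) * (2 * real k) + 1)"
      using a D
    proof (rule mult_mono)
      show "0 \<le> 11 + 4 * log 2 (real k)" using a by linarith
    qed simp
    then show "14 + 6 * ((7 + 4 * real kap) * real D) \<le> exponent (real k)" unfolding exponent_def by linarith
  qed simp
  finally show ?thesis .
qed

lemma (in sched) t_main_real: "real (t_main + 20) \<le> 2 powr exponent (real k) + 22000 * (real n * (log 2 (real n) + 2))"
proof -
  have n1: "real n \<ge> 1" using n_pos by simp
  have "2 ^ L \<le> 2 * real n" using pow_L_le by (metis of_nat_le_iff of_nat_mult of_nat_numeral of_nat_power)
  then have "log 2 (2 ^ L) \<le> log 2 (2 * real n)" using n1 by (subst log_le_cancel_iff) auto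
  then have L: "real L + 1 \<le> log 2 (real n) + 2" using n1 by (simp add: log_mult)
  have "real (t_main + 20) \<le> real (22000 * (n * (L + 1)) + 16000 * ZF ^ 6)" using t_main_le by (simp only: of_nat_le_iff)
  also have "\<dots> = 22000 * (real n * (real L + 1)) + 16000 * real ZF ^ 6" by (simp add: algebra_simps)
  also have "\<dots> \<le> 22000 * (real n * (log 2 (real n) + 2)) + 2 powr exponent (real k)"
  proof (rule add_mono[OF _ table_size_le])
    have "real n * (real L + 1) \<le> real n * (log 2 (real n) + 2)" using L by (rule mult_left_mono) simp
    then show "22000 * (real n * (real L + 1)) \<le> 22000 * (real n * (log 2 (real n) + 2))" by simp
  qed
  finally show ?thesis by simp
qed

text \<open>Monotonicity replaces the ceiling by \<open>1 / eps + 1\<close>, which leaves an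
  elementary function of \<open>eps\<close>.\<close>

lemma exponent_bigo: "(\<lambda>\<epsilon>. exponent (real_of_int \<lceil>1 / \<epsilon>\<rceil>)) \<in> O[at_right 0](\<lambda>\<epsilon>. (1 / \<epsilon>) * (log 2 (1 / \<epsilon>)) ^ 4)"
proof (rule landau_o.big_trans)
  have "exponent (1 / \<epsilon> + 1) \<ge> exponent (real_of_int \<lceil>1 / \<epsilon>\<rceil>) \<and> exponent (real_of_int \<lceil>1 / \<epsilon>\<rceil>) \<ge> 0" if "\<epsilon> > 0" for \<epsilon> :: real
  proof
    have "1 / \<epsilon> > 0" using that by simp
    then have "0 < \<lceil>1 / \<epsilon>\<rceil>" by (simp only: zero_less_ceiling)
    then have 1: "1 \<le> real_of_int \<lceil>1 / \<epsilon>\<rceil>" by linarith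
    then show "exponent (real_of_int \<lceil>1 / \<epsilon>\<rceil>) \<le> exponent (1 / \<epsilon> + 1)"
      by (intro exponent_mono of_int_ceiling_le_add_one)
    have "0 \<le> exponent 1" by (simp add: exponent_def)
    also have "\<dots> \<le> exponent (real_of_int \<lceil>1 / \<epsilon>\<rceil>)" using 1 by (intro exponent_mono) auto
    finally show "0 \<le> exponent (real_of_int \<lceil>1 / \<epsilon>\<rceil>)" .
  qed
  then have "eventually (\<lambda>\<epsilon>. norm (exponent (real_of_int \<lceil>1 / \<epsilon>\<rceil>)) \<le> 1 * norm (exponent (1 / \<epsilon> + 1))) (at_right (0 :: real))"
    by (intro eventually_at_right_less[THEN eventually_mono]) force
  then show "(\<lambda>\<epsilon>. exponent (real_of_int \<lceil>1 / \<epsilon>\<rceil>)) \<in> O[at_right 0](\<lambda>\<epsilon>. exponent (1 / \<epsilon> + 1))"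
    by (rule landau_o.bigI[rotated]) simp
  show "(\<lambda>\<epsilon>. exponent (1 / \<epsilon> + 1)) \<in> O[at_right 0](\<lambda>\<epsilon>. (1 / \<epsilon>) * (log 2 (1 / \<epsilon>)) ^ 4)"
    unfolding exponent_def by real_asymp
qed

section \<open>Instances with at least as many machines as jobs, and the final assembly\<close>

lemma ht_output_identity:
  assumes "vars s vn = int n" "outs s = []"
  shows "ht output_identity s (n * 40 + 30) (\<lambda>s'. outs s' = map int [0..<n])"
  unfolding output_identity_def
proof (rule ht_block[where U = "n * 40 + 20"], goal_cases)
  case (2 s1)
  let ?I = "\<lambda>j s'. vars s' vj = int j \<and> outs s' = map int [0..<j]"
  have s1: "vars s1 vn = int n" "?I 0 s1" using 2 assms by simp_all
  show ?case
  proof (rule ht_For[where I = ?I and N = n and T = 20], goal_cases)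
    case (2 j s2)
    then show ?case by (intro ht_straight) auto
  qed (use s1 in \<open>auto simp: same_def\<close>)
qed auto

text \<open>With one job per machine the makespan is the largest processing time, or 0 without jobs,
  and no schedule can do better.\<close>

lemma many_machines:
  assumes inst: "is_instance n m p" and le: "n \<le> m"
  shows "restrict id {..<n} \<in> assignments n m" "makespan n m p (restrict id {..<n}) \<le> opt_makespan n m p" "0 \<le> opt_makespan n m p"
proof -
  let ?a = "restrict id {..<n} :: nat \<Rightarrow> nat"
  show a: "?a \<in> assignments n m" using le by (auto simp: assignments_def)
  have fin: "finite (assignments n m)" by (simp add: assignments_def finite_PiE)
  have m: "m \<ge> 1" and pos: "\<And>j. j < n \<Longrightarrow> p j > 0" using inst by (auto simp: is_instance_def)
  have "opt_makespan n m p \<in> makespan n m p ` assignments n m"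
    unfolding opt_makespan_def using fin a by (intro Min_in) auto
  then obtain b where b: "b \<in> assignments n m" "opt_makespan n m p = makespan n m p b" by auto
  have load: "(\<Sum>j | j < n \<and> b j = i. p j) \<le> opt_makespan n m p" if "i < m" for i
    unfolding b(2) makespan_def using that by (intro Max_ge) auto
  have "0 \<le> (\<Sum>j | j < n \<and> b j = 0. p j)" using pos by (intro sum_nonneg) (auto simp: less_imp_le)
  with load[of 0] m show nonneg: "0 \<le> opt_makespan n m p" by linarith
  show "makespan n m p ?a \<le> opt_makespan n m p"
    unfolding makespan_def
  proof (rule Max.boundedI)
    show "(\<lambda>i. \<Sum>j | j < n \<and> ?a j = i. p j) ` {..<m} \<noteq> {}" using m by (auto simp: lessThan_empty_iff)
    fix x assume "x \<in> (\<lambda>i. \<Sum>j | j < n \<and> ?a j = i. p j) ` {..<m}"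
    then obtain i where x: "x = (\<Sum>j | j < n \<and> ?a j = i. p j)" by auto
    show "x \<le> opt_makespan n m p"
    proof (cases "i < n")
      case True
      then have "{j. j < n \<and> ?a j = i} = {i}" by auto
      then have "x = p i" using x by simp
      also have "\<dots> \<le> (\<Sum>j | j < n \<and> b j = b i. p j)"
        using True pos by (intro member_le_sum) (auto simp: less_imp_le)
      also have "\<dots> \<le> opt_makespan n m p" using b(1) True by (intro load) (auto simp: assignments_def)
      finally show ?thesis .
    next
      case False
      then have "{j. j < n \<and> ?a j = i} = {}" by auto
      then have "x = 0" using x by simp
      with nonneg show ?thesis by simp
    qed
  qed simp
qed

lemma ht_eptas:
  assumes inps: "inps s = int k # int n # int m # xs" and zero: "arrs s = (\<lambda>_ _. 0)" and outs: "outs s = []"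
    and body: "\<And>s'. vars s' vk = int k \<Longrightarrow> vars s' vn = int n \<Longrightarrow> vars s' vm = int m \<Longrightarrow> inps s' = xs \<Longrightarrow>
      arrs s' = (\<lambda>_ _. 0) \<Longrightarrow> outs s' = [] \<Longrightarrow> ht (if m < n then schedule else output_identity) s' T Q"
  shows "ht eptas s (T + 20) Q"
  unfolding eptas_def
proof (rule ht_Seq[OF ht_Get[OF inps, where Q = "\<lambda>s'. s' = s\<lparr>vars := (vars s)(vk := int k), inps := int n # int m # xs\<rparr>"],
    where U = "T + 15"], goal_cases)
  case (2 s1)
  have i1: "inps s1 = int n # int m # xs" using 2(1) by simp
  show ?case
  proof (rule ht_Seq[OF ht_Get[OF i1, where Q = "\<lambda>s'. s' = s1\<lparr>vars := (vars s1)(vn := int n), inps := int m # xs\<rparr>"],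
      where U = "T + 14"], goal_cases)
    case (2 s2)
    have i2: "inps s2 = int m # xs" using 2(1) by simp
    show ?case
    proof (rule ht_Seq[OF ht_Get[OF i2, where Q = "\<lambda>s'. s' = s2\<lparr>vars := (vars s2)(vm := int m), inps := xs\<rparr>"],
        where U = "T + 13"], goal_cases)
      case (2 s3)
      have s3: "vars s3 vk = int k" "vars s3 vn = int n" "vars s3 vm = int m" "inps s3 = xs" "arrs s3 = (\<lambda>_ _. 0)" "outs s3 = []"
        using 2(1) \<open>s2 = _\<close> \<open>s1 = _\<close> zero outs by simp_all
      show ?case
        by (rule ht_Cond[where T = T]) (use body[OF s3] s3 in \<open>auto split: if_splits\<close>)
    qed auto
  qed auto
qed auto

theorem theorem10:
  "\<exists>(P :: program) (g :: real \<Rightarrow> real) (h :: nat \<Rightarrow> real).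
     g \<in> O[at_right 0](\<lambda>\<epsilon>. (1 / \<epsilon>) * (log 2 (1 / \<epsilon>)) ^ 4) \<and>
     h \<in> O(\<lambda>n. real n * log 2 (real n)) \<and>
     approx_scheme_within P (\<lambda>\<epsilon> n. 2 powr g \<epsilon> + h n)"
proof (intro exI conjI)
  let ?g = "\<lambda>\<epsilon>. exponent (real_of_int \<lceil>1 / \<epsilon>\<rceil>)"
  let ?h = "\<lambda>n. 22000 * (real n * (log 2 (real n) + 2))"
  show "?g \<in> O[at_right 0](\<lambda>\<epsilon>. (1 / \<epsilon>) * (log 2 (1 / \<epsilon>)) ^ 4)" by (rule exponent_bigo)
  show "?h \<in> O(\<lambda>n. real n * log 2 (real n))" by real_asymp
  show "approx_scheme_within (comp eptas 0) (\<lambda>\<epsilon> n. 2 powr ?g \<epsilon> + ?h n)"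
    unfolding approx_scheme_within_def
  proof (intro allI impI)
    fix \<epsilon> :: real and n m :: nat and p :: "nat \<Rightarrow> int"
    assume \<epsilon>: "\<epsilon> > 0" and inst: "is_instance n m p"
    define k where "k = nat \<lceil>1 / \<epsilon>\<rceil>"
    have "1 / \<epsilon> > 0" using \<epsilon> by simp
    then have "0 < \<lceil>1 / \<epsilon>\<rceil>" by (simp only: zero_less_ceiling)
    then have k: "int k = \<lceil>1 / \<epsilon>\<rceil>" "1 \<le> k" unfolding k_def by linarith+
    from k(1) have rk: "real_of_int \<lceil>1 / \<epsilon>\<rceil> = real k" by (metis of_int_of_nat_eq)
    let ?xs = "encode_input \<epsilon> n m p"
    have init: "inps (initial ?xs) = int k # int n # int m # map p [0..<n]" "arrs (initial ?xs) = (\<lambda>_ _. 0)"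
      "outs (initial ?xs) = []"
      by (simp_all add: initial_def encode_input_def k)
    have run: "\<exists>t. \<exists>a\<in>assignments n m. computes_in (comp eptas 0) ?xs t (encode_output n a) \<and>
        real t \<le> 2 powr ?g \<epsilon> + ?h n \<and> real_of_int (makespan n m p a) \<le> (1 + \<epsilon>) * real_of_int (opt_makespan n m p)"
      if ht: "ht eptas (initial ?xs) T (\<lambda>s. \<exists>a\<in>assignments n m. outs s = encode_output n a \<and>
          real_of_int (makespan n m p a) \<le> (1 + \<epsilon>) * real_of_int (opt_makespan n m p))"
        and T: "real T \<le> 2 powr ?g \<epsilon> + ?h n" for T
    proof -
      from ht obtain t s a where *: "exe eptas (initial ?xs) t s" "t \<le> T" "a \<in> assignments n m" "outs s = encode_output n a"
        "real_of_int (makespan n m p a) \<le> (1 + \<epsilon>) * real_of_int (opt_makespan n m p)"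
        unfolding ht_def by blast
      from comp_computes[OF *(1) cwf_eptas] obtain t' where "t' \<le> t" "computes_in (comp eptas 0) ?xs t' (outs s)" by blast
      moreover from this *(2) T have "real t' \<le> 2 powr ?g \<epsilon> + ?h n" by linarith
      ultimately show ?thesis using * by auto
    qed
    show "\<exists>t. \<exists>a\<in>assignments n m. computes_in (comp eptas 0) ?xs t (encode_output n a) \<and>
        real t \<le> 2 powr ?g \<epsilon> + ?h n \<and> real_of_int (makespan n m p a) \<le> (1 + \<epsilon>) * real_of_int (opt_makespan n m p)"
    proof (cases "m < n")
      case True
      interpret sched n m k p
        using inst True k(2) by unfold_locales (auto simp: is_instance_def)
      show ?thesis
      proof (rule run[of "t_main + 20"])
        show "real (t_main + 20) \<le> 2 powr ?g \<epsilon> + ?h n" unfolding rk by (rule t_main_real)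
        show "ht eptas (initial ?xs) (t_main + 20) (\<lambda>s. \<exists>a\<in>assignments n m. outs s = encode_output n a \<and>
          real_of_int (makespan n m p a) \<le> (1 + \<epsilon>) * real_of_int (opt_makespan n m p))"
        proof (rule ht_eptas[OF init])
          fix s :: store
          assume s: "vars s vk = int k" "vars s vn = int n" "vars s vm = int m" "inps s = map p [0..<n]"
            "arrs s = (\<lambda>_ _. 0)" "outs s = []"
          have "ht schedule s t_main (\<lambda>s. \<exists>a\<in>assignments n m. outs s = encode_output n a \<and>
            real_of_int (makespan n m p a) \<le> (1 + \<epsilon>) * real_of_int (opt_makespan n m p))"
          proof (rule ht_mono[OF ht_schedule[OF s] order_refl])
            fix s' assume "\<exists>a. outs s' = map (\<lambda>j. int (a j)) [0..<n] \<and> (\<forall>j<n. a j < m) \<and>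
              (\<forall>i<m. int K * (\<Sum>j | j < n \<and> a j = i. JP j) \<le> (int K + 1) * opt)"
            then obtain a where a: "outs s' = map (\<lambda>j. int (a j)) [0..<n]" "\<And>j. j < n \<Longrightarrow> a j < m"
              "\<And>i. i < m \<Longrightarrow> int K * (\<Sum>j | j < n \<and> a j = i. JP j) \<le> (int K + 1) * opt" by blast
            have "outs s' = encode_output n (restrict a {..<n})" using a(1) by (simp add: encode_output_def)
            with approximation[OF a(2,3) \<epsilon> k(1)]
            show "\<exists>a\<in>assignments n m. outs s' = encode_output n a \<and>
              real_of_int (makespan n m p a) \<le> (1 + \<epsilon>) * real_of_int (opt_makespan n m p)" by blast
          qed
          then show "ht (if m < n then schedule else output_identity) s t_main (\<lambda>s. \<exists>a\<in>assignments n m. outs s = encode_output n a \<and>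
            real_of_int (makespan n m p a) \<le> (1 + \<epsilon>) * real_of_int (opt_makespan n m p))" using True by simp
        qed
      qed
    next
      case False
      then have le: "n \<le> m" by simp
      note triv = many_machines[OF inst le]
      show ?thesis
      proof (rule run[of "n * 40 + 30 + 20"])
        \<comment> \<open>The constant part 50 of the running time is paid by
          \<open>2 powr 14\<close>; for \<open>n = 0\<close> the summand \<open>?h n\<close> is
          0.\<close>
        have "exponent 1 \<le> ?g \<epsilon>" unfolding rk using k(2) by (intro exponent_mono) auto
        then have "14 \<le> ?g \<epsilon>" by (simp add: exponent_def)
        then have "(2 :: real) powr 14 \<le> 2 powr ?g \<epsilon>" by (rule powr_mono) simp
        moreover have "(2 :: real) powr 14 = 16384" by simp
        moreover have "real n * 2 \<le> real n * (log 2 (real n) + 2)"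
        proof (cases "n = 0")
          case False
          then have "0 \<le> log 2 (real n)" by simp
          then show ?thesis by (intro mult_left_mono) simp_all
        qed simp
        ultimately show "real (n * 40 + 30 + 20) \<le> 2 powr ?g \<epsilon> + ?h n" by simp
        show "ht eptas (initial ?xs) (n * 40 + 30 + 20) (\<lambda>s. \<exists>a\<in>assignments n m. outs s = encode_output n a \<and>
          real_of_int (makespan n m p a) \<le> (1 + \<epsilon>) * real_of_int (opt_makespan n m p))"
        proof (rule ht_eptas[OF init])
          fix s :: store
          assume s: "vars s vk = int k" "vars s vn = int n" "vars s vm = int m" "inps s = map p [0..<n]"
            "arrs s = (\<lambda>_ _. 0)" "outs s = []"
          have "ht output_identity s (n * 40 + 30) (\<lambda>s. \<exists>a\<in>assignments n m. outs s = encode_output n a \<and>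
            real_of_int (makespan n m p a) \<le> (1 + \<epsilon>) * real_of_int (opt_makespan n m p))"
          proof (rule ht_mono[OF ht_output_identity[OF s(2,6)] order_refl])
            fix s' assume "outs s' = map int [0..<n]"
            then have "outs s' = encode_output n (restrict id {..<n})" by (simp add: encode_output_def)
            moreover have "real_of_int (makespan n m p (restrict id {..<n})) \<le> real_of_int (opt_makespan n m p)"
              using triv(2) by (simp only: of_int_le_iff)
            moreover have "real_of_int (opt_makespan n m p) \<le> (1 + \<epsilon>) * real_of_int (opt_makespan n m p)"
              using triv(3) \<epsilon> by (simp add: distrib_right)
            ultimately show "\<exists>a\<in>assignments n m. outs s' = encode_output n a \<and>
              real_of_int (makespan n m p a) \<le> (1 + \<epsilon>) * real_of_int (opt_makespan n m p)"
              using triv(1) by (intro bexI[of _ "restrict id {..<n}"]) auto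
          qed
          then show "ht (if m < n then schedule else output_identity) s (n * 40 + 30) (\<lambda>s. \<exists>a\<in>assignments n m. outs s = encode_output n a \<and>
            real_of_int (makespan n m p a) \<le> (1 + \<epsilon>) * real_of_int (opt_makespan n m p))" using False by simp
        qed
      qed
    qed
  qed
qed

end
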